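(* Let $r,p,n$ be positive integers with $p$ dividing $r$. Then the representation $\rho_{r,p,n}$ is a Gelfand model for $G(r,p,n)$ if and only if $\gcd(p,n)=1$ and at least one of $p$, $r/p$ is odd.
   Context: $\mathbb Z_r$ is the cyclic group of integers $[0,r-1]=\{0,\dots,r-1\}$ modulo $r$. $S_n$ acts on $(\mathbb Z_r)^n$ by $\pi(x)=(x_{\pi^{-1}(1)},\dots,x_{\pi^{-1}(n)})$. The group $G(r,1,n)=\mathbb Z_r\wr S_n$ is the set of pairs $(x,\pi)$, $x\in(\mathbb Z_r)^n$, $\pi\in S_n$, with $(x,\pi)(y,\sigma)=(\sigma^{-1}(x)+y,\pi\sigma)$. For $g=(x,\pi)$ set $|g|=\pi$, $z_g(i)=x_i$, $\overline g=(-x,\pi)$, $g^T=\overline{g^{-1}}=(\pi(x),\pi^{-1})$, $\Delta(g)=x_1+\dots+x_n\in\mathbb Z_r$. For $p$ dividing $r$, $G(r,p,n)=\{g\in\mathbb Z_r\wr S_n:\Delta(g)\in p\mathbb Z_r\}$. For $\pi\in S_n$ let $\mathrm{Inv}(\pi)=\{(i,j):1\le i<j\le n,\ \pi(i)>\pi(j)\}$, $\mathrm{Pair}(\pi)=\{(i,j):1\le i<j\le n,\ \pi(i)=j,\ \pi(j)=i\}$, and $\mathrm{Fix}(\pi)=\{i:\pi(i)=i\}$. For $g,\omega\in G(r,1,n)$ define $B(g,\omega)=\varnothing$ if $r$ is odd; if $r$ is even, $B(g,\omega)$ is the set of $i\in\mathrm{Fix}(|\omega|)$ such that $z_\omega(i)$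 is odd and $z_g(i)+k\in[r/2,r-1]$ for the $k\in[0,r/2-1]$ with $2k+1=z_\omega(i)$ (the sum $z_g(i)+k$ is taken in $\mathbb Z_r$, and elements of $\mathbb Z_r$ are identified with integers in $[0,r-1]$). Put $$\mathrm{sign}_{r,n}(g,\omega)=(-1)^{|B(g,\omega)|}\cdot(-1)^{|\mathrm{Inv}(|g|)\cap\mathrm{Pair}(|\omega|)|}.$$ Let $\mathcal V_{r,p,n}$ be the $\mathbb Q$-vector space with basis the symbols $C_\omega$, $\omega\in G(r,p,n)$ with $\omega^T=\omega$. The representation $\rho_{r,p,n}:G(r,p,n)\to\mathrm{GL}(\mathcal V_{r,p,n})$ is $$\rho_{r,p,n}(g)C_\omega=\mathrm{sign}_{r,n}(g,\omega)\cdot C_{g\omega g^T},\qquad g,\omega\in G(r,p,n),\ \omega^T=\omega.$$ A Gelfand model for a finite group $G$ is a representation equivalent to the multiplicity-free sum of all irreducible (complex) representations of $G$, i.e. one whose character is $\sum_{\psi\in\mathrm{Irr}(G)}\psi$. *)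

theory Defs
  imports Complex_Main "HOL-Algebra.Algebra"
begin

text \<open>
  The vector space over \<open>'k\<close> with basis indexed by \<open>I\<close> is realised as the set of functions
  vanishing outside \<open>I\<close>, with pointwise operations.  For \<open>I = {..<d}\<close> this is the coordinate space
  of dimension \<open>d\<close>.
\<close>

definition coord_space :: "'i set \<Rightarrow> ('i \<Rightarrow> 'k::field) set" where
  "coord_space I = {v. \<forall>i. i \<notin> I \<longrightarrow> v i = 0}"

definition unit_vec_at :: "'i \<Rightarrow> 'i \<Rightarrow> 'k::field" where
  "unit_vec_at i = (\<lambda>j. if j = i then 1 else 0)"

definition linear_on_space :: "('i \<Rightarrow> 'k::field) set \<Rightarrow> (('i \<Rightarrow> 'k) \<Rightarrow> ('i \<Rightarrow> 'k)) \<Rightarrow> bool" where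
  "linear_on_space V f \<longleftrightarrow>
     (\<forall>u\<in>V. \<forall>v\<in>V. f (\<lambda>i. u i + v i) = (\<lambda>i. f u i + f v i)) \<and>
     (\<forall>c. \<forall>v\<in>V. f (\<lambda>i. c * v i) = (\<lambda>i. c * f v i))"

definition linear_subspace :: "('i \<Rightarrow> 'k::field) set \<Rightarrow> ('i \<Rightarrow> 'k) set \<Rightarrow> bool" where
  "linear_subspace V W \<longleftrightarrow>
     W \<subseteq> V \<and> (\<lambda>i. 0) \<in> W \<and>
     (\<forall>u\<in>W. \<forall>v\<in>W. (\<lambda>i. u i + v i) \<in> W) \<and>
     (\<forall>c. \<forall>v\<in>W. (\<lambda>i. c * v i) \<in> W)"

text \<open>
  \<open>group_action G V R\<close> says that \<open>R\<close> is a group homomorphism from \<open>G\<close> to the bijections of \<open>V\<close>;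
  with linearity this is a homomorphism from \<open>G\<close> to \<open>GL(V)\<close>.
\<close>

definition representation ::
    "('g, 'm) monoid_scheme \<Rightarrow> 'i set \<Rightarrow> ('g \<Rightarrow> ('i \<Rightarrow> 'k::field) \<Rightarrow> ('i \<Rightarrow> 'k)) \<Rightarrow> bool" where
  "representation G I R \<longleftrightarrow>
     finite I \<and> group_action G (coord_space I) R \<and>
     (\<forall>g\<in>carrier G. linear_on_space (coord_space I) (R g))"

definition irreducible_representation ::
    "('g, 'm) monoid_scheme \<Rightarrow> 'i set \<Rightarrow> ('g \<Rightarrow> ('i \<Rightarrow> 'k::field) \<Rightarrow> ('i \<Rightarrow> 'k)) \<Rightarrow> bool" where
  "irreducible_representation G I R \<longleftrightarrow>
     representation G I R \<and> I \<noteq> {} \<and>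
     (\<forall>W. linear_subspace (coord_space I) W \<and> (\<forall>g\<in>carrier G. R g ` W \<subseteq> W)
        \<longrightarrow> W = {\<lambda>i. 0} \<or> W = coord_space I)"

text \<open>The character at \<open>g\<close> is the trace of \<open>R g\<close>, read off in the standard basis.\<close>

definition rep_character ::
    "'i set \<Rightarrow> ('g \<Rightarrow> ('i \<Rightarrow> 'k::field) \<Rightarrow> ('i \<Rightarrow> 'k)) \<Rightarrow> 'g \<Rightarrow> 'k" where
  "rep_character I R g = (\<Sum>i\<in>I. R g (unit_vec_at i) i)"

text \<open>
  Every finite-dimensional complex representation is equivalent to one on some coordinate space, so
  these are all the irreducible characters.  They are restricted to the carrier so that each one
  occurs as exactly one element of the set.
\<close>

definition Irr :: "('g, 'm) monoid_scheme \<Rightarrow> ('g \<Rightarrow> complex) set" where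
  "Irr G = {restrict (rep_character {..<d} R) (carrier G) | (d::nat) R.
              irreducible_representation G {..<d} R}"

text \<open>A rational representation is compared with the complex characters by extension of scalars.\<close>

definition gelfand_model ::
    "('g, 'm) monoid_scheme \<Rightarrow> 'i set \<Rightarrow> ('g \<Rightarrow> ('i \<Rightarrow> rat) \<Rightarrow> ('i \<Rightarrow> rat)) \<Rightarrow> bool" where
  "gelfand_model G I R \<longleftrightarrow>
     representation G I R \<and>
     (\<forall>g\<in>carrier G. of_rat (rep_character I R g) = (\<Sum>\<psi>\<in>Irr G. \<psi> g))"

type_synonym wr = "(nat \<Rightarrow> int) \<times> (nat \<Rightarrow> nat)"

abbreviation Zr_pow :: "nat \<Rightarrow> nat \<Rightarrow> (nat \<Rightarrow> int) monoid" where
  "Zr_pow r n \<equiv> product_group {1..n} (\<lambda>i. integer_mod_group r)"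

definition perm_act :: "nat \<Rightarrow> (nat \<Rightarrow> nat) \<Rightarrow> (nat \<Rightarrow> int) \<Rightarrow> (nat \<Rightarrow> int)" where
  "perm_act n \<pi> x = (\<lambda>i\<in>{1..n}. x (inv' \<pi> i))"

definition wreath :: "nat \<Rightarrow> nat \<Rightarrow> wr monoid" where
  "wreath r n =
     \<lparr> carrier = carrier (Zr_pow r n) \<times> carrier (sym_group n),
       monoid.mult = (\<lambda>(x, \<pi>) (y, \<sigma>). (perm_act n (inv' \<sigma>) x \<otimes>\<^bsub>Zr_pow r n\<^esub> y, \<pi> \<otimes>\<^bsub>sym_group n\<^esub> \<sigma>)),
       one = (\<one>\<^bsub>Zr_pow r n\<^esub>, \<one>\<^bsub>sym_group n\<^esub>) \<rparr>"

abbreviation wr_perm :: "wr \<Rightarrow> nat \<Rightarrow> nat" where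
  "wr_perm g \<equiv> snd g"

abbreviation wr_col :: "wr \<Rightarrow> nat \<Rightarrow> int" where
  "wr_col g \<equiv> fst g"

definition wr_bar :: "nat \<Rightarrow> nat \<Rightarrow> wr \<Rightarrow> wr" where
  "wr_bar r n g = (inv\<^bsub>Zr_pow r n\<^esub> (fst g), snd g)"

definition wr_transpose :: "nat \<Rightarrow> nat \<Rightarrow> wr \<Rightarrow> wr" where
  "wr_transpose r n g = wr_bar r n (inv\<^bsub>wreath r n\<^esub> g)"

definition Delta :: "nat \<Rightarrow> nat \<Rightarrow> wr \<Rightarrow> int" where
  "Delta r n g = (\<Sum>i\<in>{1..n}. wr_col g i) mod int r"

definition multiples_mod :: "nat \<Rightarrow> nat \<Rightarrow> int set" where
  "multiples_mod p r = {(int p * z) mod int r | z. z \<in> carrier (integer_mod_group r)}"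

definition Grpn :: "nat \<Rightarrow> nat \<Rightarrow> nat \<Rightarrow> wr monoid" where
  "Grpn r p n =
     (wreath r n) \<lparr> carrier := {g \<in> carrier (wreath r n). Delta r n g \<in> multiples_mod p r} \<rparr>"

definition Inv_set :: "nat \<Rightarrow> (nat \<Rightarrow> nat) \<Rightarrow> (nat \<times> nat) set" where
  "Inv_set n \<pi> = {(i, j). 1 \<le> i \<and> i < j \<and> j \<le> n \<and> \<pi> i > \<pi> j}"

definition Pair_set :: "nat \<Rightarrow> (nat \<Rightarrow> nat) \<Rightarrow> (nat \<times> nat) set" where
  "Pair_set n \<pi> = {(i, j). 1 \<le> i \<and> i < j \<and> j \<le> n \<and> \<pi> i = j \<and> \<pi> j = i}"

definition Fix_set :: "nat \<Rightarrow> (nat \<Rightarrow> nat) \<Rightarrow> nat set" where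
  "Fix_set n \<pi> = {i \<in> {1..n}. \<pi> i = i}"

definition B_set :: "nat \<Rightarrow> nat \<Rightarrow> wr \<Rightarrow> wr \<Rightarrow> nat set" where
  "B_set r n g \<omega> =
     (if odd r then {}
      else {i \<in> Fix_set n (wr_perm \<omega>).
              odd (wr_col \<omega> i) \<and>
              (\<exists>k\<in>{0..int r div 2 - 1}. 2 * k + 1 = wr_col \<omega> i \<and>
                 wr_col g i \<otimes>\<^bsub>integer_mod_group r\<^esub> k \<in> {int r div 2..int r - 1})})"

definition sign_rn :: "nat \<Rightarrow> nat \<Rightarrow> wr \<Rightarrow> wr \<Rightarrow> rat" where
  "sign_rn r n g \<omega> =
     (-1) ^ card (B_set r n g \<omega>) *
     (-1) ^ card (Inv_set n (wr_perm g) \<inter> Pair_set n (wr_perm \<omega>))"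

definition sym_elts :: "nat \<Rightarrow> nat \<Rightarrow> nat \<Rightarrow> wr set" where
  "sym_elts r p n = {\<omega> \<in> carrier (Grpn r p n). wr_transpose r n \<omega> = \<omega>}"

abbreviation V_space :: "nat \<Rightarrow> nat \<Rightarrow> nat \<Rightarrow> (wr \<Rightarrow> rat) set" where
  "V_space r p n \<equiv> coord_space (sym_elts r p n)"

abbreviation C_basis :: "wr \<Rightarrow> wr \<Rightarrow> rat" where
  "C_basis \<omega> \<equiv> unit_vec_at \<omega>"

definition wr_twist :: "nat \<Rightarrow> nat \<Rightarrow> wr \<Rightarrow> wr \<Rightarrow> wr" where
  "wr_twist r n g \<omega> = g \<otimes>\<^bsub>wreath r n\<^esub> \<omega> \<otimes>\<^bsub>wreath r n\<^esub> wr_transpose r n g"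

text \<open>
  The linear extension of the formula on basis vectors, undefined outside the space as
  \<^const>\<open>Bij\<close> requires; the lemma below recovers the defining formula.
\<close>

definition rho :: "nat \<Rightarrow> nat \<Rightarrow> nat \<Rightarrow> wr \<Rightarrow> (wr \<Rightarrow> rat) \<Rightarrow> (wr \<Rightarrow> rat)" where
  "rho r p n g =
     (\<lambda>v\<in>V_space r p n. \<lambda>\<tau>.
        \<Sum>\<omega>\<in>sym_elts r p n. v \<omega> * (sign_rn r n g \<omega> * C_basis (wr_twist r n g \<omega>) \<tau>))"

lemma finite_sym_elts:
  assumes "r > 0"
  shows "finite (sym_elts r p n)"
proof -
  have "finite (carrier (wreath r n))"
    using assms
    by (auto simp: wreath_def sym_group_def carrier_integer_mod_group
        intro!: finite_cartesian_product finite_PiE finite_permutations)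
  then show ?thesis
    by (auto simp: sym_elts_def Grpn_def intro: rev_finite_subset)
qed

lemma rho_C_basis:
  assumes "r > 0" and "\<omega> \<in> sym_elts r p n"
  shows "rho r p n g (C_basis \<omega>) = (\<lambda>\<tau>. sign_rn r n g \<omega> * C_basis (wr_twist r n g \<omega>) \<tau>)"
proof -
  have "C_basis \<omega> \<in> V_space r p n"
    using assms(2) by (auto simp: coord_space_def unit_vec_at_def)
  moreover have "(\<Sum>\<omega>'\<in>sym_elts r p n. C_basis \<omega> \<omega>' * f \<omega>') = f \<omega>" for f :: "wr \<Rightarrow> rat"
    using assms finite_sym_elts[OF assms(1), of p n]
    by (simp add: unit_vec_at_def if_distrib[of "\<lambda>c. c * _"] sum.delta cong: if_cong)
  ultimately show ?thesis
    by (auto simp: rho_def)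
qed

end

theory Submission
  imports "Jordan_Normal_Form.Spectral_Radius" "HOL-Library.Function_Algebras" "HOL-Number_Theory.Cong" Defs
begin

text \<open>
  The proof never constructs the irreducible representations.  For the involutive automorphism
  \<open>\<tau>\<close> that negates all colours, the twisted Frobenius-Schur indicator of an irreducible character
  \<open>\<psi>\<close> is \<open>0\<close> or \<open>\<plusminus>1\<close>, and it is the multiplicity of \<open>\<psi>\<close> in the class function
  \<open>g \<mapsto> #{h. h (\<tau> h) = g}\<close>.  It is nonzero exactly if \<open>\<psi> (\<tau> g) = \<psi> (g\<^sup>-\<^sup>1)\<close> for all \<open>g\<close>, which holds for all
  \<open>\<psi>\<close> if \<open>\<tau> g\<close> and \<open>g\<^sup>-\<^sup>1\<close> are conjugate.

  If \<open>p\<close> and \<open>n\<close> are coprime, then \<open>G(r,1,n)\<close> is generated by \<open>G(r,p,n)\<close> and the scalars, \<open>\<tau> g\<close> and \<open>g\<^sup>-\<^sup>1\<close>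
  are conjugate, and the character of \<open>\<rho>\<close> at \<open>g\<close> equals \<open>#{h. h (\<tau> h) = g}\<close>.  For \<open>G(r,1,n)\<close> the last
  claim is proved by removing the cycle of one point (and the cycle its partner lies on); the scalars
  carry it over to \<open>G(r,p,n)\<close>.  So all multiplicities of \<open>\<rho>\<close>, being natural numbers of absolute value \<open>1\<close>,
  are \<open>1\<close>.

  Conversely, if \<open>p\<close> is even and \<open>n\<close> or \<open>r / p\<close> is even, then the scalar \<open>r / 2\<close> lies in the kernel of \<open>\<rho>\<close>,
  but a Gelfand model is faithful.  If \<open>d = gcd p n\<close> is odd and \<open>d > 1\<close>, then some \<open>\<tau> g\<close> is not conjugate to
  \<open>g\<^sup>-\<^sup>1\<close>, so that some indicator vanishes and the dimension of \<open>\<rho>\<close>, which is \<open>#{h. h (\<tau> h) = 1}\<close>, is too small.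
\<close>

section \<open>Representations by complex matrices\<close>

text \<open>Only characters are compared, so composition factors take the place of complete
  reducibility.

  Behind the character identity: a symmetric \<omega> fixed by \<open>g\<close> joins each cycle of
  the permutation of \<open>g\<close> with another cycle or with itself. Two joined cycles have
  total sign 1, and inserting the permutation on one of them turns the pairing into a twisted root.
  A cycle joined with itself is fixed pointwise or, for even length, moved by the half turn; if its
  colours sum to 0 modulo \<open>r\<close>, these give \<open>r\<close> and \<open>-r\<close>,
  otherwise nothing. So even cycles cancel, as an even cycle has no square root on itself, and an
  odd one has exactly one. The carries counted by \<open>B_set\<close> let the pointwise case see
  the colour sum itself and not merely its double.

  Twisting by scalars moves colour sums by even amounts. For even \<open>p\<close> the parity is
  controlled by the scalar \<open>r / 2\<close> instead, whose sign is the parity of the colour sum.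

  For odd \<open>d > 1\<close> the bad element is an \<open>n\<close>-cycle with colours 1 and -1 at
  neighbouring points: conjugating its inverse to its bar takes an element of colour sum -2 modulo
  \<open>d\<close>.\<close>

definition mat_trace :: "'a::comm_monoid_add mat \<Rightarrow> 'a" where
  "mat_trace A = (\<Sum>i<dim_row A. A $$ (i, i))"

lemma mat_mult_entry:
  assumes "A \<in> carrier_mat a b" "B \<in> carrier_mat b c" "i < a" "j < c"
  shows "(A * B) $$ (i, j) = (\<Sum>k<b. A $$ (i, k) * B $$ (k, j))"
  using assms by (auto simp: scalar_prod_def lessThan_atLeast0 intro!: sum.cong)

lemma mat_trace_comm:
  fixes A B :: "'a::comm_semiring_0 mat"
  assumes "A \<in> carrier_mat n m" "B \<in> carrier_mat m n"
  shows "mat_trace (A * B) = mat_trace (B * A)"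
proof -
  have "mat_trace (A * B) = (\<Sum>i<n. \<Sum>k<m. A $$ (i, k) * B $$ (k, i))"
    using assms by (auto simp: mat_trace_def mat_mult_entry[OF assms] simp del: index_mult_mat(1) intro!: sum.cong)
  also have "\<dots> = (\<Sum>k<m. \<Sum>i<n. B $$ (k, i) * A $$ (i, k))"
    by (subst sum.swap) (simp add: mult.commute)
  also have "\<dots> = mat_trace (B * A)"
    using assms by (auto simp: mat_trace_def mat_mult_entry[OF assms(2,1)] simp del: index_mult_mat(1) intro!: sum.cong)
  finally show ?thesis .
qed

lemma mat_trace_one: "mat_trace (1\<^sub>m d :: 'a::semiring_1 mat) = of_nat d"
  by (simp add: mat_trace_def)

lemma mat_trace_smult:
  fixes c :: "'a::comm_ring"
  shows "A \<in> carrier_mat d d \<Longrightarrow> mat_trace (c \<cdot>\<^sub>m A) = c * mat_trace A"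
  by (auto simp: mat_trace_def sum_distrib_left intro!: sum.cong)

lemma mat_trace_similar:
  fixes A :: "'a::comm_ring_1 mat"
  assumes "A \<in> carrier_mat d d" "P \<in> carrier_mat d e" "Q \<in> carrier_mat e d" "P * Q = 1\<^sub>m d"
  shows "mat_trace (Q * A * P) = mat_trace A"
proof -
  have "mat_trace (Q * A * P) = mat_trace (P * (Q * A))"
    using assms by (intro mat_trace_comm[of _ e d]) auto
  also have "P * (Q * A) = A"
    using assoc_mult_mat[OF assms(2,3,1)] assms by simp
  finally show ?thesis .
qed

text \<open>The value 0 outside the row range keeps results in the coordinate space, so equality of
  matrices can be tested as equality of functions.\<close>

definition mat_app :: "'a::field mat \<Rightarrow> (nat \<Rightarrow> 'a) \<Rightarrow> nat \<Rightarrow> 'a" where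
  "mat_app A v = (\<lambda>i. if i < dim_row A then (\<Sum>j<dim_col A. A $$ (i, j) * v j) else 0)"

lemma mat_app_in: "A \<in> carrier_mat a b \<Longrightarrow> mat_app A v \<in> coord_space {..<a}"
  by (auto simp: mat_app_def coord_space_def)

lemma mat_app_mult:
  assumes "A \<in> carrier_mat a b" "B \<in> carrier_mat b c"
  shows "mat_app (A * B) v = mat_app A (mat_app B v)"
proof
  fix i
  show "mat_app (A * B) v i = mat_app A (mat_app B v) i"
  proof (cases "i < a")
    case True
    have "mat_app (A * B) v i = (\<Sum>j<c. \<Sum>k<b. A $$ (i, k) * B $$ (k, j) * v j)"
      using assms True by (auto simp: mat_app_def mat_mult_entry[OF assms] sum_distrib_right simp del: index_mult_mat(1) intro!: sum.cong)
    also have "\<dots> = (\<Sum>k<b. \<Sum>j<c. A $$ (i, k) * (B $$ (k, j) * v j))"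
      by (subst sum.swap) (simp add: mult.assoc)
    also have "\<dots> = mat_app A (mat_app B v) i"
      using assms True by (auto simp: mat_app_def sum_distrib_left intro!: sum.cong)
    finally show ?thesis .
  qed (use assms in \<open>auto simp: mat_app_def\<close>)
qed

lemma mat_app_unit:
  assumes "A \<in> carrier_mat a b" "j < b"
  shows "mat_app A (unit_vec_at j) = (\<lambda>i. if i < a then A $$ (i, j) else 0)"
  using assms by (auto simp: mat_app_def unit_vec_at_def if_distrib[of "\<lambda>x. _ * x"] cong: if_cong)

lemma mat_app_one: "v \<in> coord_space {..<d} \<Longrightarrow> mat_app (1\<^sub>m d) v = v"
  by (auto simp: mat_app_def coord_space_def if_distrib[of "\<lambda>x. x * _"] fun_eq_iff cong: if_cong)

lemma mat_app_add: "mat_app A (\<lambda>i. u i + v i) = (\<lambda>i. mat_app A u i + mat_app A v i)"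
  by (auto simp: mat_app_def algebra_simps sum.distrib)

lemma mat_app_scale: "mat_app A (\<lambda>i. c * v i) = (\<lambda>i. c * mat_app A v i)"
  by (auto simp: mat_app_def sum_distrib_left fun_eq_iff mult.left_commute intro!: sum.cong)

lemma mat_app_zero: "mat_app A (\<lambda>i. 0) = (\<lambda>i. 0)"
  by (auto simp: mat_app_def)

lemma unit_vec_at_in: "j \<in> I \<Longrightarrow> unit_vec_at j \<in> coord_space I"
  by (auto simp: unit_vec_at_def coord_space_def)

lemma mat_app_zero_imp:
  assumes "A \<in> carrier_mat a b" "\<And>v. v \<in> coord_space {..<b} \<Longrightarrow> mat_app A v = (\<lambda>i. 0)"
  shows "A = 0\<^sub>m a b"
proof (rule eq_matI)
  fix i j assume "i < dim_row (0\<^sub>m a b)" "j < dim_col (0\<^sub>m a b)"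
  then show "A $$ (i, j) = 0\<^sub>m a b $$ (i, j)"
    using assms mat_app_unit[OF assms(1), of j] assms(2)[OF unit_vec_at_in, of j]
    by (auto dest!: fun_cong[of _ _ i])
qed (use assms in auto)

lemma mat_app_eqI:
  assumes "A \<in> carrier_mat a b" "B \<in> carrier_mat a b"
    "\<And>v. v \<in> coord_space {..<b} \<Longrightarrow> mat_app A v = mat_app B v"
  shows "A = B"
proof (rule eq_matI)
  fix i j assume "i < dim_row B" "j < dim_col B"
  then show "A $$ (i, j) = B $$ (i, j)"
    using assms mat_app_unit[OF assms(1), of j] mat_app_unit[OF assms(2), of j] assms(3)[OF unit_vec_at_in, of j]
    by (auto dest!: fun_cong[of _ _ i])
qed (use assms in auto)

section \<open>Matrix representations and irreducible characters\<close>

definition matrep :: "('g, 'm) monoid_scheme \<Rightarrow> nat \<Rightarrow> ('g \<Rightarrow> complex mat) \<Rightarrow> bool" where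
  "matrep G d M \<longleftrightarrow> (\<forall>g\<in>carrier G. M g \<in> carrier_mat d d) \<and> M \<one>\<^bsub>G\<^esub> = 1\<^sub>m d \<and>
     (\<forall>g\<in>carrier G. \<forall>h\<in>carrier G. M (g \<otimes>\<^bsub>G\<^esub> h) = M g * M h)"

definition irr_matrep :: "('g, 'm) monoid_scheme \<Rightarrow> nat \<Rightarrow> ('g \<Rightarrow> complex mat) \<Rightarrow> bool" where
  "irr_matrep G d M \<longleftrightarrow> matrep G d M \<and> d > 0 \<and>
     (\<forall>W. linear_subspace (coord_space {..<d}) W \<and> (\<forall>g\<in>carrier G. mat_app (M g) ` W \<subseteq> W)
        \<longrightarrow> W = {\<lambda>i. 0} \<or> W = coord_space {..<d})"

lemma linear_on_space_zero:
  assumes "linear_on_space (coord_space I) f"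
  shows "f (\<lambda>i. 0) = (\<lambda>i. 0)"
proof -
  have "(\<lambda>i. 0) \<in> coord_space I" by (auto simp: coord_space_def)
  with assms[unfolded linear_on_space_def, THEN conjunct2, THEN spec[of _ 0], THEN bspec[of _ _ "\<lambda>i. 0"]]
  have "f (\<lambda>i. 0 * 0) = (\<lambda>i. 0 * f (\<lambda>i. 0) i)" by simp
  then show ?thesis by simp
qed

text \<open>\<open>linear_on_space\<close> only speaks about vectors of the space, so
  \<open>v\<close> is built up one coordinate at a time and every partial vector is checked to lie
  in it.\<close>

lemma linear_expand:
  assumes "finite I" "linear_on_space (coord_space I) f" "v \<in> coord_space I"
  shows "f v = (\<lambda>i. \<Sum>j\<in>I. v j * f (unit_vec_at j) i)"
proof -
  have *: "f (\<lambda>i. if i \<in> J then v i else 0) = (\<lambda>i. \<Sum>j\<in>J. v j * f (unit_vec_at j) i)" if "finite J" "J \<subseteq> I" for J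
    using that
  proof (induction J rule: finite_induct)
    case empty
    then show ?case using linear_on_space_zero[OF assms(2)] by simp
  next
    case (insert a J)
    have e: "(\<lambda>i. if i \<in> insert a J then v i else 0) = (\<lambda>i. v a * unit_vec_at a i + (if i \<in> J then v i else 0))"
      using insert by (auto simp: unit_vec_at_def)
    have m: "unit_vec_at a \<in> coord_space I" "(\<lambda>i. v a * unit_vec_at a i) \<in> coord_space I" "(\<lambda>i. if i \<in> J then v i else 0) \<in> coord_space I"
      using insert by (auto simp: coord_space_def unit_vec_at_def)
    have "f (\<lambda>i. v a * unit_vec_at a i + (if i \<in> J then v i else 0)) =
       (\<lambda>i. f (\<lambda>i. v a * unit_vec_at a i) i + f (\<lambda>i. if i \<in> J then v i else 0) i)"
      by (rule assms(2)[unfolded linear_on_space_def, THEN conjunct1, rule_format, OF m(2,3)])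
    moreover have "f (\<lambda>i. v a * unit_vec_at a i) = (\<lambda>i. v a * f (unit_vec_at a) i)"
      using assms(2)[unfolded linear_on_space_def, THEN conjunct2, THEN spec] m(1) by (rule bspec)
    ultimately show ?case using insert unfolding e by auto
  qed
  have "(\<lambda>i. if i \<in> I then v i else 0) = v"
    using assms(3) by (auto simp: coord_space_def)
  with *[OF assms(1)] show ?thesis by simp
qed

lemma representation_expand:
  assumes "representation G I R" "g \<in> carrier G" "v \<in> coord_space I"
  shows "R g v = (\<lambda>i. \<Sum>j\<in>I. v j * R g (unit_vec_at j) i)"
  using assms linear_expand unfolding representation_def by blast

lemma representation_closed:
  assumes "representation G I R" "g \<in> carrier G" "v \<in> coord_space I"
  shows "R g v \<in> coord_space I"
  using assms group_action.surj_prop[of G _ R g] unfolding representation_def by blast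

lemma representation_mult:
  assumes "representation G I R" "g \<in> carrier G" "h \<in> carrier G" "v \<in> coord_space I"
  shows "R (g \<otimes>\<^bsub>G\<^esub> h) v = R g (R h v)"
  using assms group_action.composition_rule[of G _ R] unfolding representation_def by metis

lemma representation_one:
  assumes "representation G I R" "v \<in> coord_space I"
  shows "R \<one>\<^bsub>G\<^esub> v = v"
  using assms group_action.id_eq_one[of G _ R] unfolding representation_def
  by (metis restrict_apply')

lemma group_if_representation: "representation G I R \<Longrightarrow> group G"
  by (auto simp: representation_def group_action_def group_hom_def)

lemma matrep_of_representation:
  assumes R: "representation G {..<d} R"
  defines "M \<equiv> \<lambda>g. mat d d (\<lambda>(i, j). R g (unit_vec_at j) i)"
  shows "matrep G d M" "\<And>g v. g \<in> carrier G \<Longrightarrow> v \<in> coord_space {..<d} \<Longrightarrow> mat_app (M g) v = R g v"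
    "\<And>g. mat_trace (M g) = rep_character {..<d} R g"
proof -
  have G: "group G" using R by (rule group_if_representation)
  note [simp] = monoid.one_closed[OF group.is_monoid[OF G]] monoid.m_closed[OF group.is_monoid[OF G]]
  have M: "M g \<in> carrier_mat d d" for g by (auto simp: M_def)
  show app: "mat_app (M g) v = R g v" if "g \<in> carrier G" "v \<in> coord_space {..<d}" for g v
    using representation_expand[OF R that] representation_closed[OF R that]
    by (auto simp: mat_app_def M_def coord_space_def fun_eq_iff mult.commute intro!: sum.cong)
  have "M \<one>\<^bsub>G\<^esub> = 1\<^sub>m d"
    by (rule mat_app_eqI[OF M]) (auto simp: app mat_app_one representation_one[OF R])
  moreover have "M (g \<otimes>\<^bsub>G\<^esub> h) = M g * M h" if "g \<in> carrier G" "h \<in> carrier G" for g h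
    by (rule mat_app_eqI[OF M mult_carrier_mat[OF M M]])
      (auto simp: app mat_app_mult[OF M M] that representation_mult[OF R] representation_closed[OF R])
  ultimately show "matrep G d M" using M by (auto simp: matrep_def)
  show "mat_trace (M g) = rep_character {..<d} R g" for g
    by (auto simp: mat_trace_def rep_character_def M_def)
qed

text \<open>\<open>Bij\<close> demands maps that are undefined outside the space, hence the
  restriction of \<open>mat_app\<close>; bijectivity comes from the matrix of the inverse
  element.\<close>

lemma representation_of_matrep:
  assumes "group G" and M: "matrep G d M"
  defines "R \<equiv> \<lambda>g. \<lambda>v\<in>coord_space {..<d}. mat_app (M g) v"
  shows "representation G {..<d} R" 
    "\<And>g. g \<in> carrier G \<Longrightarrow> mat_trace (M g) = rep_character {..<d} R g"
proof -
  note [simp] = group.inv_closed[OF assms(1)] group.l_inv[OF assms(1)] group.r_inv[OF assms(1)]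
   monoid.one_closed[OF group.is_monoid[OF assms(1)]] monoid.m_closed[OF group.is_monoid[OF assms(1)]]
  have Mc: "M g \<in> carrier_mat d d" if "g \<in> carrier G" for g using M that by (auto simp: matrep_def)
  have cl: "R g v \<in> coord_space {..<d}" if "g \<in> carrier G" "v \<in> coord_space {..<d}" for g v
    using mat_app_in[OF Mc[OF that(1)]] that(2) by (auto simp: R_def)
  have mu: "R g (R h v) = R (g \<otimes>\<^bsub>G\<^esub> h) v" if "g \<in> carrier G" "h \<in> carrier G" "v \<in> coord_space {..<d}" for g h v
    using cl[OF that(2,3)] M that mat_app_mult[OF Mc Mc, of g h v] by (auto simp: R_def matrep_def)
  have on: "R \<one>\<^bsub>G\<^esub> v = v" if "v \<in> coord_space {..<d}" for v
    using M that by (auto simp: R_def matrep_def mat_app_one)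
  have bij: "R g \<in> Bij (coord_space {..<d})" if "g \<in> carrier G" for g
  proof -
    have "bij_betw (R g) (coord_space {..<d}) (coord_space {..<d})"
      by (rule bij_betw_byWitness[where f' = "R (inv\<^bsub>G\<^esub> g)"]) (use that in \<open>auto simp: cl mu on\<close>)
    then show ?thesis by (auto simp: Bij_def R_def)
  qed
  have "R \<in> hom G (BijGroup (coord_space {..<d}))"
  proof (rule homI)
    fix g h assume gh: "g \<in> carrier G" "h \<in> carrier G"
    have "R (g \<otimes>\<^bsub>G\<^esub> h) = compose (coord_space {..<d}) (R g) (R h)"
    proof
      fix v
      show "R (g \<otimes>\<^bsub>G\<^esub> h) v = compose (coord_space {..<d}) (R g) (R h) v"
        by (cases "v \<in> coord_space {..<d}") (simp_all add: compose_def mu[OF gh], simp add: R_def)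
    qed
    then show "R (g \<otimes>\<^bsub>G\<^esub> h) = R g \<otimes>\<^bsub>BijGroup (coord_space {..<d})\<^esub> R h"
      using bij gh by (auto simp: BijGroup_def)
  qed (auto simp: BijGroup_def bij)
  then have "group_action G (coord_space {..<d}) R"
    using assms(1) by (simp add: group_action_def group_hom_def group_hom_axioms_def group_BijGroup)
  moreover have "linear_on_space (coord_space {..<d}) (R g)" if "g \<in> carrier G" for g
  proof -
    have "(\<lambda>i. u i + v i) \<in> coord_space {..<d}" "(\<lambda>i. c * v i) \<in> coord_space {..<d}"
      if "u \<in> coord_space {..<d}" "v \<in> coord_space {..<d}" for u v :: "nat \<Rightarrow> complex" and c
      using that by (auto simp: coord_space_def)
    then show ?thesis
      by (auto simp: linear_on_space_def R_def mat_app_add mat_app_scale)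
  qed
  ultimately show "representation G {..<d} R" by (auto simp: representation_def)
  show "mat_trace (M g) = rep_character {..<d} R g" if "g \<in> carrier G" for g
    using Mc[OF that] by (auto simp: mat_trace_def rep_character_def R_def unit_vec_at_in mat_app_unit[OF Mc[OF that]])
qed

text \<open>From here on irreducible characters are traces of matrices. Irreducibility passes in
  both directions since \<open>mat_app (M g)\<close> and \<open>R g\<close> agree on the coordinate
  space and so have the same invariant subspaces.\<close>

lemma Irr_eq:
  assumes "group G"
  shows "Irr G = {restrict (\<lambda>g. mat_trace (M g)) (carrier G) | d M. irr_matrep G d M}" (is "_ = ?B")
proof -
  have "\<exists>M. irr_matrep G d M \<and> (\<forall>g. mat_trace (M g) = rep_character {..<d} R g)"
    if R: "irreducible_representation G {..<d} R" for d R
  proof -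
    have r: "representation G {..<d} R" using R by (auto simp: irreducible_representation_def)
    define M where "M g = mat d d (\<lambda>(i, j). R g (unit_vec_at j) i)" for g
    note MR = matrep_of_representation[OF r, folded M_def]
    have "irr_matrep G d M"
      unfolding irr_matrep_def
    proof (intro conjI allI impI)
      show "matrep G d M" by fact
      show "d > 0" using R by (auto simp: irreducible_representation_def)
      fix W assume W: "linear_subspace (coord_space {..<d}) W \<and> (\<forall>g\<in>carrier G. mat_app (M g) ` W \<subseteq> W)"
      then have sub: "v \<in> coord_space {..<d}" if "v \<in> W" for v
        using that by (auto simp: linear_subspace_def)
      have "R g ` W \<subseteq> W" if "g \<in> carrier G" for g
      proof
        fix u assume "u \<in> R g ` W"
        then obtain v where "v \<in> W" "u = R g v" by auto
        moreover have "mat_app (M g) v = R g v" using MR(2)[OF that sub[OF \<open>v \<in> W\<close>]] .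
        ultimately show "u \<in> W" using W that by (metis image_eqI subsetD)
      qed
      then show "W = {\<lambda>i. 0} \<or> W = coord_space {..<d}"
        using R W unfolding irreducible_representation_def by simp
    qed
    then show ?thesis using MR(3) by auto
  qed
  moreover have "\<exists>R. irreducible_representation G {..<d} R \<and> (\<forall>g\<in>carrier G. mat_trace (M g) = rep_character {..<d} R g)"
    if M: "irr_matrep G d M" for d M
  proof -
    have m: "matrep G d M" using M by (auto simp: irr_matrep_def)
    define R where "R g = (\<lambda>v\<in>coord_space {..<d}. mat_app (M g) v)" for g
    note RM = representation_of_matrep[OF assms m, folded R_def]
    have "irreducible_representation G {..<d} R"
      unfolding irreducible_representation_def
    proof (intro conjI allI impI)
      show "representation G {..<d} R" by fact
      show "{..<d} \<noteq> {}" using M by (auto simp: irr_matrep_def)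
      fix W assume W: "linear_subspace (coord_space {..<d}) W \<and> (\<forall>g\<in>carrier G. R g ` W \<subseteq> W)"
      then have sub: "v \<in> coord_space {..<d}" if "v \<in> W" for v
        using that by (auto simp: linear_subspace_def)
      have "mat_app (M g) ` W \<subseteq> W" if "g \<in> carrier G" for g
      proof
        fix u assume "u \<in> mat_app (M g) ` W"
        then obtain v where "v \<in> W" "u = R g v" using sub by (auto simp: R_def)
        then show "u \<in> W" using W that by auto
      qed
      then show "W = {\<lambda>i. 0} \<or> W = coord_space {..<d}"
        using M W unfolding irr_matrep_def by simp
    qed
    then show ?thesis using RM(2) by auto
  qed
  ultimately show ?thesis
    unfolding Irr_def by (intro Set.equalityI subsetI; clarify) (metis (mono_tags, lifting) mem_Collect_eq restrict_ext)+
qed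

section \<open>Composition factors of a matrix representation\<close>

lemma sum_apply: "sum f A x = (\<Sum>a\<in>A. f a x)"
  by (induction A rule: infinite_finite_induct) (simp_all only: sum.infinite sum.empty zero_fun_apply sum.insert plus_fun_apply if_False not_False_eq_True)

lemma sum_mult_unit_vec_at:
  assumes "finite A" "i \<in> A"
  shows "(\<Sum>a\<in>A. f a * unit_vec_at a i) = f i"
proof -
  have "(\<Sum>a\<in>A. f a * unit_vec_at a i) = (\<Sum>a\<in>A. if i = a then f a else 0)"
    by (auto simp: unit_vec_at_def intro!: sum.cong)
  then show ?thesis using assms by simp
qed

text \<open>A basis of \<open>W\<close>, extended to the whole space, gives the columns of
  \<open>P\<close>, and \<open>Q\<close> reads off coordinates. In this basis every matrix that
  stabilises \<open>W\<close> becomes block triangular; the two exclusions on \<open>W\<close> make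
  both blocks nonempty.\<close>

lemma adapted_basis:
  fixes W :: "(nat \<Rightarrow> 'a::field) set"
  assumes W: "linear_subspace (coord_space {..<d}) W" "W \<noteq> {\<lambda>i. 0}" "W \<noteq> coord_space {..<d}"
  obtains k P Q where "0 < k" "k < d" "P \<in> carrier_mat d d" "Q \<in> carrier_mat d d" "P * Q = 1\<^sub>m d" "Q * P = 1\<^sub>m d"
    "\<And>j. j < k \<Longrightarrow> mat_app P (unit_vec_at j) \<in> W"
    "\<And>w i. w \<in> W \<Longrightarrow> k \<le> i \<Longrightarrow> mat_app Q w i = 0"
proof -
  define V where "V = (coord_space {..<d} :: (nat \<Rightarrow> 'a) set)"
  define U where "U = (unit_vec_at ` {..<d} :: (nat \<Rightarrow> 'a) set)"
  have inj_unit: "inj_on (unit_vec_at :: nat \<Rightarrow> nat \<Rightarrow> 'a) {..<d}"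
    by (auto simp: inj_on_def unit_vec_at_def fun_eq_iff split: if_splits)
  \<comment> \<open>All functions on the naturals serve as ambient vector space. It has infinite
    dimension, so cardinalities are always compared with the \<open>d\<close> unit vectors.\<close>
  interpret vs: vector_space "\<lambda>(c::'a) (v::nat \<Rightarrow> 'a) i. c * v i"
    by unfold_locales (auto simp: algebra_simps)
  have subW: "vs.subspace W"
    using W(1) unfolding vs.subspace_def linear_subspace_def by (simp add: plus_fun_def zero_fun_def)
  have subV: "vs.subspace V"
    unfolding vs.subspace_def V_def coord_space_def by auto
  have WV: "W \<subseteq> V" using W(1) by (simp add: V_def linear_subspace_def)
  obtain B where B: "B \<subseteq> W" "vs.independent B" "W \<subseteq> vs.span B"
    using vs.maximal_independent_subset[of W] by blast
  obtain B' where B': "B \<subseteq> B'" "B' \<subseteq> V" "vs.independent B'" "V \<subseteq> vs.span B'"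
    using vs.maximal_independent_subset_extend[of B V] B WV by blast
  have U: "finite U" "card U = d" "U \<subseteq> V"
    using inj_unit by (auto simp: U_def V_def unit_vec_at_in card_image)
  have VU: "V \<subseteq> vs.span U"
  proof
    fix v assume "v \<in> V"
    have "v = (\<Sum>j<d. (\<lambda>i. v j * unit_vec_at j i))"
    proof
      fix i
      show "v i = (\<Sum>j<d. (\<lambda>i. v j * unit_vec_at j i)) i"
      proof (cases "i < d")
        case False
        then show ?thesis using \<open>v \<in> V\<close>
          by (auto simp: sum_apply V_def coord_space_def unit_vec_at_def intro!: sum.neutral)
      qed (simp add: sum_apply sum_mult_unit_vec_at)
    qed
    moreover have "(\<Sum>j<d. (\<lambda>i. v j * unit_vec_at j i)) \<in> vs.span U"
      by (intro vs.span_sum vs.span_scale vs.span_base) (auto simp: U_def)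
    ultimately show "v \<in> vs.span U" by simp
  qed
  have indU: "vs.independent U"
    unfolding vs.dependent_finite[OF U(1)]
  proof clarify
    fix c v assume z: "(\<Sum>v\<in>U. (\<lambda>i. c v * v i)) = 0" and v: "v \<in> U" "c v \<noteq> 0"
    from v obtain j where j: "j < d" "v = unit_vec_at j" by (auto simp: U_def)
    have "(\<Sum>v\<in>U. (\<lambda>i. c v * v i)) j = (\<Sum>i<d. c (unit_vec_at i) * unit_vec_at i j)"
      using inj_unit by (simp add: sum_apply U_def sum.reindex)
    also have "\<dots> = c v" using j by (simp add: sum_mult_unit_vec_at[where f = "\<lambda>a. c (unit_vec_at a)"])
    finally show False using z v by simp
  qed
  have finB': "finite B'" "card B' \<le> d"
    using vs.independent_span_bound[OF U(1) B'(3)] B'(2) VU U(2) by auto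
  have "d \<le> card B'"
    using vs.independent_span_bound[OF finB'(1) indU] U B'(4) by auto
  then have cB': "card B' = d" using finB' by simp
  obtain xs where xs: "distinct xs" "set xs = B"
    using finite_distinct_list finite_subset[OF B'(1) finB'(1)] by metis
  obtain ys where ys: "distinct ys" "set ys = B' - B"
    using finite_distinct_list finB'(1) by (metis finite_Diff)
  \<comment> \<open>Listing \<open>B\<close> first makes the first \<open>k\<close> basis vectors a
    basis of \<open>W\<close>.\<close>
  define b where "b j = (xs @ ys) ! j" for j
  define k where "k = length xs"
  have len: "length (xs @ ys) = d" using xs ys B'(1) cB' distinct_card[of "xs @ ys"]
    by (simp add: Un_absorb1)
  then have kd: "k \<le> d" by (simp add: k_def)
  have bB: "bij_betw b {..<k} B"
    using bij_betw_nth[OF xs(1), of "{..<k}" B] xs(2)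
    by (subst bij_betw_cong[of _ _ "(!) xs"]) (auto simp: b_def k_def nth_append)
  have b_eq: "b = (!) (xs @ ys)" by (auto simp: b_def)
  have bB': "bij_betw b {..<d} B'"
    unfolding b_eq using xs ys len B'(1) by (intro bij_betw_nth) auto
  define P where "P = mat d d (\<lambda>(i, j). b j i)"
  have "\<exists>c. unit_vec_at j = (\<Sum>v\<in>B'. (\<lambda>i. c v * v i))" if "j < d" for j
  proof -
    have "unit_vec_at j \<in> vs.span B'" using that B'(4) by (auto simp: V_def unit_vec_at_in)
    then show ?thesis unfolding vs.span_finite[OF finB'(1)] by blast
  qed
  then obtain c where c: "\<And>j. j < d \<Longrightarrow> unit_vec_at j = (\<Sum>v\<in>B'. (\<lambda>i. c j v * v i))" by metis
  define Q where "Q = mat d d (\<lambda>(l, j). c j (b l))"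
  have PQ: "P \<in> carrier_mat d d" "Q \<in> carrier_mat d d" by (auto simp: P_def Q_def)
  have PQ1: "P * Q = 1\<^sub>m d"
  proof (rule eq_matI)
    fix i j assume "i < dim_row (1\<^sub>m d)" "j < dim_col (1\<^sub>m d)"
    then have ij: "i < d" "j < d" by auto
    have "(P * Q) $$ (i, j) = (\<Sum>l<d. b l i * c j (b l))"
      unfolding mat_mult_entry[OF PQ ij] using ij by (simp add: P_def Q_def)
    also have "\<dots> = (\<Sum>v\<in>B'. v i * c j v)"
      by (rule sum.reindex_bij_betw[OF bB'])
    also have "\<dots> = unit_vec_at j i"
      unfolding c[OF ij(2)] sum_apply by (simp add: mult.commute)
    finally show "(P * Q) $$ (i, j) = 1\<^sub>m d $$ (i, j)" using ij by (auto simp: unit_vec_at_def)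
  qed (use PQ in auto)
  have QP1: "Q * P = 1\<^sub>m d" by (rule mat_mult_left_right_inverse[OF PQ PQ1])
  have "k > 0"
  proof (rule ccontr)
    assume "\<not> k > 0"
    then have "W \<subseteq> {\<lambda>i. 0}" using B(3) xs by (auto simp: k_def zero_fun_def)
    then show False using W by (auto simp: linear_subspace_def)
  qed
  have "k < d"
  proof (rule ccontr)
    assume "\<not> k < d"
    then have "B = B'" using kd bB bB' by (auto simp: bij_betw_def)
    then have "V \<subseteq> W" using B'(4) vs.span_minimal[OF B(1) subW] by auto
    then show False using WV W(3) by (auto simp: V_def)
  qed
  have c1: "mat_app P (unit_vec_at j) \<in> W" if "j < k" for j
  proof -
    have "b j \<in> W" using bB that B(1) by (auto simp: bij_betw_def)
    moreover have "mat_app P (unit_vec_at j) = b j"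
      unfolding mat_app_unit[OF PQ(1) less_trans[OF that \<open>k < d\<close>]]
      using that \<open>k < d\<close> WV \<open>b j \<in> W\<close> by (auto simp: P_def V_def coord_space_def fun_eq_iff)
    ultimately show ?thesis by simp
  qed
  have c2: "mat_app Q w i = 0" if "w \<in> W" "k \<le> i" for w i
  proof -
    have fB: "finite B" using xs by auto
    have "w \<in> vs.span B" using that B by auto
    then obtain e where e: "w = (\<Sum>v\<in>B. (\<lambda>i. e v * v i))"
      unfolding vs.span_finite[OF fB] by blast
    define u where "u l = (if l < k then e (b l) else 0)" for l
    have "w = mat_app P u"
    proof
      fix i
      have "w i = (\<Sum>l<k. e (b l) * b l i)"
        unfolding e sum_apply using sum.reindex_bij_betw[OF bB, of "\<lambda>v. e v * v i"] by simp
      also have "\<dots> = (\<Sum>l<d. u l * b l i)"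
        using kd by (intro sum.mono_neutral_cong_left) (auto simp: u_def)
      finally have "w i = (\<Sum>l<d. u l * b l i)" .
      then show "w i = mat_app P u i"
        using WV that(1) by (auto simp: mat_app_def P_def mult.commute V_def coord_space_def)
    qed
    then have "mat_app Q w = mat_app (Q * P) u"
      by (simp add: mat_app_mult[OF PQ(2,1)])
    also have "\<dots> = u" unfolding QP1 using kd by (intro mat_app_one) (auto simp: coord_space_def u_def)
    finally show ?thesis using that by (simp add: u_def)
  qed
  show thesis by (rule that[OF \<open>0 < k\<close> \<open>k < d\<close> PQ PQ1 QP1 c1 c2])
qed

lemma sum_lessThan_add:
  fixes f :: "nat \<Rightarrow> 'a::comm_monoid_add"
  shows "(\<Sum>l<k + m. f l) = (\<Sum>l<k. f l) + (\<Sum>l<m. f (k + l))"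
  by (induction m) (auto simp: add.assoc)

lemma matrep_carrier: "matrep G d M \<Longrightarrow> g \<in> carrier G \<Longrightarrow> M g \<in> carrier_mat d d"
  by (simp add: matrep_def)

lemma matrep_mult: "matrep G d M \<Longrightarrow> g \<in> carrier G \<Longrightarrow> h \<in> carrier G \<Longrightarrow> M (g \<otimes>\<^bsub>G\<^esub> h) = M g * M h"
  by (simp add: matrep_def)

lemma matrep_one: "matrep G d M \<Longrightarrow> M \<one>\<^bsub>G\<^esub> = 1\<^sub>m d"
  by (simp add: matrep_def)

lemma matrep_similar:
  assumes "matrep G d M" "P \<in> carrier_mat d d" "Q \<in> carrier_mat d d" "P * Q = 1\<^sub>m d" "Q * P = 1\<^sub>m d"
  shows "matrep G d (\<lambda>g. Q * M g * P)"
  unfolding matrep_def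
proof (intro conjI ballI)
  fix g h assume gh: "g \<in> carrier G" "h \<in> carrier G"
  note c = matrep_carrier[OF assms(1)]
  have "Q * M g * P * (Q * M h * P) = Q * M g * (P * (Q * M h * P))"
    using c[OF gh(1)] c[OF gh(2)] assms by (intro assoc_mult_mat[of _ d d _ d _ d]) auto
  also have "P * (Q * M h * P) = P * (Q * (M h * P))"
    using c[OF gh(2)] assms by (subst assoc_mult_mat[of Q d d _ d _ d]) auto
  also have "\<dots> = P * Q * (M h * P)"
    using c[OF gh(2)] assms by (intro assoc_mult_mat[symmetric, of _ d d _ d _ d]) auto
  also have "\<dots> = M h * P" using c[OF gh(2)] assms by simp
  also have "Q * M g * (M h * P) = Q * M g * M h * P"
    using c[OF gh(1)] c[OF gh(2)] assms by (intro assoc_mult_mat[symmetric, of _ d d _ d _ d]) auto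
  also have "Q * M g * M h = Q * (M g * M h)"
    using c[OF gh(1)] c[OF gh(2)] assms by (intro assoc_mult_mat[of _ d d _ d _ d]) auto
  finally show "Q * M (g \<otimes>\<^bsub>G\<^esub> h) * P = Q * M g * P * (Q * M h * P)"
    using matrep_mult[OF assms(1) gh] by simp
qed (use assms in \<open>auto simp: matrep_def\<close>)

text \<open>With a zero lower left block, the off-diagonal blocks contribute nothing to the diagonal
  blocks of a product, so both diagonal blocks are multiplicative.\<close>

lemma matrep_block_triangular:
  assumes "matrep G d N" "k \<le> d" "\<And>g i j. g \<in> carrier G \<Longrightarrow> k \<le> i \<Longrightarrow> i < d \<Longrightarrow> j < k \<Longrightarrow> N g $$ (i, j) = 0"
  defines "A \<equiv> \<lambda>g. mat k k (\<lambda>(i, j). N g $$ (i, j))"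
    and "D \<equiv> \<lambda>g. mat (d - k) (d - k) (\<lambda>(i, j). N g $$ (k + i, k + j))"
  shows "matrep G k A" "matrep G (d - k) D"
    "\<And>g. g \<in> carrier G \<Longrightarrow> mat_trace (N g) = mat_trace (A g) + mat_trace (D g)"
proof -
  note c = matrep_carrier[OF assms(1)]
  obtain m where d: "d = k + m" using assms(2) le_Suc_ex by blast
  have ent: "N (g \<otimes>\<^bsub>G\<^esub> h) $$ (i, j) = (\<Sum>l<k. N g $$ (i, l) * N h $$ (l, j)) + (\<Sum>l<m. N g $$ (i, k + l) * N h $$ (k + l, j))"
    if "g \<in> carrier G" "h \<in> carrier G" "i < d" "j < d" for g h i j
    using matrep_mult[OF assms(1) that(1,2)] mat_mult_entry[OF c[OF that(1)] c[OF that(2)] that(3,4)]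
    unfolding d sum_lessThan_add by simp
  have car: "A g \<in> carrier_mat k k" "D g \<in> carrier_mat m m" for g by (auto simp: A_def D_def d)
  show "matrep G k A"
    unfolding matrep_def
  proof (intro conjI ballI)
    fix g h assume gh: "g \<in> carrier G" "h \<in> carrier G"
    show "A (g \<otimes>\<^bsub>G\<^esub> h) = A g * A h"
    proof (rule eq_matI)
      fix i j assume "i < dim_row (A g * A h)" "j < dim_col (A g * A h)"
      then have ij: "i < k" "j < k" using car[of g] car[of h] by auto
      show "A (g \<otimes>\<^bsub>G\<^esub> h) $$ (i, j) = (A g * A h) $$ (i, j)"
        unfolding mat_mult_entry[OF car(1) car(1) ij]
        using ij ent[OF gh, of i j] assms(3)[OF gh(2)] by (simp add: A_def d)
    qed (auto simp: A_def)
  qed (use matrep_one[OF assms(1)] assms(2) in \<open>auto simp: A_def\<close>)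
  show "matrep G (d - k) D"
    unfolding matrep_def
  proof (intro conjI ballI)
    fix g h assume gh: "g \<in> carrier G" "h \<in> carrier G"
    show "D (g \<otimes>\<^bsub>G\<^esub> h) = D g * D h"
    proof (rule eq_matI)
      fix i j assume "i < dim_row (D g * D h)" "j < dim_col (D g * D h)"
      then have ij: "i < m" "j < m" using car[of g] car[of h] by auto
      show "D (g \<otimes>\<^bsub>G\<^esub> h) $$ (i, j) = (D g * D h) $$ (i, j)"
        unfolding mat_mult_entry[OF car(2) car(2) ij]
        using ij ent[OF gh, of "k + i" "k + j"] assms(3)[OF gh(1)] by (simp add: D_def d)
    qed (auto simp: D_def)
  qed (use matrep_one[OF assms(1)] assms(2) in \<open>auto simp: D_def\<close>)
  show "mat_trace (N g) = mat_trace (A g) + mat_trace (D g)" if "g \<in> carrier G" for g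
    using c[OF that] by (auto simp: mat_trace_def d sum_lessThan_add A_def D_def)
qed

text \<open>Traces do not see whether an invariant subspace has an invariant complement, so
  splitting off block after block suffices. The list records multiplicities.\<close>

lemma matrep_trace_decomp:
  assumes G: "group G" and "matrep G d M"
  shows "\<exists>\<psi>s. set \<psi>s \<subseteq> Irr G \<and> (\<forall>g\<in>carrier G. mat_trace (M g) = (\<Sum>\<psi>\<leftarrow>\<psi>s. \<psi> g))"
  using assms(2)
proof (induction d arbitrary: M rule: less_induct)
  case (less d)
  note c = matrep_carrier[OF less(2)]
  consider "d = 0" | "irr_matrep G d M" | "d > 0" "\<not> irr_matrep G d M" by blast
  then show ?case
  proof cases
    case 1
    then have "\<forall>g\<in>carrier G. mat_trace (M g) = (\<Sum>\<psi>\<leftarrow>[]. \<psi> g)" using carrier_matD(1)[OF c] 1 by (simp add: mat_trace_def)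
    then show ?thesis by (intro exI[of _ "[]"]) auto
  next
    case 2
    let ?\<psi> = "restrict (\<lambda>g. mat_trace (M g)) (carrier G)"
    have "?\<psi> \<in> Irr G" unfolding Irr_eq[OF G] using 2 by blast
    then show ?thesis by (intro exI[of _ "[?\<psi>]"]) auto
  next
    case 3
    then obtain W where W: "linear_subspace (coord_space {..<d}) W" "W \<noteq> {\<lambda>i. 0}" "W \<noteq> coord_space {..<d}"
      and inv: "\<And>g. g \<in> carrier G \<Longrightarrow> mat_app (M g) ` W \<subseteq> W"
      using less(2) unfolding irr_matrep_def by blast
    obtain k P Q where kPQ: "0 < k" "k < d" "P \<in> carrier_mat d d" "Q \<in> carrier_mat d d" "P * Q = 1\<^sub>m d" "Q * P = 1\<^sub>m d"
      "\<And>j. j < k \<Longrightarrow> mat_app P (unit_vec_at j) \<in> W"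
      "\<And>w i. w \<in> W \<Longrightarrow> k \<le> i \<Longrightarrow> mat_app Q w i = 0"
      by (rule adapted_basis[OF W]) (rule that; blast)
    define N where "N g = Q * M g * P" for g
    have N: "matrep G d N" unfolding N_def by (rule matrep_similar[OF less(2) kPQ(3-6)])
    \<comment> \<open>Column \<open>j\<close> of \<open>P\<close> lies in \<open>W\<close>,
      \<open>M g\<close> keeps it there, and the coordinates of a vector of \<open>W\<close> vanish
      from index \<open>k\<close> on.\<close>
    have z: "N g $$ (i, j) = 0" if "g \<in> carrier G" "k \<le> i" "i < d" "j < k" for g i j
    proof -
      have "N g $$ (i, j) = mat_app (N g) (unit_vec_at j) i"
        using mat_app_unit[OF matrep_carrier[OF N that(1)], of j] that kPQ by simp
      also have "\<dots> = mat_app Q (mat_app (M g) (mat_app P (unit_vec_at j))) i"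
        unfolding N_def using c[OF that(1)] kPQ
        by (simp add: mat_app_mult[of _ d d _ d])
      also have "\<dots> = 0" using inv[OF that(1)] kPQ(7)[OF that(4)] that by (intro kPQ(8)) auto
      finally show ?thesis .
    qed
    note bl = matrep_block_triangular[OF N less_imp_le[OF kPQ(2)] z]
    obtain ps where ps: "set ps \<subseteq> Irr G" "\<forall>g\<in>carrier G. mat_trace (mat k k (\<lambda>(i, j). N g $$ (i, j))) = (\<Sum>\<psi>\<leftarrow>ps. \<psi> g)"
      using less.IH[OF kPQ(2) bl(1)] by auto
    obtain qs where qs: "set qs \<subseteq> Irr G" "\<forall>g\<in>carrier G. mat_trace (mat (d-k) (d-k) (\<lambda>(i, j). N g $$ (k + i, k + j))) = (\<Sum>\<psi>\<leftarrow>qs. \<psi> g)"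
      using less.IH[OF _ bl(2)] kPQ by auto
    have "mat_trace (M g) = mat_trace (N g)" if "g \<in> carrier G" for g
      unfolding N_def by (rule mat_trace_similar[OF c[OF that] kPQ(3-5), symmetric])
    then have "\<forall>g\<in>carrier G. mat_trace (M g) = (\<Sum>\<psi>\<leftarrow>ps @ qs. \<psi> g)"
      using bl(3) ps qs by auto
    then show ?thesis using ps qs by (intro exI[of _ "ps @ qs"]) auto
  qed
qed

text \<open>\<open>matrep\<close> indexes by numbers below \<open>d\<close>, whereas the regular
  representation and the model have bases indexed by arbitrary finite sets; an enumeration of
  \<open>I\<close> bridges the gap.\<close>

lemma matrep_of_kernel:
  fixes m :: "'g \<Rightarrow> 'i \<Rightarrow> 'i \<Rightarrow> complex"
  assumes "group G" "finite I"
    "\<And>g h a c. g \<in> carrier G \<Longrightarrow> h \<in> carrier G \<Longrightarrow> a \<in> I \<Longrightarrow> c \<in> I \<Longrightarrow>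
       m (g \<otimes>\<^bsub>G\<^esub> h) a c = (\<Sum>b\<in>I. m g a b * m h b c)"
    "\<And>a c. a \<in> I \<Longrightarrow> c \<in> I \<Longrightarrow> m \<one>\<^bsub>G\<^esub> a c = (if a = c then 1 else 0)"
  shows "\<exists>d M. matrep G d M \<and> (\<forall>g. mat_trace (M g) = (\<Sum>a\<in>I. m g a a))"
proof -
  obtain e where e: "bij_betw e {0..<card I} I" using ex_bij_betw_nat_finite[OF assms(2)] by blast
  define d where "d = card I"
  have e: "bij_betw e {..<d} I" using e by (simp add: d_def atLeast0LessThan)
  have eI: "e i \<in> I" if "i < d" for i using e that by (auto simp: bij_betw_def)
  have e_inj: "e i = e j \<longleftrightarrow> i = j" if "i < d" "j < d" for i j
    using e that by (auto simp: bij_betw_def inj_on_def)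
  define M where "M g = mat d d (\<lambda>(i, j). m g (e i) (e j))" for g
  have M: "M g \<in> carrier_mat d d" for g by (simp add: M_def)
  have "matrep G d M"
    unfolding matrep_def
  proof (intro conjI ballI)
    show "M \<one>\<^bsub>G\<^esub> = 1\<^sub>m d" by (rule eq_matI) (auto simp: M_def assms(4) eI e_inj)
    fix g h assume gh: "g \<in> carrier G" "h \<in> carrier G"
    show "M (g \<otimes>\<^bsub>G\<^esub> h) = M g * M h"
    proof (rule eq_matI)
      fix i j assume "i < dim_row (M g * M h)" "j < dim_col (M g * M h)"
      then have ij: "i < d" "j < d" using M[of g] M[of h] by auto
      have "M (g \<otimes>\<^bsub>G\<^esub> h) $$ (i, j) = (\<Sum>b\<in>I. m g (e i) b * m h b (e j))"
        using ij by (simp add: M_def assms(3) gh eI)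
      also have "\<dots> = (\<Sum>k<d. m g (e i) (e k) * m h (e k) (e j))"
        by (rule sum.reindex_bij_betw[OF e, symmetric])
      finally show "M (g \<otimes>\<^bsub>G\<^esub> h) $$ (i, j) = (M g * M h) $$ (i, j)"
        unfolding mat_mult_entry[OF M M ij] using ij by (simp add: M_def)
    qed (auto simp: M_def)
  qed (simp add: M)
  moreover have "mat_trace (M g) = (\<Sum>a\<in>I. m g a a)" for g
    using sum.reindex_bij_betw[OF e, of "\<lambda>a. m g a a"] by (simp add: mat_trace_def M_def)
  ultimately show ?thesis by blast
qed

text \<open>The image of an intertwiner is invariant, hence zero or everything. Surjectivity is
  delivered as a right inverse, whose columns are preimages of the unit vectors.\<close>

lemma schur_surjective:
  assumes M: "irr_matrep G d M" and T: "T \<in> carrier_mat d e"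
    and N: "\<And>g. g \<in> carrier G \<Longrightarrow> N g \<in> carrier_mat e e"
    and MN: "\<And>g. g \<in> carrier G \<Longrightarrow> M g * T = T * N g"
  shows "T = 0\<^sub>m d e \<or> (\<exists>Q\<in>carrier_mat e d. T * Q = 1\<^sub>m d)"
proof -
  define W where "W = mat_app T ` coord_space {..<e}"
  have "linear_subspace (coord_space {..<d}) W"
    unfolding linear_subspace_def
  proof (intro conjI allI ballI)
    show "W \<subseteq> coord_space {..<d}" using mat_app_in[OF T] by (auto simp: W_def)
    have "(\<lambda>i. 0) \<in> coord_space {..<e}" by (simp add: coord_space_def)
    then show "(\<lambda>i. 0) \<in> W" unfolding W_def by (rule rev_image_eqI) (simp add: mat_app_zero)
  next
    fix u v assume "u \<in> W" "v \<in> W"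
    then obtain a b where ab: "a \<in> coord_space {..<e}" "b \<in> coord_space {..<e}" "u = mat_app T a" "v = mat_app T b"
      by (auto simp: W_def)
    then have "(\<lambda>i. a i + b i) \<in> coord_space {..<e}" by (simp add: coord_space_def)
    then show "(\<lambda>i. u i + v i) \<in> W" unfolding W_def by (rule rev_image_eqI) (simp add: mat_app_add ab)
  next
    fix c v assume "v \<in> W"
    then obtain a where ab: "a \<in> coord_space {..<e}" "v = mat_app T a"
      by (auto simp: W_def)
    then have "(\<lambda>i. c * a i) \<in> coord_space {..<e}" by (simp add: coord_space_def)
    then show "(\<lambda>i. c * v i) \<in> W" unfolding W_def by (rule rev_image_eqI) (simp add: mat_app_scale ab)
  qed
  moreover have "mat_app (M g) ` W \<subseteq> W" if "g \<in> carrier G" for g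
  proof
    fix u assume "u \<in> mat_app (M g) ` W"
    then obtain a where a: "a \<in> coord_space {..<e}" "u = mat_app (M g) (mat_app T a)" by (auto simp: W_def)
    have Mg: "M g \<in> carrier_mat d d" using M that by (simp add: irr_matrep_def matrep_def)
    have "u = mat_app T (mat_app (N g) a)"
      using MN[OF that] unfolding a mat_app_mult[OF Mg T, symmetric] mat_app_mult[OF T N[OF that], symmetric] by simp
    then show "u \<in> W" using mat_app_in[OF N[OF that]] by (simp add: W_def)
  qed
  ultimately have "W = {\<lambda>i. 0} \<or> W = coord_space {..<d}" using M by (simp add: irr_matrep_def)
  then show ?thesis
  proof
    assume W: "W = {\<lambda>i. 0}"
    have "T = 0\<^sub>m d e"
    proof (rule mat_app_zero_imp[OF T])
      fix v :: "nat \<Rightarrow> complex" assume "v \<in> coord_space {..<e}"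
      then have "mat_app T v \<in> W" by (simp add: W_def)
      with W show "mat_app T v = (\<lambda>i. 0)" by simp
    qed
    then show ?thesis ..
  next
    assume W: "W = coord_space {..<d}"
    have "\<exists>v. mat_app T v = unit_vec_at j" if "j < d" for j
    proof -
      have "unit_vec_at j \<in> W" unfolding W using that by (intro unit_vec_at_in) simp
      then show ?thesis by (auto simp: W_def)
    qed
    then obtain v where v: "\<And>j. j < d \<Longrightarrow> mat_app T (v j) = unit_vec_at j" by metis
    define Q where "Q = mat e d (\<lambda>(i, j). v j i)"
    have Q: "Q \<in> carrier_mat e d" by (simp add: Q_def)
    have "T * Q = 1\<^sub>m d"
    proof (rule eq_matI)
      fix i j assume "i < dim_row (1\<^sub>m d)" "j < dim_col (1\<^sub>m d)"
      then have ij: "i < d" "j < d" by auto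
      have "(T * Q) $$ (i, j) = mat_app T (v j) i"
        unfolding mat_mult_entry[OF T Q ij] using ij T by (simp add: Q_def mat_app_def)
      then show "(T * Q) $$ (i, j) = 1\<^sub>m d $$ (i, j)" using v ij by (simp add: unit_vec_at_def)
    qed (use T Q in auto)
    then show ?thesis using Q by blast
  qed
qed

text \<open>Over the complex numbers \<open>T\<close> has an eigenvalue; its eigenspace is invariant
  and nonzero, hence everything.\<close>

lemma schur_scalar:
  assumes M: "irr_matrep G d M" and T: "T \<in> carrier_mat d d"
    and MT: "\<And>g. g \<in> carrier G \<Longrightarrow> M g * T = T * M g"
  shows "\<exists>c. T = c \<cdot>\<^sub>m 1\<^sub>m d"
proof -
  have "d > 0" using M by (simp add: irr_matrep_def)
  then obtain c v where v: "v \<in> carrier_vec d" "v \<noteq> 0\<^sub>v d" "T *\<^sub>v v = c \<cdot>\<^sub>v v"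
    using spectrum_non_empty[OF T] T unfolding spectrum_def eigenvalue_def eigenvector_def by auto
  define W where "W = {u \<in> coord_space {..<d}. mat_app T u = (\<lambda>i. c * u i)}"
  have "linear_subspace (coord_space {..<d}) W"
    unfolding linear_subspace_def W_def
    by (auto simp: coord_space_def mat_app_zero mat_app_add mat_app_scale algebra_simps)
  moreover have "mat_app (M g) ` W \<subseteq> W" if "g \<in> carrier G" for g
  proof
    fix u assume "u \<in> mat_app (M g) ` W"
    then obtain w where w: "w \<in> coord_space {..<d}" "mat_app T w = (\<lambda>i. c * w i)" "u = mat_app (M g) w"
      by (auto simp: W_def)
    have Mg: "M g \<in> carrier_mat d d" using M that by (simp add: irr_matrep_def matrep_def)
    have "mat_app T u = mat_app (M g) (mat_app T w)"
      using MT[OF that] unfolding w(3) mat_app_mult[OF Mg T, symmetric] mat_app_mult[OF T Mg, symmetric] by simp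
    then show "u \<in> W" using mat_app_in[OF Mg, of w] by (simp add: W_def w mat_app_scale)
  qed
  moreover have "W \<noteq> {\<lambda>i. 0}"
  proof
    define u where "u i = (if i < d then v $ i else 0)" for i
    assume "W = {\<lambda>i. 0}"
    moreover have "u \<in> W"
    proof -
      have "mat_app T u i = c * u i" for i
      proof (cases "i < d")
        case True
        then have "mat_app T u i = (T *\<^sub>v v) $ i"
          using T v(1) by (auto simp: mat_app_def scalar_prod_def u_def atLeast0LessThan intro!: sum.cong)
        also have "\<dots> = c * u i" using True v(1) unfolding v(3) by (simp add: u_def)
        finally show ?thesis .
      qed (use T in \<open>simp add: mat_app_def u_def\<close>)
      then show ?thesis by (auto simp: W_def u_def coord_space_def)
    qed
    ultimately have "u i = 0" for i by (simp add: fun_eq_iff)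
    then have "v = 0\<^sub>v d" using v(1) by (intro eq_vecI) (auto simp: u_def split: if_splits, metis)
    with v(2) show False ..
  qed
  ultimately have W: "W = coord_space {..<d}" using M unfolding irr_matrep_def by blast
  have "T = c \<cdot>\<^sub>m 1\<^sub>m d"
  proof (rule mat_app_eqI[OF T])
    fix u :: "nat \<Rightarrow> complex" assume u: "u \<in> coord_space {..<d}"
    then have "mat_app T u = (\<lambda>i. c * u i)" using W by (auto simp: W_def)
    also have "(\<lambda>i. c * u i) = mat_app (c \<cdot>\<^sub>m 1\<^sub>m d) u"
      using u by (auto simp: mat_app_def coord_space_def fun_eq_iff if_distrib[of "\<lambda>x. _ * x * _"] cong: if_cong)
    finally show "mat_app T u = mat_app (c \<cdot>\<^sub>m 1\<^sub>m d) u" .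
  qed simp
  then show ?thesis ..
qed

section \<open>Averaging over the group and orthogonality of characters\<close>

definition unit_mat_at :: "nat \<Rightarrow> nat \<Rightarrow> nat \<Rightarrow> nat \<Rightarrow> complex mat" where
  "unit_mat_at a b j k = mat a b (\<lambda>(i, l). if i = j \<and> l = k then 1 else 0)"

lemma unit_mat_at_carrier [simp]: "unit_mat_at a b j k \<in> carrier_mat a b"
  by (simp add: unit_mat_at_def)

lemma sum_delta_left:
  fixes f :: "nat \<Rightarrow> 'a::semiring_1"
  shows "j < n \<Longrightarrow> (\<Sum>i<n. (if i = j then 1 else 0) * f i) = f j"
  by (subst sum.cong[OF refl, of _ _ "\<lambda>i. if i = j then f i else 0"]) auto

lemma sum_delta_right:
  fixes f :: "nat \<Rightarrow> 'a::semiring_1"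
  shows "j < n \<Longrightarrow> (\<Sum>i<n. f i * (if i = j then 1 else 0)) = f j"
  by (subst sum.cong[OF refl, of _ _ "\<lambda>i. if i = j then f i else 0"]) auto

text \<open>A matrix unit between two factors extracts a product of two single entries. Under
  \<open>average\<close> this turns sums of products of matrix coefficients into entries of
  intertwiners.\<close>

lemma entry_sandwich:
  assumes A: "A \<in> carrier_mat m a" and B: "B \<in> carrier_mat b n"
    and "i < m" "l < n" "j < a" "k < b"
  shows "(A * unit_mat_at a b j k * B) $$ (i, l) = A $$ (i, j) * B $$ (k, l)"
proof -
  have A': "A * unit_mat_at a b j k \<in> carrier_mat m b" using A by simp
  have e: "(A * unit_mat_at a b j k) $$ (i, k') = A $$ (i, j) * (if k' = k then 1 else 0)" if "k' < b" for k'
  proof -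
    have "(A * unit_mat_at a b j k) $$ (i, k') = (\<Sum>q<a. A $$ (i, q) * unit_mat_at a b j k $$ (q, k'))"
      by (rule mat_mult_entry[OF A]) (use assms that in auto)
    also have "\<dots> = (\<Sum>q<a. (A $$ (i, q) * (if k' = k then 1 else 0)) * (if q = j then 1 else 0))"
      using that by (intro sum.cong) (auto simp: unit_mat_at_def)
    also have "\<dots> = A $$ (i, j) * (if k' = k then 1 else 0)"
      by (rule sum_delta_right[OF assms(5)])
    finally show ?thesis .
  qed
  have "(A * unit_mat_at a b j k * B) $$ (i, l) = (\<Sum>q<b. (if q = k then 1 else 0) * (A $$ (i, j) * B $$ (q, l)))"
    unfolding mat_mult_entry[OF A' B assms(3,4)] by (intro sum.cong) (auto simp: e)
  also have "\<dots> = A $$ (i, j) * B $$ (k, l)" by (rule sum_delta_left[OF assms(6)])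
  finally show ?thesis .
qed

lemma mat_trace_unit_mat_at_mult:
  assumes Q: "Q \<in> carrier_mat b a" "j < a" "k < b"
  shows "mat_trace (unit_mat_at a b j k * Q) = Q $$ (k, j)"
proof -
  have "mat_trace (unit_mat_at a b j k * Q) = mat_trace (1\<^sub>m a * unit_mat_at a b j k * Q)" by (simp add: left_mult_one_mat[of _ a b])
  also have "\<dots> = (\<Sum>i<a. (1\<^sub>m a * unit_mat_at a b j k * Q) $$ (i, i))" using Q by (simp add: mat_trace_def)
  also have "\<dots> = (\<Sum>i<a. 1\<^sub>m a $$ (i, j) * Q $$ (k, i))"
    by (intro sum.cong refl entry_sandwich[of _ a]) (use assms in auto)
  also have "\<dots> = (\<Sum>i<a. (if i = j then 1 else 0) * Q $$ (k, i))" using assms by (intro sum.cong) auto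
  also have "\<dots> = Q $$ (k, j)" by (rule sum_delta_left[OF assms(2)])
  finally show ?thesis .
qed

locale finite_group = group +
  assumes finite_carrier: "finite (carrier G)"
begin

definition msum :: "nat \<Rightarrow> nat \<Rightarrow> ('a \<Rightarrow> complex mat) \<Rightarrow> complex mat" where
  "msum a b F = mat a b (\<lambda>(i, j). \<Sum>g\<in>carrier G. F g $$ (i, j))"

lemma msum_carrier [simp]: "msum a b F \<in> carrier_mat a b"
  by (simp add: msum_def)

lemma msum_entry: "i < a \<Longrightarrow> j < b \<Longrightarrow> msum a b F $$ (i, j) = (\<Sum>g\<in>carrier G. F g $$ (i, j))"
  by (simp add: msum_def)

lemma msum_cong: "(\<And>g. g \<in> carrier G \<Longrightarrow> F g = F' g) \<Longrightarrow> msum a b F = msum a b F'"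
  by (simp add: msum_def)

lemma mult_msum:
  assumes A: "A \<in> carrier_mat c a" and F: "\<And>g. g \<in> carrier G \<Longrightarrow> F g \<in> carrier_mat a b"
  shows "A * msum a b F = msum c b (\<lambda>g. A * F g)"
proof (rule eq_matI)
  fix i j assume "i < dim_row (msum c b (\<lambda>g. A * F g))" "j < dim_col (msum c b (\<lambda>g. A * F g))"
  then have ij: "i < c" "j < b" by (auto simp: msum_def)
  have "(A * msum a b F) $$ (i, j) = (\<Sum>k<a. \<Sum>g\<in>carrier G. A $$ (i, k) * F g $$ (k, j))"
    unfolding mat_mult_entry[OF A msum_carrier ij] using ij by (simp add: msum_entry sum_distrib_left)
  also have "\<dots> = (\<Sum>g\<in>carrier G. (A * F g) $$ (i, j))"
    by (subst sum.swap) (intro sum.cong refl mat_mult_entry[OF A F ij, symmetric])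
  finally show "(A * msum a b F) $$ (i, j) = msum c b (\<lambda>g. A * F g) $$ (i, j)"
    by (simp add: msum_entry ij)
qed (use A in \<open>auto simp: msum_def\<close>)

lemma msum_mult:
  assumes B: "B \<in> carrier_mat b c" and F: "\<And>g. g \<in> carrier G \<Longrightarrow> F g \<in> carrier_mat a b"
  shows "msum a b F * B = msum a c (\<lambda>g. F g * B)"
proof (rule eq_matI)
  fix i j assume "i < dim_row (msum a c (\<lambda>g. F g * B))" "j < dim_col (msum a c (\<lambda>g. F g * B))"
  then have ij: "i < a" "j < c" by (auto simp: msum_def)
  have "(msum a b F * B) $$ (i, j) = (\<Sum>k<b. \<Sum>g\<in>carrier G. F g $$ (i, k) * B $$ (k, j))"
    unfolding mat_mult_entry[OF msum_carrier B ij] using ij by (simp add: msum_entry sum_distrib_right)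
  also have "\<dots> = (\<Sum>g\<in>carrier G. (F g * B) $$ (i, j))"
    by (subst sum.swap) (intro sum.cong refl mat_mult_entry[OF F B ij, symmetric])
  finally show "(msum a b F * B) $$ (i, j) = msum a c (\<lambda>g. F g * B) $$ (i, j)"
    by (simp add: msum_entry ij)
qed (use B in \<open>auto simp: msum_def\<close>)

lemma bij_betw_lmult: "h \<in> carrier G \<Longrightarrow> bij_betw (\<lambda>g. h \<otimes> g) (carrier G) (carrier G)"
  by (rule bij_betw_byWitness[where f' = "\<lambda>g. inv h \<otimes> g"]) (auto simp: m_assoc[symmetric])

lemma bij_betw_inv: "bij_betw (\<lambda>g. inv g) (carrier G) (carrier G)"
  by (rule bij_betw_byWitness[where f' = "\<lambda>g. inv g"]) auto

lemma msum_lmult: "h \<in> carrier G \<Longrightarrow> msum a b (\<lambda>g. F (h \<otimes> g)) = msum a b F"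
  unfolding msum_def by (subst sum.reindex_bij_betw[OF bij_betw_lmult]) auto

lemma mat_trace_msum:
  assumes "\<And>g. g \<in> carrier G \<Longrightarrow> F g \<in> carrier_mat a a"
  shows "mat_trace (msum a a F) = (\<Sum>g\<in>carrier G. mat_trace (F g))"
proof -
  have "mat_trace (msum a a F) = (\<Sum>g\<in>carrier G. \<Sum>i<a. F g $$ (i, i))"
    by (subst sum.swap) (simp add: mat_trace_def msum_def)
  also have "\<dots> = (\<Sum>g\<in>carrier G. mat_trace (F g))"
    using carrier_matD(1)[OF assms] by (simp add: mat_trace_def)
  finally show ?thesis .
qed

lemma matrep_inv:
  assumes "matrep G d M" "g \<in> carrier G"
  shows "M g * M (inv g) = 1\<^sub>m d" "M (inv g) * M g = 1\<^sub>m d"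
  using matrep_mult[OF assms(1), of g "inv g"] matrep_mult[OF assms(1), of "inv g" g] assms matrep_one[OF assms(1)] by auto

text \<open>The usual projection onto the intertwiners from \<open>N\<close> to \<open>M\<close>,
  without division by the group order.\<close>

definition average :: "nat \<Rightarrow> nat \<Rightarrow> ('a \<Rightarrow> complex mat) \<Rightarrow> ('a \<Rightarrow> complex mat) \<Rightarrow> complex mat \<Rightarrow> complex mat" where
  "average d e M N T = msum d e (\<lambda>g. M g * T * N (inv g))"

lemma average_carrier [simp]: "average d e M N T \<in> carrier_mat d e"
  by (simp add: average_def)

lemma average_intertwines:
  assumes M: "matrep G d M" and N: "matrep G e N" and T: "T \<in> carrier_mat d e" and h: "h \<in> carrier G"
  shows "M h * average d e M N T = average d e M N T * N h"
proof -
  note cM = matrep_carrier[OF M] and cN = matrep_carrier[OF N]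
  have c: "M g * T * N (inv g) \<in> carrier_mat d e" if "g \<in> carrier G" for g
    using cM[OF that] cN[of "inv g"] T that by simp
  have eq: "M h * (M g * T * N (inv g)) = M (h \<otimes> g) * T * N (inv (h \<otimes> g)) * N h" if g: "g \<in> carrier G" for g
  proof -
    have cc: "M g \<in> carrier_mat d d" "M h \<in> carrier_mat d d" "N (inv g) \<in> carrier_mat e e" "N h \<in> carrier_mat e e"
      "N (inv h) \<in> carrier_mat e e" using cM cN g h by auto
    have "M (h \<otimes> g) * T * N (inv (h \<otimes> g)) * N h = M (h \<otimes> g) * T * (N (inv (h \<otimes> g)) * N h)"
      by (rule assoc_mult_mat[of _ d e _ e _ e]) (use mult_carrier_mat[OF cM[OF m_closed[OF h g]] T] cN g h in auto)
    also have "N (inv (h \<otimes> g)) * N h = N (inv (h \<otimes> g) \<otimes> h)"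
      using g h by (simp add: matrep_mult[OF N])
    also have "inv (h \<otimes> g) \<otimes> h = inv g" using g h by (simp add: inv_mult_group m_assoc)
    finally have 1: "M (h \<otimes> g) * T * N (inv (h \<otimes> g)) * N h = M (h \<otimes> g) * T * N (inv g)" .
    have "M h * M g * T * N (inv g) = M h * (M g * T) * N (inv g)"
      using cc T by (subst assoc_mult_mat[of "M h" d d "M g" d T e]) auto
    also have "\<dots> = M h * (M g * T * N (inv g))"
      using cc T by (intro assoc_mult_mat[of _ d d _ e _ e]) auto
    finally show ?thesis unfolding 1 unfolding matrep_mult[OF M h g] by simp
  qed
  have "M h * average d e M N T = msum d e (\<lambda>g. M (h \<otimes> g) * T * N (inv (h \<otimes> g)) * N h)"
    unfolding average_def by (subst mult_msum[OF cM[OF h] c]) (auto intro!: msum_cong eq)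
  also have "\<dots> = msum d e (\<lambda>g. M g * T * N (inv g) * N h)"
    by (rule msum_lmult[OF h, where F = "\<lambda>g. M g * T * N (inv g) * N h"])
  also have "\<dots> = average d e M N T * N h"
    unfolding average_def by (rule msum_mult[OF cN[OF h] c, symmetric])
  finally show ?thesis .
qed

lemma average_unit_entry:
  assumes M: "matrep G d M" and N: "matrep G e N" and "i < d" "l < e" "j < d" "k < e"
  shows "average d e M N (unit_mat_at d e j k) $$ (i, l) = (\<Sum>g\<in>carrier G. M g $$ (i, j) * N (inv g) $$ (k, l))"
  unfolding average_def msum_entry[OF assms(3,4)]
  by (intro sum.cong refl entry_sandwich[of _ d _ _ _ e] matrep_carrier[OF M] matrep_carrier[OF N] assms) auto

lemma sum_trace_mult_trace:
  assumes M: "matrep G d M" and N: "matrep G e N"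
  shows "(\<Sum>g\<in>carrier G. mat_trace (M g) * mat_trace (N (inv g))) =
    (\<Sum>i<d. \<Sum>k<e. average d e M N (unit_mat_at d e i k) $$ (i, k))"
proof -
  have "(\<Sum>g\<in>carrier G. mat_trace (M g) * mat_trace (N (inv g))) =
     (\<Sum>g\<in>carrier G. \<Sum>i<d. \<Sum>k<e. M g $$ (i, i) * N (inv g) $$ (k, k))"
    using carrier_matD(1)[OF matrep_carrier[OF M]] carrier_matD(1)[OF matrep_carrier[OF N]]
    by (intro sum.cong) (auto simp: mat_trace_def sum_product)
  also have "\<dots> = (\<Sum>i<d. \<Sum>k<e. \<Sum>g\<in>carrier G. M g $$ (i, i) * N (inv g) $$ (k, k))"
    by (subst sum.swap, rule sum.cong[OF refl], subst sum.swap) simp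
  also have "\<dots> = (\<Sum>i<d. \<Sum>k<e. average d e M N (unit_mat_at d e i k) $$ (i, k))"
    by (intro sum.cong) (auto simp: average_unit_entry[OF M N])
  finally show ?thesis .
qed

text \<open>A nonzero average would be an isomorphism and force equal characters, against the values
  at \<open>g0\<close>. So all averages vanish, in particular those of the matrix units, whose
  entries make up the sum.\<close>

lemma orthogonal_neq:
  assumes M: "irr_matrep G d M" and N: "irr_matrep G e N"
    and "g0 \<in> carrier G" "mat_trace (M g0) \<noteq> mat_trace (N g0)"
  shows "(\<Sum>g\<in>carrier G. mat_trace (M g) * mat_trace (N (inv g))) = 0"
proof -
  have M': "matrep G d M" and N': "matrep G e N" using M N by (auto simp: irr_matrep_def)
  note cM = matrep_carrier[OF M'] and cN = matrep_carrier[OF N']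
  have "average d e M N T = 0\<^sub>m d e" if T: "T \<in> carrier_mat d e" for T
  proof (rule ccontr)
    let ?A = "average d e M N T"
    assume nz: "?A \<noteq> 0\<^sub>m d e"
    have A: "?A \<in> carrier_mat d e" by simp
    note int = average_intertwines[OF M' N' T]
    obtain Q where Q: "Q \<in> carrier_mat e d" "?A * Q = 1\<^sub>m d"
      using schur_surjective[OF M A cN int] nz by blast
    have "\<not> (\<forall>v\<in>coord_space {..<e}. mat_app ?A v = (\<lambda>i. 0))" using nz mat_app_zero_imp[OF A] by blast
    define K where "K = {v \<in> coord_space {..<e}. mat_app ?A v = (\<lambda>i. 0)}"
    have "linear_subspace (coord_space {..<e}) K"
      unfolding linear_subspace_def K_def
      by (auto simp: coord_space_def mat_app_zero mat_app_add mat_app_scale)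
    moreover have "mat_app (N g) ` K \<subseteq> K" if "g \<in> carrier G" for g
    proof
      fix u assume "u \<in> mat_app (N g) ` K"
      then obtain w where w: "w \<in> coord_space {..<e}" "mat_app ?A w = (\<lambda>i. 0)" "u = mat_app (N g) w"
        by (auto simp: K_def)
      have "mat_app ?A u = mat_app (M g) (mat_app ?A w)"
        using int[OF that] unfolding w(3) mat_app_mult[OF cM[OF that] A, symmetric] mat_app_mult[OF A cN[OF that], symmetric] by simp
      then show "u \<in> K" using mat_app_in[OF cN[OF that], of w] by (simp add: K_def w mat_app_zero)
    qed
    ultimately have "K = {\<lambda>i. 0} \<or> K = coord_space {..<e}" using N unfolding irr_matrep_def by blast
    moreover have "K \<noteq> coord_space {..<e}"
      using nz mat_app_zero_imp[OF A] by (auto simp: K_def)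
    ultimately have K: "K = {\<lambda>i. 0}" by blast
    \<comment> \<open>\<open>d = e\<close> is not known here, so the right inverse must be shown to
      be a left inverse by hand: \<open>?A\<close> maps \<open>Q * ?A\<close> applied to
      \<open>v\<close> to the same vector as \<open>v\<close>, and its kernel is trivial.\<close>
    have QA: "Q * ?A = 1\<^sub>m e"
    proof (rule mat_app_eqI)
      fix v :: "nat \<Rightarrow> complex" assume v: "v \<in> coord_space {..<e}"
      let ?w = "mat_app (Q * ?A) v"
      have w: "?w \<in> coord_space {..<e}" by (rule mat_app_in[of _ e e]) (use Q in auto)
      have "mat_app ?A ?w = mat_app (?A * (Q * ?A)) v"
        by (rule mat_app_mult[symmetric, of _ d e _ e]) (use Q in auto)
      also have "?A * (Q * ?A) = ?A" using assoc_mult_mat[OF A Q(1) A] Q(2) left_mult_one_mat[OF A] by simp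
      finally have 1: "mat_app ?A ?w = mat_app ?A v" .
      define u where "u = (\<lambda>i. ?w i + (- 1) * v i)"
      have "mat_app ?A u = (\<lambda>i. 0)"
        unfolding u_def mat_app_add mat_app_scale 1 by simp
      moreover have "u \<in> coord_space {..<e}" using v w by (simp add: u_def coord_space_def)
      ultimately have "u \<in> K" by (simp add: K_def)
      then have "?w i = v i" for i unfolding K by (simp add: u_def fun_eq_iff)
      then show "?w = mat_app (1\<^sub>m e) v" using mat_app_one[OF v] by auto
    qed (use Q in auto)
    have "mat_trace (N g0) = mat_trace (Q * (?A * N g0))"
      using cN[OF assms(3)] assoc_mult_mat[OF Q(1) A cN[OF assms(3)]] QA by simp
    also have "\<dots> = mat_trace (Q * M g0 * ?A)"
      using int[OF assms(3)] assoc_mult_mat[OF Q(1) cM[OF assms(3)] A] by simp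
    also have "\<dots> = mat_trace (M g0)"
      by (rule mat_trace_similar[OF cM[OF assms(3)] A Q])
    finally show False using assms(4) by simp
  qed
  then show ?thesis unfolding sum_trace_mult_trace[OF M' N'] by simp
qed

text \<open>By Schur's lemma the average of a matrix unit is a scalar matrix, and its trace
  identifies the scalar: \<open>order G / d\<close> for diagonal units and 0 for the others.\<close>

lemma orthogonal_eq:
  assumes M: "irr_matrep G d M"
  shows "(\<Sum>g\<in>carrier G. mat_trace (M g) * mat_trace (M (inv g))) = of_nat (order G)"
proof -
  have M': "matrep G d M" and d: "d > 0" using M by (auto simp: irr_matrep_def)
  note cM = matrep_carrier[OF M']
  have av: "average d d M M (unit_mat_at d d i k) $$ (i, k) = (if k = i then 1 else 0) * (of_nat (order G) / of_nat d)"
    if ik: "i < d" "k < d" for i k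
  proof -
    let ?E = "unit_mat_at d d i k"
    obtain c where c: "average d d M M ?E = c \<cdot>\<^sub>m 1\<^sub>m d"
      using schur_scalar[OF M average_carrier average_intertwines[OF M' M' unit_mat_at_carrier]] by blast
    have "mat_trace (M g * ?E * M (inv g)) = (if k = i then 1 else 0)" if g: "g \<in> carrier G" for g
    proof -
      have "mat_trace (M g * ?E * M (inv g)) = mat_trace ?E"
        by (rule mat_trace_similar[of _ d]) (use cM g matrep_inv[OF M'] in auto)
      also have "\<dots> = mat_trace (?E * 1\<^sub>m d)" by (simp add: right_mult_one_mat[of _ d d])
      also have "\<dots> = (if k = i then 1 else 0)"
        by (subst mat_trace_unit_mat_at_mult) (use ik in auto)
      finally show ?thesis .
    qed
    then have "mat_trace (average d d M M ?E) = (\<Sum>g\<in>carrier G. if k = i then 1 else 0)"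
      unfolding average_def by (subst mat_trace_msum) (use mult_carrier_mat[OF mult_carrier_mat[OF cM unit_mat_at_carrier] cM[OF inv_closed]] in auto)
    also have "\<dots> = (if k = i then 1 else 0) * of_nat (order G)" by (simp add: order_def)
    also have "mat_trace (average d d M M ?E) = c * of_nat d"
      unfolding c by (subst mat_trace_smult[of _ d]) (simp_all add: mat_trace_one)
    finally show ?thesis using d ik unfolding c by (auto simp: field_simps)
  qed
  have "(\<Sum>g\<in>carrier G. mat_trace (M g) * mat_trace (M (inv g))) =
    (\<Sum>i<d. \<Sum>k<d. (if k = i then 1 else 0) * (of_nat (order G) / of_nat d))"
    unfolding sum_trace_mult_trace[OF M' M'] by (intro sum.cong refl av) auto
  also have "\<dots> = (\<Sum>i<d. of_nat (order G) / of_nat d)"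
    by (intro sum.cong refl sum_delta_left) auto
  also have "\<dots> = of_nat (order G)" using d by simp
  finally show ?thesis .
qed

end

section \<open>Characters\<close>

context finite_group
begin

lemma order_pos: "order G > 0"
  using finite_carrier by (simp add: order_gt_0_iff_finite)

lemma Irr_matrep:
  assumes "\<psi> \<in> Irr G"
  shows "\<exists>d M. irr_matrep G d M \<and> (\<forall>g\<in>carrier G. \<psi> g = mat_trace (M g)) \<and> \<psi> \<in> extensional (carrier G)"
proof -
  from assms obtain d :: nat and M where "irr_matrep G d M" "\<psi> = restrict (\<lambda>g. mat_trace (M g)) (carrier G)"
    unfolding Irr_eq[OF is_group] by blast
  then show ?thesis by (intro exI[of _ d] exI[of _ M]) auto
qed

lemma Irr_orthogonal:
  assumes "\<psi> \<in> Irr G" "\<phi> \<in> Irr G"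
  shows "(\<Sum>g\<in>carrier G. \<psi> g * \<phi> (inv g)) = (if \<psi> = \<phi> then of_nat (order G) else 0)"
proof -
  obtain d M where M: "irr_matrep G d M" "\<And>g. g \<in> carrier G \<Longrightarrow> \<psi> g = mat_trace (M g)" "\<psi> \<in> extensional (carrier G)"
    using Irr_matrep[OF assms(1)] by blast
  obtain e N where N: "irr_matrep G e N" "\<And>g. g \<in> carrier G \<Longrightarrow> \<phi> g = mat_trace (N g)" "\<phi> \<in> extensional (carrier G)"
    using Irr_matrep[OF assms(2)] by blast
  show ?thesis
  proof (cases "\<psi> = \<phi>")
    case True
    then show ?thesis using orthogonal_eq[OF M(1)] M(2) by simp
  next
    case False
    then obtain g0 where "g0 \<in> carrier G" "\<psi> g0 \<noteq> \<phi> g0"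
      using extensionalityI[OF M(3) N(3)] by blast
    then show ?thesis using False orthogonal_neq[OF M(1) N(1), of g0] M(2) N(2) by simp
  qed
qed

lemma Irr_one:
  assumes "\<psi> \<in> Irr G"
  obtains d where "d > 0" "\<psi> \<one> = of_nat d"
proof -
  obtain d M where M: "irr_matrep G d M" "\<And>g. g \<in> carrier G \<Longrightarrow> \<psi> g = mat_trace (M g)"
    using Irr_matrep[OF assms] by blast
  then have "d > 0" "\<psi> \<one> = of_nat d"
    using matrep_one[of G d M] by (auto simp: irr_matrep_def mat_trace_one)
  then show thesis by (rule that)
qed

lemma multiplicity_eq:
  assumes "set \<psi>s \<subseteq> Irr G" "\<And>g. g \<in> carrier G \<Longrightarrow> f g = (\<Sum>\<psi>\<leftarrow>\<psi>s. \<psi> g)" "\<phi> \<in> Irr G"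
  shows "(\<Sum>g\<in>carrier G. f g * \<phi> (inv g)) = of_nat (count_list \<psi>s \<phi>) * of_nat (order G)"
proof -
  have "(\<Sum>g\<in>carrier G. (\<Sum>\<psi>\<leftarrow>\<psi>s. \<psi> g) * \<phi> (inv g)) = of_nat (count_list \<psi>s \<phi>) * of_nat (order G)"
    using assms(1)
    by (induction \<psi>s) (auto simp: ring_distribs sum.distrib Irr_orthogonal[OF _ assms(3)])
  then show ?thesis using assms(2) by simp
qed

definition reg_char :: "'a \<Rightarrow> complex" where
  "reg_char g = (if g = \<one> then of_nat (order G) else 0)"

lemma reg_char_matrep: "\<exists>d M. matrep G d M \<and> (\<forall>g\<in>carrier G. mat_trace (M g) = reg_char g)"
proof -
  define m where "m g a b = (if a = g \<otimes> b then 1 else 0 :: complex)" for g a b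
  have "\<exists>d M. matrep G d M \<and> (\<forall>g. mat_trace (M g) = (\<Sum>a\<in>carrier G. m g a a))"
  proof (rule matrep_of_kernel[OF is_group finite_carrier, where m = m])
    fix g h a c assume *: "g \<in> carrier G" "h \<in> carrier G" "a \<in> carrier G" "c \<in> carrier G"
    have "(\<Sum>b\<in>carrier G. m g a b * m h b c) = (\<Sum>b\<in>carrier G. if b = h \<otimes> c then m g a b else 0)"
      by (intro sum.cong) (auto simp: m_def)
    also have "\<dots> = m g a (h \<otimes> c)" using * finite_carrier by simp
    also have "\<dots> = m (g \<otimes> h) a c" using * by (simp add: m_def m_assoc)
    finally show "m (g \<otimes> h) a c = (\<Sum>b\<in>carrier G. m g a b * m h b c)" by simp
  qed (auto simp: m_def)
  moreover have "(\<Sum>a\<in>carrier G. m g a a) = reg_char g" if "g \<in> carrier G" for g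
  proof -
    have "m g a a = (if g = \<one> then 1 else 0)" if "a \<in> carrier G" for a
      using that \<open>g \<in> carrier G\<close> by (metis m_def l_one one_closed right_cancel)
    then show ?thesis by (simp add: reg_char_def order_def)
  qed
  ultimately show ?thesis by (metis (no_types, lifting))
qed

lemma sum_reg_char_mult:
  assumes "\<phi> \<in> Irr G"
  shows "(\<Sum>g\<in>carrier G. reg_char g * \<phi> (inv g)) = of_nat (order G) * \<phi> \<one>"
proof -
  have "(\<Sum>g\<in>carrier G. reg_char g * \<phi> (inv g)) = (\<Sum>g\<in>carrier G. if g = \<one> then of_nat (order G) * \<phi> \<one> else 0)"
    by (intro sum.cong) (auto simp: reg_char_def)
  then show ?thesis using finite_carrier by simp
qed

text \<open>By orthogonality each irreducible character occurs in the regular one with multiplicity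
  equal to its degree, so all of them appear in one fixed list.\<close>

lemma finite_Irr: "finite (Irr G)"
proof -
  obtain d M where M: "matrep G d M" "\<forall>g\<in>carrier G. mat_trace (M g) = reg_char g"
    using reg_char_matrep by blast
  obtain \<psi>s where \<psi>s: "set \<psi>s \<subseteq> Irr G" "\<forall>g\<in>carrier G. mat_trace (M g) = (\<Sum>\<psi>\<leftarrow>\<psi>s. \<psi> g)"
    using matrep_trace_decomp[OF is_group M(1)] by blast
  have "\<phi> \<in> set \<psi>s" if \<phi>: "\<phi> \<in> Irr G" for \<phi>
  proof -
    have "of_nat (count_list \<psi>s \<phi>) * of_nat (order G) = of_nat (order G) * \<phi> \<one>"
      using multiplicity_eq[OF \<psi>s(1) _ \<phi>, of reg_char] \<psi>s(2) M(2) sum_reg_char_mult[OF \<phi>] by simp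
    then have "count_list \<psi>s \<phi> \<noteq> 0"
      using order_pos Irr_one[OF \<phi>] by (metis mult_eq_0_iff of_nat_eq_0_iff not_gr0)
    then show ?thesis by (metis count_notin)
  qed
  then show ?thesis by (meson List.finite_set finite_subset subsetI)
qed

lemma matrep_trace_multiplicities:
  assumes "matrep G d M"
  shows "\<exists>m. (\<forall>g\<in>carrier G. mat_trace (M g) = (\<Sum>\<psi>\<in>Irr G. of_nat (m \<psi>) * \<psi> g)) \<and>
     (\<forall>\<phi>\<in>Irr G. (\<Sum>g\<in>carrier G. mat_trace (M g) * \<phi> (inv g)) = of_nat (m \<phi>) * of_nat (order G))"
proof -
  obtain \<psi>s where \<psi>s: "set \<psi>s \<subseteq> Irr G" "\<forall>g\<in>carrier G. mat_trace (M g) = (\<Sum>\<psi>\<leftarrow>\<psi>s. \<psi> g)"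
    using matrep_trace_decomp[OF is_group assms] by blast
  have "mat_trace (M g) = (\<Sum>\<psi>\<in>Irr G. of_nat (count_list \<psi>s \<psi>) * \<psi> g)" if "g \<in> carrier G" for g
  proof -
    have "mat_trace (M g) = (\<Sum>\<psi>\<in>Irr G. \<Sum>\<phi>\<leftarrow>\<psi>s. if \<phi> = \<psi> then \<psi> g else 0)"
      using \<psi>s(1) unfolding \<psi>s(2)[rule_format, OF that]
      by (induction \<psi>s) (auto simp: sum.distrib finite_Irr)
    also have "\<dots> = (\<Sum>\<psi>\<in>Irr G. of_nat (count_list \<psi>s \<psi>) * \<psi> g)"
    proof (rule sum.cong[OF refl])
      fix \<psi> :: "'a \<Rightarrow> complex"
      show "(\<Sum>\<phi>\<leftarrow>\<psi>s. if \<phi> = \<psi> then \<psi> g else 0) = of_nat (count_list \<psi>s \<psi>) * \<psi> g"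
        by (induction \<psi>s) (auto simp: algebra_simps)
    qed
    finally show ?thesis .
  qed
  then show ?thesis
    using multiplicity_eq[OF \<psi>s(1), of "\<lambda>g. mat_trace (M g)"] \<psi>s(2)
    by (intro exI[of _ "count_list \<psi>s"]) auto
qed

lemma reg_char_eq:
  assumes "g \<in> carrier G"
  shows "reg_char g = (\<Sum>\<psi>\<in>Irr G. \<psi> \<one> * \<psi> g)"
proof -
  obtain d M where M: "matrep G d M" "\<forall>g\<in>carrier G. mat_trace (M g) = reg_char g"
    using reg_char_matrep by blast
  obtain m where m: "\<forall>g\<in>carrier G. mat_trace (M g) = (\<Sum>\<psi>\<in>Irr G. of_nat (m \<psi>) * \<psi> g)"
     "\<forall>\<phi>\<in>Irr G. (\<Sum>g\<in>carrier G. mat_trace (M g) * \<phi> (inv g)) = of_nat (m \<phi>) * of_nat (order G)"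
    using matrep_trace_multiplicities[OF M(1)] by blast
  have "of_nat (m \<phi>) = \<phi> \<one>" if "\<phi> \<in> Irr G" for \<phi>
    using m(2)[rule_format, OF that] sum_reg_char_mult[OF that] M(2) order_pos by simp
  then show ?thesis using m(1) M(2) assms by simp
qed

text \<open>A direct route to conjugacy without a basis of the class functions. Summing the matrices
  of all conjugates of \<open>y\<close> gives a scalar matrix that depends only on
  \<open>\<psi> y\<close>, so the sums in \<open>key\<close> agree for \<open>a\<close> and
  \<open>b\<close> and every \<open>x\<close>. Weighting by degrees replaces \<psi> by the regular
  character, which sees equality of group elements.\<close>

lemma Irr_separates:
  assumes ab: "a \<in> carrier G" "b \<in> carrier G" "\<And>\<psi>. \<psi> \<in> Irr G \<Longrightarrow> \<psi> a = \<psi> b"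
  shows "\<exists>k\<in>carrier G. b = k \<otimes> a \<otimes> inv k"
proof -
  have key: "(\<Sum>k\<in>carrier G. \<psi> (k \<otimes> a \<otimes> inv k \<otimes> x)) = (\<Sum>k\<in>carrier G. \<psi> (k \<otimes> b \<otimes> inv k \<otimes> x))"
    if \<psi>: "\<psi> \<in> Irr G" and x: "x \<in> carrier G" for \<psi> x
  proof -
    obtain d M where M: "irr_matrep G d M" "\<And>g. g \<in> carrier G \<Longrightarrow> \<psi> g = mat_trace (M g)"
      using Irr_matrep[OF \<psi>] by blast
    have M': "matrep G d M" and d: "d > 0" using M by (auto simp: irr_matrep_def)
    note cM = matrep_carrier[OF M']
    have scal: "average d d M M (M y) = (of_nat (order G) * \<psi> y / of_nat d) \<cdot>\<^sub>m 1\<^sub>m d" if y: "y \<in> carrier G" for y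
    proof -
      obtain c where c: "average d d M M (M y) = c \<cdot>\<^sub>m 1\<^sub>m d"
        using schur_scalar[OF M(1) average_carrier average_intertwines[OF M' M' cM[OF y]]] by blast
      have c': "M g * M y * M (inv g) \<in> carrier_mat d d" if "g \<in> carrier G" for g
        using mult_carrier_mat[OF mult_carrier_mat[OF cM[OF that] cM[OF y]] cM[OF inv_closed[OF that]]] .
      have "mat_trace (average d d M M (M y)) = (\<Sum>g\<in>carrier G. mat_trace (M g * M y * M (inv g)))"
        unfolding average_def by (rule mat_trace_msum[OF c'])
      also have "\<dots> = (\<Sum>g\<in>carrier G. mat_trace (M y))"
        using cM y by (intro sum.cong refl mat_trace_similar[of _ d]) (auto simp: matrep_inv[OF M'])
      finally have "c * of_nat d = of_nat (order G) * \<psi> y"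
        unfolding c by (subst (asm) mat_trace_smult[of _ d]) (simp_all add: mat_trace_one M(2) y order_def)
      then have "c = of_nat (order G) * \<psi> y / of_nat d" using d by (simp add: field_simps)
      then show ?thesis unfolding c by simp
    qed
    have tr: "mat_trace (average d d M M (M y) * M x) = (\<Sum>k\<in>carrier G. \<psi> (k \<otimes> y \<otimes> inv k \<otimes> x))" if y: "y \<in> carrier G" for y
    proof -
      have c: "M k * M y * M (inv k) \<in> carrier_mat d d" if "k \<in> carrier G" for k
        using mult_carrier_mat[OF mult_carrier_mat[OF cM[OF that] cM[OF y]] cM[OF inv_closed[OF that]]] .
      have "average d d M M (M y) * M x = msum d d (\<lambda>k. M k * M y * M (inv k) * M x)"
        unfolding average_def by (rule msum_mult[OF cM[OF x] c])
      then have "mat_trace (average d d M M (M y) * M x) = (\<Sum>k\<in>carrier G. mat_trace (M k * M y * M (inv k) * M x))"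
        using mat_trace_msum[OF mult_carrier_mat[OF c cM[OF x]]] by simp
      also have "\<dots> = (\<Sum>k\<in>carrier G. \<psi> (k \<otimes> y \<otimes> inv k \<otimes> x))"
        using x y by (intro sum.cong) (auto simp: M(2) matrep_mult[OF M'])
      finally show ?thesis .
    qed
    show ?thesis using tr[OF ab(1)] tr[OF ab(2)] scal[OF ab(1)] scal[OF ab(2)] ab(3)[OF \<psi>] by simp
  qed
  have reg: "(\<Sum>k\<in>carrier G. reg_char (k \<otimes> y \<otimes> inv k \<otimes> x)) =
      (\<Sum>\<psi>\<in>Irr G. \<psi> \<one> * (\<Sum>k\<in>carrier G. \<psi> (k \<otimes> y \<otimes> inv k \<otimes> x)))" if "x \<in> carrier G" "y \<in> carrier G" for x y
    unfolding sum_distrib_left by (subst sum.swap) (intro sum.cong reg_char_eq, use that in auto)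
  \<comment> \<open>With \<open>x = inv b\<close> both sides count, up to the factor
    \<open>order G\<close>, the elements conjugating \<open>a\<close> respectively \<open>b\<close>
    to \<open>b\<close>; the right count is positive because of \<open>k = \<one>\<close>.\<close>
  have eq: "(\<Sum>k\<in>carrier G. reg_char (k \<otimes> a \<otimes> inv k \<otimes> inv b)) = (\<Sum>k\<in>carrier G. reg_char (k \<otimes> b \<otimes> inv k \<otimes> inv b))"
    using key[of _ "inv b"] ab by (simp add: reg cong: sum.cong)
  show ?thesis
  proof (rule ccontr)
    assume no: "\<not> ?thesis"
    have "k \<otimes> a \<otimes> inv k \<otimes> inv b \<noteq> \<one>" if k: "k \<in> carrier G" for k
    proof
      assume "k \<otimes> a \<otimes> inv k \<otimes> inv b = \<one>"
      then have "k \<otimes> a \<otimes> inv k = b" using ab k by (metis inv_closed inv_equality inv_inv m_closed)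
      then show False using no k by blast
    qed
    then have "(\<Sum>k\<in>carrier G. reg_char (k \<otimes> a \<otimes> inv k \<otimes> inv b)) = 0" by (simp add: reg_char_def)
    then have "of_nat (\<Sum>k\<in>carrier G. if k \<otimes> b \<otimes> inv k \<otimes> inv b = \<one> then order G else 0) = (0 :: complex)"
      using eq unfolding of_nat_sum by (simp add: reg_char_def if_distrib[of of_nat] cong: if_cong)
    then have "(\<Sum>k\<in>carrier G. if k \<otimes> b \<otimes> inv k \<otimes> inv b = \<one> then order G else 0) = 0"
      by (simp only: of_nat_eq_0_iff)
    then have "\<forall>k\<in>carrier G. (if k \<otimes> b \<otimes> inv k \<otimes> inv b = \<one> then order G else 0) = 0"
      using finite_carrier by (simp only: sum_eq_0_iff)
    from bspec[OF this one_closed] show False using ab order_pos by simp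
  qed
qed

text \<open>A central involution acts on each irreducible representation as 1 or -1. Equality of the
  sums forces 1 throughout, and then no character separates \<open>z\<close> from the identity.
  Later \<open>z\<close> is the scalar \<open>r / 2\<close>.\<close>

lemma central_involution_trivial:
  assumes z: "z \<in> carrier G" "\<And>g. g \<in> carrier G \<Longrightarrow> g \<otimes> z = z \<otimes> g" "z \<otimes> z = \<one>"
    and eq: "(\<Sum>\<psi>\<in>Irr G. \<psi> z) = (\<Sum>\<psi>\<in>Irr G. \<psi> \<one>)"
  shows "z = \<one>"
proof -
  have val: "\<psi> z = \<psi> \<one> \<or> \<psi> z = - \<psi> \<one>" if \<psi>: "\<psi> \<in> Irr G" for \<psi>
  proof -
    obtain d M where M: "irr_matrep G d M" "\<And>g. g \<in> carrier G \<Longrightarrow> \<psi> g = mat_trace (M g)"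
      using Irr_matrep[OF \<psi>] by blast
    have M': "matrep G d M" and d: "d > 0" using M by (auto simp: irr_matrep_def)
    note cM = matrep_carrier[OF M']
    obtain c where c: "M z = c \<cdot>\<^sub>m 1\<^sub>m d"
      using schur_scalar[OF M(1) cM[OF z(1)]] matrep_mult[OF M'] z by metis
    have "M z * M z = 1\<^sub>m d" using matrep_mult[OF M' z(1) z(1)] z(3) matrep_one[OF M'] by simp
    then have "c \<cdot>\<^sub>m (c \<cdot>\<^sub>m 1\<^sub>m d) = 1\<^sub>m d"
      unfolding c by (simp add: mult_smult_distrib[of _ d d _ d] mult_smult_assoc_mat[of _ d d _ d])
    then have "(c \<cdot>\<^sub>m (c \<cdot>\<^sub>m 1\<^sub>m d)) $$ (0, 0) = 1\<^sub>m d $$ (0, 0)" by simp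
    then have "c * c = 1" using d by simp
    then have "c = 1 \<or> c = -1" by (metis square_eq_1_iff)
    moreover have "\<psi> z = c * \<psi> \<one>"
      unfolding M(2)[OF z(1)] M(2)[OF one_closed] c matrep_one[OF M'] by (rule mat_trace_smult[of _ d]) simp
    ultimately show ?thesis by auto
  qed
  have pos: "\<psi> \<one> = of_real (Re (\<psi> \<one>))" "Re (\<psi> \<one>) > 0" if "\<psi> \<in> Irr G" for \<psi>
    using Irr_one[OF that] by (metis Re_complex_of_real of_real_of_nat_eq, metis Re_complex_of_real of_real_of_nat_eq of_nat_0_less_iff)
  have "(\<Sum>\<psi>\<in>Irr G. Re (\<psi> \<one>) - Re (\<psi> z)) = 0" using eq by (simp add: sum_subtractf flip: Re_sum)
  moreover have "0 \<le> Re (\<psi> \<one>) - Re (\<psi> z)" if "\<psi> \<in> Irr G" for \<psi>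
    using val[OF that] pos(2)[OF that] by auto
  ultimately have "\<forall>\<psi>\<in>Irr G. Re (\<psi> \<one>) - Re (\<psi> z) = 0"
    using sum_nonneg_eq_0_iff[OF finite_Irr, of "\<lambda>\<psi>. Re (\<psi> \<one>) - Re (\<psi> z)"] by simp
  then have "\<psi> z = \<psi> \<one>" if "\<psi> \<in> Irr G" for \<psi>
    using val[OF that] pos[OF that] that by fastforce
  then obtain k where "k \<in> carrier G" "z = k \<otimes> \<one> \<otimes> inv k"
    using Irr_separates[OF one_closed z(1)] by metis
  then show ?thesis by simp
qed

end

section \<open>Twisted Frobenius-Schur indicators\<close>

locale finite_group_involution = finite_group +
  fixes \<tau> :: "'a \<Rightarrow> 'a"
  assumes \<tau>_closed [simp]: "g \<in> carrier G \<Longrightarrow> \<tau> g \<in> carrier G"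
    and \<tau>_mult: "g \<in> carrier G \<Longrightarrow> h \<in> carrier G \<Longrightarrow> \<tau> (g \<otimes> h) = \<tau> g \<otimes> \<tau> h"
    and \<tau>_\<tau> [simp]: "g \<in> carrier G \<Longrightarrow> \<tau> (\<tau> g) = g"
begin

lemma \<tau>_one [simp]: "\<tau> \<one> = \<one>"
  using \<tau>_mult[of \<one> \<one>] by simp

lemma \<tau>_inv: "g \<in> carrier G \<Longrightarrow> \<tau> (inv g) = inv (\<tau> g)"
  using \<tau>_mult[of "inv g" g] by (intro inv_equality[symmetric]) auto

lemma bij_betw_\<tau>: "bij_betw \<tau> (carrier G) (carrier G)"
  by (rule bij_betw_byWitness[where f' = \<tau>]) auto

text \<open>This is the dual representation composed with \<tau>; inversion and transposition each
  reverse products.\<close>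

lemma matrep_transpose_inv:
  assumes M: "matrep G d M"
  shows "matrep G d (\<lambda>g. transpose_mat (M (\<tau> (inv g))))"
  unfolding matrep_def
proof (intro conjI ballI)
  fix g h assume gh: "g \<in> carrier G" "h \<in> carrier G"
  have "\<tau> (inv (g \<otimes> h)) = \<tau> (inv h) \<otimes> \<tau> (inv g)"
    using gh by (simp add: inv_mult_group \<tau>_mult)
  then have "M (\<tau> (inv (g \<otimes> h))) = M (\<tau> (inv h)) * M (\<tau> (inv g))"
    using gh by (simp add: matrep_mult[OF M])
  then show "transpose_mat (M (\<tau> (inv (g \<otimes> h)))) = transpose_mat (M (\<tau> (inv g))) * transpose_mat (M (\<tau> (inv h)))"
    using transpose_mult[of "M (\<tau> (inv h))" d d "M (\<tau> (inv g))" d] gh matrep_carrier[OF M] by simp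
qed (use matrep_carrier[OF M] matrep_one[OF M] in auto)

text \<open>
  The twisted Frobenius-Schur indicator: matrices \<open>T\<close> with \<open>M g T (M (\<tau> g))\<^sup>t = T\<close> for all \<open>g\<close> form a
  space of dimension at most one by Schur's lemma, which is stable under transposition.
\<close>

lemma frobenius_schur:
  assumes M: "irr_matrep G d M"
  defines "S \<equiv> \<Sum>h\<in>carrier G. mat_trace (M (h \<otimes> \<tau> h))"
  shows "(S = 0 \<and> (\<exists>g\<in>carrier G. mat_trace (M (\<tau> g)) \<noteq> mat_trace (M (inv g)))) \<or>
    ((S = of_nat (order G) \<or> S = - of_nat (order G)) \<and> (\<forall>g\<in>carrier G. mat_trace (M (\<tau> g)) = mat_trace (M (inv g))))"
proof -
  have M': "matrep G d M" and d: "d > 0" using M by (auto simp: irr_matrep_def)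
  note cM = matrep_carrier[OF M']
  define N where "N g = transpose_mat (M (\<tau> (inv g)))" for g
  have N: "matrep G d N" unfolding N_def by (rule matrep_transpose_inv[OF M'])
  note cN = matrep_carrier[OF N]
  let ?av = "average d d M N"
  let ?E = "unit_mat_at d d"
  have N_entry: "N (inv g) $$ (i, j) = M (\<tau> g) $$ (j, i)" if "g \<in> carrier G" "i < d" "j < d" for g i j
    using that cM[of "\<tau> g"] by (simp add: N_def)
  \<comment> \<open>\<open>N (inv h)\<close> is the transpose of \<open>M (\<tau> h)\<close>, so the
    trace of \<open>M h * M (\<tau> h)\<close> is a sum of products of coefficients of
    \<open>M h\<close> and \<open>N (inv h)\<close>, as they occur in averages of matrix
    units.\<close>
  have S: "S = (\<Sum>i<d. \<Sum>j<d. ?av (?E j i) $$ (i, j))"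
  proof -
    have "S = (\<Sum>h\<in>carrier G. \<Sum>i<d. \<Sum>j<d. M h $$ (i, j) * M (\<tau> h) $$ (j, i))"
      unfolding S_def
    proof (rule sum.cong[OF refl])
      fix h assume h: "h \<in> carrier G"
      have "mat_trace (M (h \<otimes> \<tau> h)) = (\<Sum>i<d. (M h * M (\<tau> h)) $$ (i, i))"
        using cM[of h] h by (simp add: mat_trace_def matrep_mult[OF M'] del: index_mult_mat(1))
      also have "\<dots> = (\<Sum>i<d. \<Sum>j<d. M h $$ (i, j) * M (\<tau> h) $$ (j, i))"
        by (intro sum.cong refl mat_mult_entry[of _ d _ _ d]) (use cM h in auto)
      finally show "mat_trace (M (h \<otimes> \<tau> h)) = (\<Sum>i<d. \<Sum>j<d. M h $$ (i, j) * M (\<tau> h) $$ (j, i))" .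
    qed
    also have "\<dots> = (\<Sum>i<d. \<Sum>j<d. \<Sum>h\<in>carrier G. M h $$ (i, j) * M (\<tau> h) $$ (j, i))"
      by (subst sum.swap, rule sum.cong[OF refl], subst sum.swap) simp
    also have "\<dots> = (\<Sum>i<d. \<Sum>j<d. ?av (?E j i) $$ (i, j))"
      by (intro sum.cong refl) (simp add: average_unit_entry[OF M' N] N_entry)
    finally show ?thesis .
  qed
  show ?thesis
  proof (cases "\<forall>U\<in>carrier_mat d d. ?av U = 0\<^sub>m d d")
    case True
    \<comment> \<open>If the traces agreed everywhere, \<open>N\<close> would have the character of
      \<open>M\<close>, and the orthogonality sum would be the group order although all averages
      vanish.\<close>
    have "\<exists>g\<in>carrier G. mat_trace (M (\<tau> g)) \<noteq> mat_trace (M (inv g))"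
    proof (rule ccontr)
      assume no: "\<not> ?thesis"
      have "mat_trace (N (inv g)) = mat_trace (M (\<tau> g))" if "g \<in> carrier G" for g
        using cM[of "\<tau> g"] that by (simp add: mat_trace_def N_def)
      then have "(\<Sum>g\<in>carrier G. mat_trace (M g) * mat_trace (M (inv g))) =
         (\<Sum>g\<in>carrier G. mat_trace (M g) * mat_trace (N (inv g)))" using no by simp
      also have "\<dots> = 0" unfolding sum_trace_mult_trace[OF M' N] using True by simp
      finally show False using orthogonal_eq[OF M] order_pos by simp
    qed
    moreover have "S = 0" unfolding S using True by simp
    ultimately show ?thesis by blast
  next
    case False
    then obtain U where U: "U \<in> carrier_mat d d" "?av U \<noteq> 0\<^sub>m d d" by blast
    define T where "T = ?av U"
    have T: "T \<in> carrier_mat d d" "T \<noteq> 0\<^sub>m d d" using U by (auto simp: T_def)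
    have int: "M g * T = T * N g" if "g \<in> carrier G" for g
      unfolding T_def by (rule average_intertwines[OF M' N U(1) that])
    obtain Q where Q: "Q \<in> carrier_mat d d" "T * Q = 1\<^sub>m d"
      using schur_surjective[OF M T(1) cN int] T(2) by blast
    have QT: "Q * T = 1\<^sub>m d" by (rule mat_mult_left_right_inverse[OF T(1) Q])
    have NQ: "N g * Q = Q * M g" if g: "g \<in> carrier G" for g
    proof -
      have "N g * Q = Q * T * (N g * Q)" using QT cN[OF g] Q by simp
      also have "\<dots> = Q * (T * (N g * Q))" using cN[OF g] Q T by (intro assoc_mult_mat[of _ d d _ d _ d]) auto
      also have "T * (N g * Q) = T * N g * Q" using cN[OF g] Q T by (intro assoc_mult_mat[symmetric, of _ d d _ d _ d]) auto
      also have "\<dots> = M g * T * Q" by (simp add: int[OF g])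
      also have "\<dots> = M g * (T * Q)" using cM[OF g] Q T by (intro assoc_mult_mat[of _ d d _ d _ d]) auto
      also have "\<dots> = M g" using Q cM[OF g] by simp
      finally show ?thesis .
    qed
    have tr: "mat_trace (M (\<tau> g)) = mat_trace (M (inv g))" if g: "g \<in> carrier G" for g
    proof -
      have "mat_trace (M (\<tau> g)) = mat_trace (N (inv g))"
        using cM[of "\<tau> g"] g by (simp add: mat_trace_def N_def)
      also have "N (inv g) = N (inv g) * (Q * T)" using QT cN[of "inv g"] g by simp
      also have "\<dots> = N (inv g) * Q * T" using cN[of "inv g"] Q T g by (intro assoc_mult_mat[symmetric, of _ d d _ d _ d]) auto
      also have "\<dots> = Q * M (inv g) * T" using g by (simp add: NQ)
      also have "mat_trace \<dots> = mat_trace (M (inv g))"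
        by (rule mat_trace_similar[of _ d]) (use cM g T Q in auto)
      finally show ?thesis .
    qed
    have scal: "\<exists>c. Y = c \<cdot>\<^sub>m T" if Y: "Y \<in> carrier_mat d d" "\<And>g. g \<in> carrier G \<Longrightarrow> M g * Y = Y * N g" for Y
    proof -
      have MYQ: "M g * (Y * Q) = Y * Q * M g" if g: "g \<in> carrier G" for g
      proof -
        have "M g * (Y * Q) = M g * Y * Q" using cM[OF g] Q Y by (intro assoc_mult_mat[symmetric, of _ d d _ d _ d]) auto
        also have "\<dots> = Y * N g * Q" by (simp add: Y(2)[OF g])
        also have "\<dots> = Y * (N g * Q)" using cN[OF g] Q Y by (intro assoc_mult_mat[of _ d d _ d _ d]) auto
        also have "\<dots> = Y * (Q * M g)" by (simp add: NQ[OF g])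
        also have "\<dots> = Y * Q * M g" using cM[OF g] Q Y by (intro assoc_mult_mat[symmetric, of _ d d _ d _ d]) auto
        finally show ?thesis .
      qed
      obtain c where c: "Y * Q = c \<cdot>\<^sub>m 1\<^sub>m d"
        using schur_scalar[OF M mult_carrier_mat[OF Y(1) Q(1)] MYQ] by blast
      have "Y = Y * (Q * T)" using QT Y by simp
      also have "\<dots> = Y * Q * T" using T Q Y by (intro assoc_mult_mat[symmetric, of _ d d _ d _ d]) auto
      also have "\<dots> = c \<cdot>\<^sub>m T" unfolding c using T by (simp add: mult_smult_assoc_mat[of _ d d _ d])
      finally show ?thesis by blast
    qed
    \<comment> \<open>Transposing the relation at \<open>\<tau> (inv g)\<close> exchanges
      \<open>M\<close> and \<open>N\<close> and yields the relation at \<open>g\<close> for the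
      transpose of \<open>T\<close>.\<close>
    have fixT: "M g * transpose_mat T = transpose_mat T * N g" if g: "g \<in> carrier G" for g
    proof -
      let ?t = "\<tau> (inv g)"
      have t: "?t \<in> carrier G" "inv g \<in> carrier G" using g by auto
      have Nt: "N ?t = transpose_mat (M g)" using g by (simp add: N_def \<tau>_inv)
      have Ng: "N g = transpose_mat (M ?t)" by (simp add: N_def)
      have "transpose_mat T * N g = transpose_mat (M ?t * T)"
        unfolding Ng using transpose_mult[OF cM[OF t(1)] T(1)] by simp
      also have "\<dots> = transpose_mat (T * N ?t)" by (simp add: int[OF t(1)])
      also have "\<dots> = M g * transpose_mat T"
        unfolding Nt using transpose_mult[OF T(1), of "transpose_mat (M g)" d] cM[OF g] by simp
      finally show ?thesis by simp
    qed
    obtain c0 where c0: "transpose_mat T = c0 \<cdot>\<^sub>m T" using scal[of "transpose_mat T"] fixT T by auto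
    \<comment> \<open>Transposing twice is the identity, so \<open>T\<close> is symmetric or
      antisymmetric; \<open>c0\<close> will be the indicator.\<close>
    have "c0 * c0 = 1"
    proof -
      have ent: "T $$ (j, i) = c0 * T $$ (i, j)" if "i < d" "j < d" for i j
        using arg_cong[OF c0, of "\<lambda>A. A $$ (i, j)"] that T by simp
      obtain i j where ij: "i < d" "j < d" "T $$ (i, j) \<noteq> 0"
        using T by (metis carrier_matD eq_matI index_zero_mat(1,2,3))
      have "T $$ (i, j) = c0 * (c0 * T $$ (i, j))"
        using ent[OF ij(1,2)] ent[OF ij(2,1)] by (rule subst)
      then show ?thesis using ij(3) by (simp add: mult.assoc[symmetric])
    qed
    then have c0': "c0 = 1 \<or> c0 = -1" by (metis square_eq_1_iff)
    \<comment> \<open>The average of a matrix unit is a multiple \<open>c\<close> of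
      \<open>T\<close>. Multiplying by \<open>Q\<close>, the inverse of \<open>T\<close>, and taking
      traces gives \<open>c * d = order G * Q $$ (i, j)\<close>. Summing up, \<open>S\<close>
      becomes \<open>order G / d\<close> times the trace of \<open>Q\<close> times the transpose of
      \<open>T\<close>, which is \<open>c0 * d\<close>.\<close>
    have av: "?av (?E j i) $$ (i, j) = of_nat (order G) / of_nat d * (Q $$ (i, j) * transpose_mat T $$ (j, i))"
      if ij: "i < d" "j < d" for i j
    proof -
      obtain c where c: "?av (?E j i) = c \<cdot>\<^sub>m T"
        using scal[OF average_carrier average_intertwines[OF M' N unit_mat_at_carrier]] by blast
      have cc: "M g * ?E j i * N (inv g) \<in> carrier_mat d d" if g: "g \<in> carrier G" for g
        using mult_carrier_mat[OF mult_carrier_mat[OF cM[OF g] unit_mat_at_carrier] cN[OF inv_closed[OF g]]] .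
      have "?av (?E j i) * Q = msum d d (\<lambda>g. M g * ?E j i * N (inv g) * Q)"
        unfolding average_def by (rule msum_mult[OF Q(1) cc])
      then have "mat_trace (?av (?E j i) * Q) = (\<Sum>g\<in>carrier G. mat_trace (M g * ?E j i * N (inv g) * Q))"
        using mat_trace_msum[OF mult_carrier_mat[OF cc Q(1)]] by simp
      also have "\<dots> = (\<Sum>g\<in>carrier G. Q $$ (i, j))"
      proof (rule sum.cong[OF refl])
        fix g assume g: "g \<in> carrier G"
        note car = cM[OF g] cM[OF inv_closed[OF g]] cN[OF inv_closed[OF g]] Q(1)
        have ME: "M g * ?E j i \<in> carrier_mat d d" using mult_carrier_mat[OF cM[OF g] unit_mat_at_carrier] .
        have "M g * ?E j i * N (inv g) * Q = M g * ?E j i * (N (inv g) * Q)"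
          using car ME by (intro assoc_mult_mat[of _ d d _ d _ d]) auto
        also have "N (inv g) * Q = Q * M (inv g)" using g by (simp add: NQ)
        also have "M g * ?E j i * (Q * M (inv g)) = M g * ?E j i * Q * M (inv g)"
          using car ME by (intro assoc_mult_mat[symmetric, of _ d d _ d _ d]) auto
        also have "M g * ?E j i * Q = M g * (?E j i * Q)"
          using car by (intro assoc_mult_mat[of _ d d _ d _ d]) auto
        finally have "mat_trace (M g * ?E j i * N (inv g) * Q) = mat_trace (M g * (?E j i * Q) * M (inv g))" by simp
        also have "\<dots> = mat_trace (?E j i * Q)"
          by (rule mat_trace_similar[of _ d]) (use car matrep_inv[OF M' g] in \<open>auto intro: mult_carrier_mat[of _ d d]\<close>)
        also have "\<dots> = Q $$ (i, j)" by (rule mat_trace_unit_mat_at_mult) (use Q ij in auto)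
        finally show "mat_trace (M g * ?E j i * N (inv g) * Q) = Q $$ (i, j)" .
      qed
      also have "mat_trace (?av (?E j i) * Q) = c * of_nat d"
        unfolding c using T Q by (simp add: mult_smult_assoc_mat[of _ d d _ d] mat_trace_smult[of _ d] mat_trace_one)
      finally have "c = of_nat (order G) / of_nat d * Q $$ (i, j)"
        using d by (simp add: order_def field_simps)
      then show ?thesis unfolding c using ij T by simp
    qed
    have "S = of_nat (order G) / of_nat d * (\<Sum>i<d. \<Sum>j<d. Q $$ (i, j) * transpose_mat T $$ (j, i))"
      unfolding S sum_distrib_left by (intro sum.cong refl) (auto simp: av)
    also have "(\<Sum>i<d. \<Sum>j<d. Q $$ (i, j) * transpose_mat T $$ (j, i)) = (\<Sum>i<d. (Q * transpose_mat T) $$ (i, i))"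
      by (intro sum.cong refl mat_mult_entry[symmetric, of _ d _ _ d]) (use T Q in auto)
    also have "\<dots> = mat_trace (Q * transpose_mat T)"
      using Q by (simp add: mat_trace_def del: index_mult_mat(1))
    also have "\<dots> = c0 * of_nat d"
      unfolding c0 using T Q QT by (simp add: mult_smult_distrib[of _ d d _ d] mat_trace_smult[of _ d] mat_trace_one)
    finally have "S = of_nat (order G) * c0" using d by simp
    then show ?thesis using c0' tr by auto
  qed
qed

lemma Irr_frobenius_schur:
  assumes "\<psi> \<in> Irr G"
  defines "S \<equiv> \<Sum>h\<in>carrier G. \<psi> (h \<otimes> \<tau> h)"
  shows "(S = 0 \<and> (\<exists>g\<in>carrier G. \<psi> (\<tau> g) \<noteq> \<psi> (inv g))) \<or>
    ((S = of_nat (order G) \<or> S = - of_nat (order G)) \<and> (\<forall>g\<in>carrier G. \<psi> (\<tau> g) = \<psi> (inv g)))"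
proof -
  obtain d M where M: "irr_matrep G d M" "\<And>g. g \<in> carrier G \<Longrightarrow> \<psi> g = mat_trace (M g)"
    using Irr_matrep[OF assms(1)] by blast
  show ?thesis using frobenius_schur[OF M(1)] unfolding S_def by (simp add: M(2))
qed

definition twisted_roots :: "'a \<Rightarrow> 'a set" where
  "twisted_roots g = {h \<in> carrier G. h \<otimes> \<tau> h = g}"

lemma sum_twisted_roots:
  fixes f :: "'a \<Rightarrow> complex"
  shows "(\<Sum>g\<in>carrier G. of_nat (card (twisted_roots g)) * f g) = (\<Sum>h\<in>carrier G. f (h \<otimes> \<tau> h))"
proof -
  have "(\<Sum>g\<in>carrier G. of_nat (card (twisted_roots g)) * f g) =
    (\<Sum>g\<in>carrier G. \<Sum>h\<in>{h \<in> carrier G. h \<otimes> \<tau> h = g}. f (h \<otimes> \<tau> h))"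
    by (intro sum.cong) (auto simp: twisted_roots_def)
  also have "\<dots> = (\<Sum>h\<in>carrier G. f (h \<otimes> \<tau> h))"
    by (rule sum.group[OF finite_carrier finite_carrier]) auto
  finally show ?thesis .
qed

text \<open>Conjugacy of \<open>\<tau> g\<close> and \<open>inv g\<close> rules out the indicator 0.
  The indicator of \<phi> is also its multiplicity in the trace of \<open>M\<close>, a natural
  number, so the value -1 is impossible too.\<close>

theorem sum_Irr_eq_if_twisted_roots:
  assumes M: "matrep G d M" and tr: "\<And>g. g \<in> carrier G \<Longrightarrow> mat_trace (M g) = of_nat (card (twisted_roots g))"
    and conj: "\<And>g. g \<in> carrier G \<Longrightarrow> \<exists>k\<in>carrier G. \<tau> g = k \<otimes> inv g \<otimes> inv k"
    and g: "g \<in> carrier G"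
  shows "mat_trace (M g) = (\<Sum>\<psi>\<in>Irr G. \<psi> g)"
proof -
  obtain m where m: "\<forall>g\<in>carrier G. mat_trace (M g) = (\<Sum>\<psi>\<in>Irr G. of_nat (m \<psi>) * \<psi> g)"
     "\<forall>\<phi>\<in>Irr G. (\<Sum>g\<in>carrier G. mat_trace (M g) * \<phi> (inv g)) = of_nat (m \<phi>) * of_nat (order G)"
    using matrep_trace_multiplicities[OF M] by blast
  have "m \<phi> = 1" if \<phi>: "\<phi> \<in> Irr G" for \<phi>
  proof -
    obtain e N where N: "irr_matrep G e N" "\<And>g. g \<in> carrier G \<Longrightarrow> \<phi> g = mat_trace (N g)"
      using Irr_matrep[OF \<phi>] by blast
    then have N': "matrep G e N" by (simp add: irr_matrep_def)
    have "\<phi> (\<tau> g) = \<phi> (inv g)" if g: "g \<in> carrier G" for g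
    proof -
      obtain k where k: "k \<in> carrier G" "\<tau> g = k \<otimes> inv g \<otimes> inv k" using conj[OF g] by blast
      have "\<phi> (\<tau> g) = mat_trace (N k * N (inv g) * N (inv k))"
        unfolding k(2) using k g by (simp add: N(2) matrep_mult[OF N'])
      also have "\<dots> = \<phi> (inv g)"
        unfolding N(2)[OF inv_closed[OF g]]
        by (rule mat_trace_similar[of _ e]) (use matrep_carrier[OF N'] k g matrep_inv[OF N'] in auto)
      finally show ?thesis .
    qed
    then have "(\<Sum>h\<in>carrier G. \<phi> (h \<otimes> \<tau> h)) = of_nat (order G) \<or> (\<Sum>h\<in>carrier G. \<phi> (h \<otimes> \<tau> h)) = - of_nat (order G)"
      using Irr_frobenius_schur[OF \<phi>] by blast
    \<comment> \<open>The inner product evaluates \<phi> at the inverse of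
      \<open>h \<otimes> \<tau> h\<close>. Substituting \<open>inv h\<close> and then
      \<open>\<tau> h\<close> for \<open>h\<close> restores the original form.\<close>
    moreover have "(\<Sum>h\<in>carrier G. \<phi> (h \<otimes> \<tau> h)) = of_nat (m \<phi>) * of_nat (order G)"
    proof -
      have "of_nat (m \<phi>) * of_nat (order G) = (\<Sum>g\<in>carrier G. of_nat (card (twisted_roots g)) * \<phi> (inv g))"
        using m(2) \<phi> tr by simp
      also have "\<dots> = (\<Sum>h\<in>carrier G. \<phi> (inv (h \<otimes> \<tau> h)))" by (rule sum_twisted_roots)
      also have "\<dots> = (\<Sum>h\<in>carrier G. \<phi> (\<tau> (inv h) \<otimes> inv h))"
        by (intro sum.cong) (auto simp: inv_mult_group \<tau>_inv)
      also have "\<dots> = (\<Sum>h\<in>carrier G. \<phi> (\<tau> h \<otimes> h))"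
        by (rule sum.reindex_bij_betw[OF bij_betw_inv])
      also have "\<dots> = (\<Sum>h\<in>carrier G. \<phi> (\<tau> (\<tau> h) \<otimes> \<tau> h))"
        by (rule sum.reindex_bij_betw[OF bij_betw_\<tau>, symmetric])
      finally show ?thesis by simp
    qed
    ultimately have "of_nat (m \<phi>) * of_nat (order G) = (of_nat (order G) :: complex) \<or>
       of_nat (m \<phi>) * of_nat (order G) = (- of_nat (order G) :: complex)" by simp
    then have "Re (of_nat (m \<phi>) * of_nat (order G)) = order G \<or> Re (of_nat (m \<phi>) * of_nat (order G)) = - real (order G)"
      by (elim disjE) simp_all
    then have "real (m \<phi>) * order G = order G \<or> real (m \<phi>) * order G = - real (order G)" by simp
    moreover have "real (m \<phi>) * order G \<ge> 0" by simp
    ultimately have "real (m \<phi>) * order G = order G" using order_pos by linarith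
    then show ?thesis using order_pos by simp
  qed
  then show ?thesis using m(1) g by simp
qed

text \<open>Counting the roots of the identity with the regular character gives the degrees weighted
  by the indicators. No indicator exceeds 1, so equality with the plain sum of degrees makes all of
  them 1, and then no irreducible character separates \<open>\<tau> g\<close> from
  \<open>inv g\<close>.\<close>

theorem conj_if_sum_Irr_one:
  assumes eq: "of_nat (card (twisted_roots \<one>)) = (\<Sum>\<psi>\<in>Irr G. \<psi> \<one>)"
    and g: "g \<in> carrier G"
  shows "\<exists>k\<in>carrier G. \<tau> g = k \<otimes> inv g \<otimes> inv k"
proof -
  define S where "S \<psi> = (\<Sum>h\<in>carrier G. \<psi> (h \<otimes> \<tau> h))" for \<psi> :: "'a \<Rightarrow> complex"
  have "of_nat (card (twisted_roots \<one>)) * of_nat (order G) =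
      (\<Sum>g\<in>carrier G. of_nat (card (twisted_roots g)) * reg_char g)"
    by (subst sum.remove[OF finite_carrier one_closed], subst sum.neutral) (auto simp: reg_char_def)
  also have "\<dots> = (\<Sum>h\<in>carrier G. reg_char (h \<otimes> \<tau> h))" by (rule sum_twisted_roots)
  also have "\<dots> = (\<Sum>h\<in>carrier G. \<Sum>\<psi>\<in>Irr G. \<psi> \<one> * \<psi> (h \<otimes> \<tau> h))"
    by (intro sum.cong refl reg_char_eq) auto
  also have "\<dots> = (\<Sum>\<psi>\<in>Irr G. \<psi> \<one> * S \<psi>)"
    by (subst sum.swap) (simp add: S_def sum_distrib_left)
  finally have 0: "(\<Sum>\<psi>\<in>Irr G. \<psi> \<one> * of_nat (order G)) = (\<Sum>\<psi>\<in>Irr G. \<psi> \<one> * S \<psi>)"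
    unfolding eq by (simp add: sum_distrib_right)
  define dg where "dg \<psi> = Re (\<psi> \<one>)" for \<psi> :: "'a \<Rightarrow> complex"
  have dg: "\<psi> \<one> = of_real (dg \<psi>)" "dg \<psi> > 0" if ps: "\<psi> \<in> Irr G" for \<psi>
  proof -
    obtain k where "k > 0" "\<psi> \<one> = of_nat k" using ps by (rule Irr_one)
    then show "\<psi> \<one> = of_real (dg \<psi>)" "dg \<psi> > 0" by (simp_all add: dg_def)
  qed
  have "(\<Sum>\<psi>\<in>Irr G. \<psi> \<one> * (of_nat (order G) - S \<psi>)) = 0"
    using 0 by (simp add: right_diff_distrib sum_subtractf)
  then have "Re (\<Sum>\<psi>\<in>Irr G. \<psi> \<one> * (of_nat (order G) - S \<psi>)) = 0" by simp
  then have "(\<Sum>\<psi>\<in>Irr G. dg \<psi> * (order G - Re (S \<psi>))) = 0"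
    unfolding Re_sum by (simp add: dg(1) cong: sum.cong)
  moreover have "0 \<le> dg \<psi> * (order G - Re (S \<psi>))" if "\<psi> \<in> Irr G" for \<psi>
  proof -
    have "Re (S \<psi>) \<le> order G" using Irr_frobenius_schur[OF that, folded S_def] by (auto simp del: Re_sum)
    then show ?thesis using dg(2)[OF that] by simp
  qed
  ultimately have "\<forall>\<psi>\<in>Irr G. dg \<psi> * (order G - Re (S \<psi>)) = 0"
    using sum_nonneg_eq_0_iff[OF finite_Irr, of "\<lambda>\<psi>. dg \<psi> * (order G - Re (S \<psi>))"] by simp
  then have "Re (S \<psi>) = order G" if "\<psi> \<in> Irr G" for \<psi> using dg(2)[OF that] that by fastforce
  then have "S \<psi> \<noteq> 0" if "\<psi> \<in> Irr G" for \<psi> using that order_pos by fastforce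
  then have "\<psi> (inv g) = \<psi> (\<tau> g)" if "\<psi> \<in> Irr G" for \<psi>
    using Irr_frobenius_schur[OF that] that g unfolding S_def by fastforce
  then show ?thesis using Irr_separates[of "inv g" "\<tau> g"] g by auto
qed

end

section \<open>Colourings of the cycles of a permutation\<close>

text \<open>A solution is determined by its value at \<open>c\<close>, and every value is possible
  once a full turn adds a multiple of \<open>r\<close>. \<rho> is kept general because it will also
  be a square root of the cycle under study.\<close>

lemma card_cyclic_cocycle:
  fixes u :: "'b \<Rightarrow> int"
  assumes r: "r > 0" and m: "m > 0" and per: "(\<rho> ^^ m) c = c" and bij: "bij_betw (\<lambda>k. (\<rho> ^^ k) c) {..<m} C"
  shows "card {w \<in> C \<rightarrow>\<^sub>E {0..<int r}. \<forall>i\<in>C. w (\<rho> i) = (w i + u i) mod int r} = (if int r dvd (\<Sum>i\<in>C. u i) then r else 0)"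
    (is "card ?W = _")
proof -
  define e where "e = (\<lambda>k. (\<rho> ^^ k) c)"
  define s where "s k = (\<Sum>l<k. u (e l))" for k
  have bij: "bij_betw e {..<m} C" using bij by (simp add: e_def)
  have e_mod: "e (k mod m) = e k" for k unfolding e_def by (rule funpow_mod_eq[OF per])
  have eC: "e k \<in> C" for k using bij m e_mod[of k] by (metis bij_betwE lessThan_iff mod_less_divisor)
  have e0: "e 0 = c" and eS: "e (Suc k) = \<rho> (e k)" and em: "e m = c" for k using per by (auto simp: e_def)
  have sm: "s m = (\<Sum>i\<in>C. u i)" unfolding s_def by (rule sum.reindex_bij_betw[OF bij])
  have fwd: "w (e k) = (w c + s k) mod int r" if w: "w \<in> ?W" for w k
  proof (induction k)
    case 0
    have "w c \<in> {0..<int r}" using w eC[of 0] by (auto simp: e0)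
    then show ?case by (simp add: e0 s_def)
  next
    case (Suc k)
    have "w (e (Suc k)) = (w (e k) + u (e k)) mod int r" using w eC[of k] by (auto simp: eS)
    then show ?case using Suc by (simp add: s_def mod_simps add.assoc)
  qed
  show ?thesis
  proof (cases "int r dvd (\<Sum>i\<in>C. u i)")
    case True
    define idx where "idx = inv_into {..<m} e"
    have idx: "idx (e k) = k" if "k < m" for k
      unfolding idx_def using bij that by (auto simp: bij_betw_def inv_into_f_f)
    define B where "B a = (\<lambda>i\<in>C. (a + s (idx i)) mod int r)" for a
    have Be: "B a (e k) = (a + s k) mod int r" if "k < m" for a k using eC that by (simp add: B_def idx)
    have "bij_betw (\<lambda>w. w c) ?W {0..<int r}"
    proof (rule bij_betw_byWitness[where f' = B])
      show "\<forall>w\<in>?W. B (w c) = w"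
      proof
        fix w assume w: "w \<in> ?W"
        have "B (w c) i = w i" for i
        proof (cases "i \<in> C")
          case True
          then obtain k where "k < m" "i = e k" using bij by (auto simp: bij_betw_def)
          then show ?thesis using Be fwd[OF w] by simp
        next
          case False
          then show ?thesis using w by (auto simp: B_def PiE_def extensional_def)
        qed
        then show "B (w c) = w" ..
      qed
      show "\<forall>a\<in>{0..<int r}. B a c = a"
        using Be[of 0] m by (auto simp: e0 s_def)
      show "(\<lambda>w. w c) ` ?W \<subseteq> {0..<int r}" using eC[of 0] by (auto simp: e0)
      show "B ` {0..<int r} \<subseteq> ?W"
      proof (intro image_subsetI CollectI conjI ballI)
        fix a assume a: "a \<in> {0..<int r}"
        show "B a \<in> C \<rightarrow>\<^sub>E {0..<int r}" using r by (auto simp: B_def)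
        fix i assume "i \<in> C"
        then obtain k where k: "k < m" "i = e k" using bij by (auto simp: bij_betw_def)
        have r1: "(B a i + u i) mod int r = (a + s (Suc k)) mod int r"
          using k Be by (simp add: s_def mod_simps add.assoc)
        have "B a (\<rho> i) = (a + s (Suc k)) mod int r"
        proof (cases "Suc k < m")
          case True
          then show ?thesis using Be[of "Suc k"] k by (simp add: eS)
        next
          case False
          \<comment> \<open>The cycle closes here, and closing up is where the divisibility of the
            full sum enters.\<close>
          then have "Suc k = m" using k by simp
          then have "\<rho> i = e 0" "s (Suc k) mod int r = 0" using k em e0 eS[of k] sm True by auto
          then have "B a (\<rho> i) = a mod int r" using Be[OF m] by (simp add: s_def)
          also have "\<dots> = (a + s (Suc k) mod int r) mod int r"
            using \<open>s (Suc k) mod int r = 0\<close> by simp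
          finally show ?thesis by (simp only: mod_add_right_eq)
        qed
        then show "B a (\<rho> i) = (B a i + u i) mod int r" using r1 by simp
      qed
    qed
    then show ?thesis using True by (simp add: bij_betw_same_card)
  next
    case False
    have "w \<notin> ?W" for w
    proof
      assume w: "w \<in> ?W"
      have "w c = (w c + s m) mod int r" using fwd[OF w, of m] by (simp add: em)
      moreover have "w c = w c mod int r" using fwd[OF w, of 0] by (simp add: e0 s_def)
      ultimately have "[w c + 0 = w c + s m] (mod int r)" by (simp add: cong_def)
      then have "int r dvd s m" by (simp add: cong_iff_dvd_diff)
      then show False using False sm by simp
    qed
    then show ?thesis using False by (simp add: card_eq_0_iff)
  qed
qed

text \<open>\<open>(x, \<pi>)\<close> is the group element at which characters are evaluated.
  \<open>U\<close> makes all cycles finite; the counts below run over arbitrary finite invariant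
  sets so that cycles can be removed.\<close>

locale colored_perm =
  fixes U :: "nat set" and \<pi> :: "nat \<Rightarrow> nat" and r :: nat and x :: "nat \<Rightarrow> int"
  assumes finU: "finite U" and perm: "\<pi> permutes U" and r: "r > 0"
begin

definition cyc :: "nat \<Rightarrow> nat set" where "cyc c = range (\<lambda>k. (\<pi> ^^ k) c)"

lemma inj_\<pi>: "inj \<pi>" using perm by (rule permutes_inj)

lemma \<pi>_eq [simp]: "\<pi> i = \<pi> j \<longleftrightarrow> i = j" using inj_\<pi> by (auto dest: injD)

lemma inj_pow: "(\<pi> ^^ k) i = (\<pi> ^^ k) j \<longleftrightarrow> i = j"
  by (induction k arbitrary: i j) auto

lemma period:
  obtains m where "m > 0" "(\<pi> ^^ m) c = c" "bij_betw (\<lambda>k. (\<pi> ^^ k) c) {..<m} (cyc c)"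
    "\<And>a b. (\<pi> ^^ a) c = (\<pi> ^^ b) c \<longleftrightarrow> a mod m = b mod m"
proof -
  have "permutation \<pi>" using finU perm unfolding permutation_permutes by blast
  then obtain M where M: "\<pi> ^^ M = id" "M > 0" using permutation_is_nilpotent by blast
  define m where "m = (LEAST k. k > 0 \<and> (\<pi> ^^ k) c = c)"
  have m: "m > 0" "(\<pi> ^^ m) c = c" using LeastI[of "\<lambda>k. k > 0 \<and> (\<pi> ^^ k) c = c" M] M unfolding m_def by auto
  have least: "\<not> (k > 0 \<and> (\<pi> ^^ k) c = c)" if "k < m" for k using not_less_Least that unfolding m_def by blast
  have md: "(\<pi> ^^ (k mod m)) c = (\<pi> ^^ k) c" for k by (rule funpow_mod_eq[OF m(2)])
  have inj: "a = b" if "a < m" "b < m" "(\<pi> ^^ a) c = (\<pi> ^^ b) c" "a \<le> b" for a b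
  proof (rule ccontr)
    assume "a \<noteq> b"
    have "(\<pi> ^^ a) ((\<pi> ^^ (b - a)) c) = (\<pi> ^^ a) c"
      using that by (simp flip: funpow_add[THEN fun_cong, unfolded comp_def])
    then have "(\<pi> ^^ (b - a)) c = c" using inj_pow by blast
    then show False using least[of "b - a"] that \<open>a \<noteq> b\<close> less_imp_diff_less[of b m a] by simp
  qed
  have inj': "a = b" if "a < m" "b < m" "(\<pi> ^^ a) c = (\<pi> ^^ b) c" for a b
    using inj[of a b] inj[of b a] that by (cases "a \<le> b") auto
  have "bij_betw (\<lambda>k. (\<pi> ^^ k) c) {..<m} (cyc c)"
    unfolding bij_betw_def
  proof
    show "inj_on (\<lambda>k. (\<pi> ^^ k) c) {..<m}" using inj' by (auto simp: inj_on_def)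
    show "(\<lambda>k. (\<pi> ^^ k) c) ` {..<m} = cyc c"
    proof (intro Set.equalityI image_subsetI subsetI)
      fix i assume "i \<in> cyc c"
      then obtain k where "i = (\<pi> ^^ k) c" by (auto simp: cyc_def)
      then have "i = (\<pi> ^^ (k mod m)) c" by (simp add: md)
      then show "i \<in> (\<lambda>k. (\<pi> ^^ k) c) ` {..<m}" using m by auto
    qed (simp add: cyc_def)
  qed
  moreover have "(\<pi> ^^ a) c = (\<pi> ^^ b) c \<longleftrightarrow> a mod m = b mod m" for a b
    using inj'[of "a mod m" "b mod m"] m(1) md by (metis mod_less_divisor)
  ultimately show thesis using that m by blast
qed

lemma cyc_self: "c \<in> cyc c" unfolding cyc_def by (rule range_eqI[of _ _ 0]) simp

lemma cyc_closed: "i \<in> cyc c \<Longrightarrow> \<pi> i \<in> cyc c"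
  unfolding cyc_def by (auto intro: range_eqI[of _ _ "Suc _"])

lemma cyc_pow: "(\<pi> ^^ k) c \<in> cyc c" by (simp add: cyc_def)

lemma finite_cyc: "finite (cyc c)"
  using period[of c] by (metis bij_betw_finite finite_lessThan)

lemma image_eq_if_closed: "finite T \<Longrightarrow> (\<And>i. i \<in> T \<Longrightarrow> \<pi> i \<in> T) \<Longrightarrow> \<pi> ` T = T"
  using inj_\<pi> by (intro card_subset_eq) (auto simp: card_image inj_on_subset)

lemma image_cyc: "\<pi> ` cyc c = cyc c"
  by (rule image_eq_if_closed[OF finite_cyc cyc_closed])

definition inv_set :: "nat set \<Rightarrow> bool" where "inv_set S \<longleftrightarrow> finite S \<and> \<pi> ` S = S"

lemma inv_setD: "inv_set S \<Longrightarrow> \<pi> i \<in> S \<longleftrightarrow> i \<in> S"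
  unfolding inv_set_def using inj_\<pi> by (metis inj_image_mem_iff)

lemma inv_set_finite: "inv_set S \<Longrightarrow> finite S" by (simp add: inv_set_def)

lemma inv_set_cyc: "inv_set (cyc c)" by (simp add: inv_set_def finite_cyc image_cyc)

lemma inv_set_Un: "inv_set S \<Longrightarrow> inv_set T \<Longrightarrow> inv_set (S \<union> T)" by (auto simp: inv_set_def)

lemma inv_set_Diff: "inv_set S \<Longrightarrow> inv_set T \<Longrightarrow> inv_set (S - T)"
  by (auto simp: inv_set_def image_set_diff[OF inj_\<pi>])

lemma inv_set_pow: "inv_set S \<Longrightarrow> i \<in> S \<Longrightarrow> (\<pi> ^^ k) i \<in> S"
  by (induction k) (auto simp: inv_setD)

lemma cyc_subset: "inv_set S \<Longrightarrow> c \<in> S \<Longrightarrow> cyc c \<subseteq> S"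
  by (auto simp: cyc_def inv_set_pow)

lemma cyc_disjoint: "d \<notin> cyc c \<Longrightarrow> cyc c \<inter> cyc d = {}"
proof (rule ccontr)
  assume d: "d \<notin> cyc c" and "cyc c \<inter> cyc d \<noteq> {}"
  then obtain z where "z \<in> cyc c" "z \<in> cyc d" by blast
  moreover from this(2) obtain k where "z = (\<pi> ^^ k) d" by (auto simp: cyc_def)
  ultimately have "(\<pi> ^^ k) d \<in> cyc c" by simp
  then have "d \<in> cyc c" by (induction k) (auto simp: inv_setD[OF inv_set_cyc])
  then show False using d by blast
qed

section \<open>Configurations on invariant sets\<close>

abbreviation Col :: "int set" where "Col \<equiv> {0..<int r}"

text \<open>A wreath product element on the points of \<open>S\<close>, stored as one function to
  pairs of image and colour, so that passing to an invariant subset is plain restriction.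
  Injectivity of the images follows from each of the predicates in use.\<close>

definition config :: "((nat \<Rightarrow> nat \<times> int) \<Rightarrow> nat \<Rightarrow> bool) \<Rightarrow> nat set \<Rightarrow> (nat \<Rightarrow> nat \<times> int) set" where
  "config P S = {f \<in> S \<rightarrow>\<^sub>E S \<times> Col. \<forall>i\<in>S. P f i}"

text \<open>The condition at \<open>i\<close> looks only at \<open>i\<close>, its image and
  \<open>\<pi> i\<close>. On a set closed under both maps it cannot feel what happens elsewhere,
  which makes the counts multiplicative.\<close>

definition local_pred :: "((nat \<Rightarrow> nat \<times> int) \<Rightarrow> nat \<Rightarrow> bool) \<Rightarrow> bool" where
  "local_pred P \<longleftrightarrow> (\<forall>f g i. f i = g i \<and> f (fst (f i)) = g (fst (f i)) \<and> f (\<pi> i) = g (\<pi> i) \<longrightarrow> P f i = P g i)"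

lemma finite_config: "finite S \<Longrightarrow> finite (config P S)"
  unfolding config_def by (rule finite_subset[of _ "S \<rightarrow>\<^sub>E S \<times> Col"]) (auto intro!: finite_PiE)

lemma config_cong:
  assumes P: "local_pred P" and S: "inv_set S" and f: "f \<in> S \<rightarrow>\<^sub>E S \<times> Col" and eq: "\<And>i. i \<in> S \<Longrightarrow> f i = g i"
    and i: "i \<in> S"
  shows "P f i \<longleftrightarrow> P g i"
proof -
  have "fst (f i) \<in> S" using f i by (metis PiE_mem mem_Times_iff)
  then show ?thesis using P eq i S unfolding local_pred_def by (metis inv_setD)
qed

definition preserves :: "nat set \<Rightarrow> nat set \<Rightarrow> (nat \<Rightarrow> nat \<times> int) \<Rightarrow> bool" where
  "preserves S T f \<longleftrightarrow> (\<forall>i\<in>T. fst (f i) \<in> T) \<and> (\<forall>i\<in>S - T. fst (f i) \<in> S - T)"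

lemma bij_betw_config_split:
  assumes P: "local_pred P" and S: "inv_set S" and T: "inv_set T" "T \<subseteq> S"
  shows "bij_betw (\<lambda>f. (restrict f T, restrict f (S - T))) {f \<in> config P S. preserves S T f} (config P T \<times> config P (S - T))"
proof (rule bij_betw_byWitness[where f' = "\<lambda>(f, g). (\<lambda>i\<in>S. if i \<in> T then f i else g i)"])
  let ?F = "{f \<in> config P S. preserves S T f}"
  have ST: "inv_set (S - T)" using S T by (simp add: inv_set_Diff)
  show "\<forall>f\<in>?F. (\<lambda>(f, g). (\<lambda>i\<in>S. if i \<in> T then f i else g i)) (restrict f T, restrict f (S - T)) = f"
    using T by (auto simp: config_def PiE_def extensional_def fun_eq_iff)
  show "\<forall>p\<in>config P T \<times> config P (S - T).
     (restrict ((\<lambda>(f, g). (\<lambda>i\<in>S. if i \<in> T then f i else g i)) p) T, restrict ((\<lambda>(f, g). (\<lambda>i\<in>S. if i \<in> T then f i else g i)) p) (S - T)) = p"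
    using T(2) by (auto simp: config_def PiE_def extensional_def fun_eq_iff)
  show "(\<lambda>f. (restrict f T, restrict f (S - T))) ` ?F \<subseteq> config P T \<times> config P (S - T)"
  proof (rule image_subsetI)
    fix f assume "f \<in> ?F"
    then have f: "f \<in> S \<rightarrow>\<^sub>E S \<times> Col" "\<And>i. i \<in> S \<Longrightarrow> P f i" "preserves S T f" by (auto simp: config_def)
    have fS: "snd (f i) \<in> Col" if "i \<in> S" for i using f(1) that by (metis PiE_mem mem_Times_iff)
    have 1: "restrict f T \<in> T \<rightarrow>\<^sub>E T \<times> Col" "restrict f (S - T) \<in> (S - T) \<rightarrow>\<^sub>E (S - T) \<times> Col"
      using f(3) fS T(2) unfolding preserves_def by (auto simp: mem_Times_iff)
    show "(restrict f T, restrict f (S - T)) \<in> config P T \<times> config P (S - T)"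
      unfolding config_def using 1 config_cong[OF P T(1) 1(1), of f] config_cong[OF P ST 1(2), of f] f(2) T(2) by auto
  qed
  show "(\<lambda>(f, g). (\<lambda>i\<in>S. if i \<in> T then f i else g i)) ` (config P T \<times> config P (S - T)) \<subseteq> ?F"
  proof (rule image_subsetI)
    fix p assume "p \<in> config P T \<times> config P (S - T)"
    then obtain f g where p: "p = (f, g)" and f: "f \<in> config P T" and g: "g \<in> config P (S - T)" by blast
    let ?h = "\<lambda>i\<in>S. if i \<in> T then f i else g i"
    have f': "f \<in> T \<rightarrow>\<^sub>E T \<times> Col" "\<And>i. i \<in> T \<Longrightarrow> P f i" using f by (auto simp: config_def)
    have g': "g \<in> (S - T) \<rightarrow>\<^sub>E (S - T) \<times> Col" "\<And>i. i \<in> S - T \<Longrightarrow> P g i" using g by (auto simp: config_def)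
    have pf: "?h i = f i" "f i \<in> T \<times> Col" if "i \<in> T" for i using that T(2) f' by auto
    have pg: "?h i = g i" "g i \<in> (S - T) \<times> Col" if "i \<in> S - T" for i using that g' by auto
    have "?h \<in> S \<rightarrow>\<^sub>E S \<times> Col"
    proof (rule PiE_I)
      fix i assume "i \<in> S"
      show "?h i \<in> S \<times> Col"
      proof (cases "i \<in> T")
        case True
        then show ?thesis using pf[OF True] T(2) by (auto simp: mem_Times_iff)
      next
        case False
        then have "i \<in> S - T" using \<open>i \<in> S\<close> by blast
        then show ?thesis using pg[of i] by (auto simp: mem_Times_iff)
      qed
    qed simp
    moreover have "P ?h i" if "i \<in> S" for i
    proof (cases "i \<in> T")
      case True
      then show ?thesis using config_cong[OF P T(1) f'(1) pf(1)[symmetric]] f'(2) by blast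
    next
      case False
      then show ?thesis using config_cong[OF P ST g'(1) pg(1)[symmetric]] g'(2) that by blast
    qed
    moreover have "preserves S T ?h"
      unfolding preserves_def using pf pg by (simp add: mem_Times_iff)
    ultimately have "?h \<in> {f \<in> config P S. preserves S T f}"
      by (simp add: config_def)
    then show "(\<lambda>(f, g). (\<lambda>i\<in>S. if i \<in> T then f i else g i)) p \<in> {f \<in> config P S. preserves S T f}"
      unfolding p by simp
  qed
qed

text \<open>Pointwise form of two equations: the first and the last conjunct say that the element
  equals its transpose, the middle two that twisting by \<open>(x, \<pi>)\<close> fixes it.\<close>

definition sym_pred :: "(nat \<Rightarrow> nat \<times> int) \<Rightarrow> nat \<Rightarrow> bool" where
  "sym_pred f i \<longleftrightarrow> fst (f (fst (f i))) = i \<and> fst (f (\<pi> i)) = \<pi> (fst (f i)) \<and>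
     snd (f (\<pi> i)) = (snd (f i) + x i + x (fst (f i))) mod int r \<and> snd (f (fst (f i))) = snd (f i)"

text \<open>Pointwise form of the equation that an element times its bar is
  \<open>(x, \<pi>)\<close>.\<close>

definition root_pred :: "(nat \<Rightarrow> nat \<times> int) \<Rightarrow> nat \<Rightarrow> bool" where
  "root_pred f i \<longleftrightarrow> fst (f (fst (f i))) = \<pi> i \<and> snd (f (fst (f i))) = (snd (f i) + x i) mod int r"

text \<open>The share of the point \<open>i\<close> in \<open>sign_rn\<close>. An inverted pair is
  charged to its smaller point; the second factor is membership in \<open>B_set\<close>, where the
  \<open>k\<close> of that definition is \<open>snd p div 2\<close>.\<close>

definition sg :: "nat \<Rightarrow> nat \<times> int \<Rightarrow> int" where
  "sg i p = (if i < fst p \<and> \<pi> i > \<pi> (fst p) then -1 else 1) *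
     (if even r \<and> fst p = i \<and> odd (snd p) \<and> int r div 2 \<le> (x i + snd p div 2) mod int r then -1 else 1)"

lemma local_sym_pred: "local_pred sym_pred"
  unfolding local_pred_def sym_pred_def by metis

lemma local_root_pred: "local_pred root_pred"
  unfolding local_pred_def root_pred_def by metis

definition Z :: "((nat \<Rightarrow> nat \<times> int) \<Rightarrow> nat \<Rightarrow> bool) \<Rightarrow> (nat \<Rightarrow> nat \<times> int \<Rightarrow> int) \<Rightarrow> nat set \<Rightarrow> int" where
  "Z P W S = (\<Sum>f\<in>config P S. \<Prod>i\<in>S. W i (f i))"

definition Zat :: "((nat \<Rightarrow> nat \<times> int) \<Rightarrow> nat \<Rightarrow> bool) \<Rightarrow> (nat \<Rightarrow> nat \<times> int \<Rightarrow> int) \<Rightarrow> nat set \<Rightarrow> nat \<Rightarrow> nat \<Rightarrow> int" where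
  "Zat P W S c d = (\<Sum>f\<in>{f \<in> config P S. fst (f c) = d}. \<Prod>i\<in>S. W i (f i))"

lemma config_mem: "f \<in> config P S \<Longrightarrow> i \<in> S \<Longrightarrow> fst (f i) \<in> S"
  "f \<in> config P S \<Longrightarrow> i \<in> S \<Longrightarrow> snd (f i) \<in> Col"
  "f \<in> config P S \<Longrightarrow> i \<in> S \<Longrightarrow> P f i"
  unfolding config_def by (auto dest!: PiE_mem simp: mem_Times_iff)

lemma Z_eq_sum_Zat:
  assumes "inv_set S" "c \<in> S"
  shows "Z P W S = (\<Sum>d\<in>S. Zat P W S c d)"
  unfolding Z_def Zat_def
  by (rule sum.group[symmetric]) (use assms config_mem in \<open>auto simp: finite_config inv_set_finite\<close>)

lemma Zat_split:
  assumes P: "local_pred P" and S: "inv_set S" and T: "inv_set T" "T \<subseteq> S" and c: "c \<in> T"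
    and pres: "\<And>f. f \<in> config P S \<Longrightarrow> fst (f c) = d \<Longrightarrow> preserves S T f"
  shows "Zat P W S c d = Zat P W T c d * Z P W (S - T)"
proof -
  let ?F = "{f \<in> config P S. preserves S T f}"
  let ?r = "\<lambda>f. (restrict f T, restrict f (S - T))"
  define K where "K = (\<lambda>(g, h). (if fst (g c) = d then \<Prod>i\<in>T. W i (g i) else 0) * (\<Prod>i\<in>S - T. W i (h i)))"
  have fin: "finite S" "finite T" using S T by (auto simp: inv_set_def)
  have pr: "(\<Prod>i\<in>S. W i (f i)) = (\<Prod>i\<in>T. W i (f i)) * (\<Prod>i\<in>S - T. W i (f i))" for f
    using prod.subset_diff[OF T(2) fin(1), of "\<lambda>i. W i (f i)"] by (simp add: mult.commute)
  have "Zat P W S c d = (\<Sum>f\<in>{f \<in> ?F. fst (f c) = d}. \<Prod>i\<in>S. W i (f i))"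
    unfolding Zat_def using pres by (intro sum.cong) auto
  also have "\<dots> = (\<Sum>f\<in>?F. if fst (f c) = d then \<Prod>i\<in>S. W i (f i) else 0)"
    by (rule sum.inter_filter) (simp add: finite_config fin)
  also have "\<dots> = (\<Sum>f\<in>?F. K (?r f))"
    using c by (intro sum.cong) (auto simp: K_def pr)
  also have "\<dots> = (\<Sum>p\<in>config P T \<times> config P (S - T). K p)"
    by (rule sum.reindex_bij_betw[OF bij_betw_config_split[OF P S T]])
  also have "\<dots> = (\<Sum>g\<in>config P T. if fst (g c) = d then \<Prod>i\<in>T. W i (g i) else 0) * (\<Sum>h\<in>config P (S - T). \<Prod>i\<in>S - T. W i (h i))"
    unfolding K_def by (simp add: sum.cartesian_product[symmetric] sum_product)
  also have "\<dots> = Zat P W T c d * Z P W (S - T)"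
    unfolding Zat_def Z_def by (simp add: sum.inter_filter finite_config fin)
  finally show ?thesis .
qed

lemma sym_commute:
  assumes "f \<in> config sym_pred S" "inv_set S" "i \<in> S"
  shows "fst (f ((\<pi> ^^ k) i)) = (\<pi> ^^ k) (fst (f i))"
proof (induction k)
  case (Suc k)
  then show ?case using config_mem(3)[OF assms(1) inv_set_pow[OF assms(2,3)], of k] by (simp add: sym_pred_def)
qed simp

lemma root_commute:
  assumes "f \<in> config root_pred S" "inv_set S" "i \<in> S"
  shows "fst (f ((\<pi> ^^ k) i)) = (\<pi> ^^ k) (fst (f i))"
proof (induction k)
  case (Suc k)
  let ?i = "(\<pi> ^^ k) i"
  have "?i \<in> S" by (rule inv_set_pow[OF assms(2,3)])
  moreover from this have "fst (f ?i) \<in> S" by (rule config_mem(1)[OF assms(1)])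
  ultimately have "fst (f (\<pi> ?i)) = \<pi> (fst (f ?i))"
    using config_mem(3)[OF assms(1)] unfolding root_pred_def by metis
  then show ?case using Suc by simp
qed simp

lemma sym_preserves:
  assumes f: "f \<in> config sym_pred S" and S: "inv_set S" and c: "c \<in> S" and d: "fst (f c) = d"
  shows "preserves S (cyc c \<union> cyc d) f"
proof -
  have dS: "d \<in> S" using config_mem(1)[OF f c] d by simp
  have dc: "fst (f d) = c" using config_mem(3)[OF f c] d by (simp add: sym_pred_def)
  have T: "fst (f i) \<in> cyc c \<union> cyc d" if "i \<in> cyc c \<union> cyc d" for i
    using that sym_commute[OF f S c] sym_commute[OF f S dS] d dc by (auto simp: cyc_def)
  moreover have "fst (f i) \<in> S - (cyc c \<union> cyc d)" if "i \<in> S - (cyc c \<union> cyc d)" for i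
    using T[of "fst (f i)"] config_mem(1)[OF f, of i] config_mem(3)[OF f, of i] that by (auto simp: sym_pred_def)
  ultimately show ?thesis by (simp add: preserves_def)
qed

lemma root_preserves:
  assumes f: "f \<in> config root_pred S" and S: "inv_set S" and c: "c \<in> S" and d: "fst (f c) = d"
  shows "preserves S (cyc c \<union> cyc d) f"
proof -
  have dS: "d \<in> S" using config_mem(1)[OF f c] d by simp
  have dc: "fst (f d) = \<pi> c" using config_mem(3)[OF f c] d by (simp add: root_pred_def)
  have T: "fst (f i) \<in> cyc c \<union> cyc d" if "i \<in> cyc c \<union> cyc d" for i
  proof -
    from that consider k where "i = (\<pi> ^^ k) c" | k where "i = (\<pi> ^^ k) d" by (auto simp: cyc_def)
    then show ?thesis
    proof cases
      case 1
      then show ?thesis using root_commute[OF f S c, of k] d by (simp add: cyc_pow)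
    next
      case 2
      then have "fst (f i) = (\<pi> ^^ Suc k) c" using root_commute[OF f S dS, of k] dc by (simp add: funpow_swap1)
      then show ?thesis using cyc_pow[of "Suc k" c] by simp
    qed
  qed
  have inv: "inv_set (cyc c \<union> cyc d)" by (simp add: inv_set_Un inv_set_cyc)
  have "fst (f i) \<in> S - (cyc c \<union> cyc d)" if "i \<in> S - (cyc c \<union> cyc d)" for i
    using T[of "fst (f i)"] config_mem(1)[OF f, of i] config_mem(3)[OF f, of i] that inv_setD[OF inv, of i]
    by (auto simp: root_pred_def)
  then show ?thesis using T by (simp add: preserves_def)
qed

text \<open>Configurations are sorted by the image \<open>d\<close> of \<open>c\<close>. If
  \<open>d\<close> lies on the cycle of \<open>c\<close>, this cycle splits off alone; otherwise the
  cycles of \<open>c\<close> and \<open>d\<close> split off together.\<close>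

lemma Z_recursion:
  assumes P: "local_pred P" and S: "inv_set S" and c: "c \<in> S"
    and pres: "\<And>S f d. inv_set S \<Longrightarrow> c \<in> S \<Longrightarrow> f \<in> config P S \<Longrightarrow> fst (f c) = d \<Longrightarrow> preserves S (cyc c \<union> cyc d) f"
  shows "Z P W S = Z P W (cyc c) * Z P W (S - cyc c) +
     (\<Sum>d\<in>S - cyc c. Zat P W (cyc c \<union> cyc d) c d * Z P W (S - (cyc c \<union> cyc d)))"
proof -
  have CS: "cyc c \<subseteq> S" by (rule cyc_subset[OF S c])
  have split: "Zat P W S c d = Zat P W (cyc c \<union> cyc d) c d * Z P W (S - (cyc c \<union> cyc d))" if "d \<in> S" for d
    by (rule Zat_split[OF P S]) (use that CS cyc_self cyc_subset[OF S that] pres[OF S c] in \<open>auto simp: inv_set_Un inv_set_cyc\<close>)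
  have same: "cyc c \<union> cyc d = cyc c" if "d \<in> cyc c" for d
    using cyc_subset[OF inv_set_cyc that] by blast
  have "Z P W S = (\<Sum>d\<in>cyc c. Zat P W S c d) + (\<Sum>d\<in>S - cyc c. Zat P W S c d)"
    unfolding Z_eq_sum_Zat[OF S c] using sum.subset_diff[OF CS inv_set_finite[OF S], of "Zat P W S c"] by simp
  also have "(\<Sum>d\<in>cyc c. Zat P W S c d) = (\<Sum>d\<in>cyc c. Zat P W (cyc c) c d * Z P W (S - cyc c))"
    using split CS by (intro sum.cong) (auto simp: same subset_iff)
  also have "\<dots> = Z P W (cyc c) * Z P W (S - cyc c)"
    unfolding Z_eq_sum_Zat[OF inv_set_cyc cyc_self] by (simp add: sum_distrib_right)
  finally show ?thesis using split by simp
qed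

text \<open>Moved points have no carry factor, and the inversion factor is -1 exactly if \<pi>
  reverses the order of the pair. Written as orientation before times orientation after \<pi>, it
  telescopes along a cycle.\<close>

lemma sg_pair:
  assumes "fst (f i) = j" "fst (f j) = i" "i \<noteq> j" "fst (f (\<pi> i)) = \<pi> j"
  shows "sg i (f i) * sg j (f j) =
    (if i < fst (f i) then 1 else -1) * (if \<pi> i < fst (f (\<pi> i)) then 1 else -1)"
proof -
  have "\<pi> i \<noteq> \<pi> j" using assms by simp
  then show ?thesis using assms by (auto simp: sg_def)
qed

text \<open>The orientations cancel around the cycle of \<open>c\<close>, since \<pi> permutes it.
  So each weight is 1 and both sides are plain cardinalities, to be matched by a bijection.\<close>

lemma Zat_two_cycles:
  assumes d: "d \<notin> cyc c"
  shows "Zat sym_pred sg (cyc c \<union> cyc d) c d = Zat root_pred (\<lambda>_ _. 1) (cyc c \<union> cyc d) c d"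
proof -
  let ?C = "cyc c" and ?D = "cyc d" and ?T = "cyc c \<union> cyc d"
  have disj: "?C \<inter> ?D = {}" by (rule cyc_disjoint[OF d])
  have T: "inv_set ?T" by (simp add: inv_set_Un inv_set_cyc)
  have cT: "c \<in> ?T" "d \<in> ?T" by (auto simp: cyc_self)
  note invC = inv_setD[OF inv_set_cyc[of c]] and invD = inv_setD[OF inv_set_cyc[of d]]
  define A where "A = {f \<in> config sym_pred ?T. fst (f c) = d}"
  define H where "H = {f \<in> config root_pred ?T. fst (f c) = d}"
  have Aswap: "i \<in> ?C \<Longrightarrow> fst (f i) \<in> ?D" "i \<in> ?D \<Longrightarrow> fst (f i) \<in> ?C" if f: "f \<in> A" for f i
  proof -
    have f': "f \<in> config sym_pred ?T" "fst (f c) = d" using f by (auto simp: A_def)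
    have dc: "fst (f d) = c" using config_mem(3)[OF f'(1) cT(1)] f'(2) by (simp add: sym_pred_def)
    show "i \<in> ?C \<Longrightarrow> fst (f i) \<in> ?D" "i \<in> ?D \<Longrightarrow> fst (f i) \<in> ?C"
      using sym_commute[OF f'(1) T cT(1)] sym_commute[OF f'(1) T cT(2)] f'(2) dc by (auto simp: cyc_def)
  qed
  have Hswap: "i \<in> ?C \<Longrightarrow> fst (f i) \<in> ?D" "i \<in> ?D \<Longrightarrow> fst (f i) \<in> ?C" if f: "f \<in> H" for f i
  proof -
    have f': "f \<in> config root_pred ?T" "fst (f c) = d" using f by (auto simp: H_def)
    have dc: "fst (f d) = \<pi> c" using config_mem(3)[OF f'(1) cT(1)] f'(2) by (simp add: root_pred_def)
    show "i \<in> ?C \<Longrightarrow> fst (f i) \<in> ?D"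
      using root_commute[OF f'(1) T cT(1)] f'(2) by (auto simp: cyc_def)
    assume "i \<in> ?D"
    then obtain k where "i = (\<pi> ^^ k) d" by (auto simp: cyc_def)
    then have "fst (f i) = (\<pi> ^^ Suc k) c"
      using root_commute[OF f'(1) T cT(2), of k] dc by (simp add: funpow_swap1)
    then show "fst (f i) \<in> ?C" using cyc_pow[of "Suc k" c] by simp
  qed
  have w1: "(\<Prod>i\<in>?T. sg i (f i)) = 1" if f: "f \<in> A" for f
  proof -
    have f': "f \<in> config sym_pred ?T" using f by (auto simp: A_def)
    note sp = config_mem(3)[OF f', unfolded sym_pred_def]
    have bij: "bij_betw (\<lambda>i. fst (f i)) ?C ?D"
      by (rule bij_betw_byWitness[where f' = "\<lambda>i. fst (f i)"]) (use sp Aswap[OF f] in auto)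
    let ?s = "\<lambda>i. if i < fst (f i) then 1 else -1 :: int"
    have "(\<Prod>i\<in>?T. sg i (f i)) = (\<Prod>i\<in>?C. sg i (f i)) * (\<Prod>i\<in>?D. sg i (f i))"
      by (rule prod.union_disjoint[OF finite_cyc finite_cyc disj])
    also have "(\<Prod>i\<in>?D. sg i (f i)) = (\<Prod>i\<in>?C. sg (fst (f i)) (f (fst (f i))))"
      by (rule prod.reindex_bij_betw[OF bij, symmetric])
    also have "(\<Prod>i\<in>?C. sg i (f i)) * \<dots> = (\<Prod>i\<in>?C. ?s i * ?s (\<pi> i))"
      unfolding prod.distrib[symmetric]
    proof (rule prod.cong[OF refl])
      fix i assume i: "i \<in> ?C"
      show "sg i (f i) * sg (fst (f i)) (f (fst (f i))) = ?s i * ?s (\<pi> i)"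
      proof (rule sg_pair[OF refl])
        show "fst (f (fst (f i))) = i" "fst (f (\<pi> i)) = \<pi> (fst (f i))" using sp[of i] i by auto
        show "i \<noteq> fst (f i)" using Aswap(1)[OF f i] i disj by auto
      qed
    qed
    also have "\<dots> = (\<Prod>i\<in>?C. ?s i) * (\<Prod>i\<in>?C. ?s (\<pi> i))" by (rule prod.distrib)
    also have "(\<Prod>i\<in>?C. ?s (\<pi> i)) = (\<Prod>i\<in>\<pi> ` ?C. ?s i)"
      by (rule prod.reindex[symmetric, unfolded comp_def]) (simp add: inj_on_def)
    also have "\<pi> ` ?C = ?C" by (rule image_cyc)
    also have "(\<Prod>i\<in>?C. ?s i) * (\<Prod>i\<in>?C. ?s i) = 1"
      unfolding prod.distrib[symmetric] by (rule prod.neutral) auto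
    finally show ?thesis .
  qed
  \<comment> \<open>An involution exchanging the two cycles becomes a square root of \<pi> if \<pi>
    is inserted on the way back from the second cycle to the first; the colours receive their
    \<open>x\<close> at the same place. \<Psi> reverses this.\<close>
  define \<Phi> where "\<Phi> f = (\<lambda>i\<in>?T. if i \<in> ?C then f i else (\<pi> (fst (f i)), (snd (f i) + x (fst (f i))) mod int r))" for f :: "nat \<Rightarrow> nat \<times> int"
  define \<Psi> where "\<Psi> f = (\<lambda>i\<in>?T. if i \<in> ?C then f i else (inv' \<pi> (fst (f i)), (snd (f i) - x (inv' \<pi> (fst (f i)))) mod int r))" for f :: "nat \<Rightarrow> nat \<times> int"
  have \<Phi>C: "\<Phi> f i = f i" "\<Psi> f i = f i" if "i \<in> ?C" for f i using that by (auto simp: \<Phi>_def \<Psi>_def)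
  have \<Phi>D: "\<Phi> f i = (\<pi> (fst (f i)), (snd (f i) + x (fst (f i))) mod int r)" 
    "\<Psi> f i = (inv' \<pi> (fst (f i)), (snd (f i) - x (inv' \<pi> (fst (f i)))) mod int r)" if "i \<in> ?D" for f i
    using that disj by (auto simp: \<Phi>_def \<Psi>_def)
  have inv\<pi> [simp]: "\<pi> (inv' \<pi> i) = i" "inv' \<pi> (\<pi> i) = i" for i using permutes_inverses[OF perm] by auto
  have invC': "inv' \<pi> i \<in> ?C \<longleftrightarrow> i \<in> ?C" for i using invC[of "inv' \<pi> i"] by simp
  have \<Phi>H: "\<Phi> f \<in> H" if f: "f \<in> A" for f
  proof -
    have f': "f \<in> config sym_pred ?T" "fst (f c) = d" using f by (auto simp: A_def)
    note sp = config_mem(3)[OF f'(1), unfolded sym_pred_def]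
    note sw = Aswap[OF f]
    have "\<Phi> f \<in> ?T \<rightarrow>\<^sub>E ?T \<times> Col"
    proof (rule PiE_I)
      fix i assume "i \<in> ?T"
      then show "\<Phi> f i \<in> ?T \<times> Col"
        using sw config_mem(2)[OF f'(1), of i] r by (auto simp: \<Phi>C \<Phi>D mem_Times_iff invC)
    qed (simp add: \<Phi>_def)
    moreover have "root_pred (\<Phi> f) i" if "i \<in> ?T" for i
      using that
    proof
      assume i: "i \<in> ?C"
      have "fst (f i) \<in> ?D" "fst (f (fst (f i))) = i" "snd (f (fst (f i))) = snd (f i)" using sw i sp[of i] by auto
      then show ?thesis using i by (simp add: root_pred_def \<Phi>C \<Phi>D)
    next
      assume i: "i \<in> ?D"
      let ?j = "fst (f i)"
      have j: "?j \<in> ?C" "fst (f ?j) = i" "snd (f ?j) = snd (f i)" using sw i sp[of i] by auto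
      then have "fst (f (\<pi> ?j)) = \<pi> i" "snd (f (\<pi> ?j)) = (snd (f i) + x ?j + x i) mod int r" using sp[of ?j] by auto
      then show ?thesis using i j by (simp add: root_pred_def \<Phi>C \<Phi>D invC mod_simps add.assoc)
    qed
    ultimately have "\<Phi> f \<in> config root_pred ?T" by (simp add: config_def)
    then show ?thesis using f'(2) by (simp add: H_def \<Phi>C cyc_self)
  qed
  have \<Psi>A: "\<Psi> f \<in> A" if f: "f \<in> H" for f
  proof -
    have f': "f \<in> config root_pred ?T" "fst (f c) = d" using f by (auto simp: H_def)
    note sp = config_mem(3)[OF f'(1), unfolded root_pred_def]
    note sw = Hswap[OF f]
    have com: "fst (f (\<pi> i)) = \<pi> (fst (f i))" if "i \<in> ?T" for i using root_commute[OF f'(1) T that, of 1] by simp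
    have "\<Psi> f \<in> ?T \<rightarrow>\<^sub>E ?T \<times> Col"
    proof (rule PiE_I)
      fix i assume "i \<in> ?T"
      then show "\<Psi> f i \<in> ?T \<times> Col"
        using sw config_mem(2)[OF f'(1), of i] r by (auto simp: \<Phi>C \<Phi>D mem_Times_iff invC')
    qed (simp add: \<Psi>_def)
    moreover have C: "sym_pred (\<Psi> f) i \<and> sym_pred (\<Psi> f) (fst (f i))" if i: "i \<in> ?C" for i
    proof -
      let ?e = "fst (f i)"
      have e: "?e \<in> ?D" "fst (f ?e) = \<pi> i" "snd (f ?e) = (snd (f i) + x i) mod int r" using sw i sp[of i] by auto
      have ci: "snd (f i) mod int r = snd (f i)" using config_mem(2)[OF f'(1), of i] i by auto
      have pi: "fst (f (\<pi> i)) = \<pi> ?e" "snd (f (\<pi> i)) = (snd (f i) + x i + x ?e) mod int r"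
        using com[of i] sp[of ?e] e i by (auto simp: mod_simps)
      have pe: "fst (f (\<pi> ?e)) = \<pi> (\<pi> i)" "snd (f (\<pi> ?e)) = (snd (f i) + x i + x ?e + x (\<pi> i)) mod int r"
        using com[of ?e] sp[of "\<pi> i"] e i pi by (auto simp: mod_simps invC)
      have 1: "\<Psi> f i = f i" "\<Psi> f (\<pi> i) = f (\<pi> i)" using i invC by (auto simp: \<Phi>C)
      have 2: "\<Psi> f ?e = (i, snd (f i))" using e ci by (simp add: \<Phi>D mod_simps)
      have 3: "\<Psi> f (\<pi> ?e) = (\<pi> i, (snd (f i) + x i + x ?e) mod int r)" using e invD pe by (simp add: \<Phi>D mod_simps)
      show ?thesis unfolding sym_pred_def using 1 2 3 pi by (simp add: add.commute add.left_commute)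
    qed
    moreover have "sym_pred (\<Psi> f) e" if e: "e \<in> ?D" for e
    proof -
      let ?i = "inv' \<pi> (fst (f e))"
      have i: "?i \<in> ?C" using sw e by (simp add: invC')
      have "\<pi> (fst (f ?i)) = fst (f (\<pi> ?i))" using com[of ?i] i by simp
      also have "\<dots> = \<pi> e" using sp[of e] e by simp
      finally have "fst (f ?i) = e" by simp
      then show ?thesis using C[OF i] by simp
    qed
    ultimately have "\<Psi> f \<in> config sym_pred ?T" by (auto simp: config_def)
    then show ?thesis using f'(2) by (simp add: A_def \<Phi>C cyc_self)
  qed
  have "bij_betw \<Phi> A H"
  proof (rule bij_betw_byWitness[where f' = \<Psi>])
    show "\<forall>f\<in>A. \<Psi> (\<Phi> f) = f"
    proof (intro ballI ext)
      fix f i assume f: "f \<in> A"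
      then have f': "f \<in> config sym_pred ?T" by (simp add: A_def)
      show "\<Psi> (\<Phi> f) i = f i"
      proof (cases "i \<in> ?T")
        case True
        then have "snd (f i) mod int r = snd (f i)" using config_mem(2)[OF f', of i] by auto
        then show ?thesis using True by (auto simp: \<Phi>C \<Phi>D mod_simps prod_eq_iff)
      next
        case False
        then show ?thesis using f' by (auto simp: config_def \<Psi>_def PiE_def extensional_def)
      qed
    qed
    show "\<forall>f\<in>H. \<Phi> (\<Psi> f) = f"
    proof (intro ballI ext)
      fix f i assume f: "f \<in> H"
      then have f': "f \<in> config root_pred ?T" by (simp add: H_def)
      show "\<Phi> (\<Psi> f) i = f i"
      proof (cases "i \<in> ?T")
        case True
        then have "snd (f i) mod int r = snd (f i)" using config_mem(2)[OF f', of i] by auto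
        then show ?thesis using True by (auto simp: \<Phi>C \<Phi>D mod_simps prod_eq_iff)
      next
        case False
        then show ?thesis using f' by (auto simp: config_def \<Phi>_def PiE_def extensional_def)
      qed
    qed
  qed (use \<Phi>H \<Psi>A in auto)
  then have "card A = card H" by (rule bij_betw_same_card)
  moreover have "Zat sym_pred sg ?T c d = (\<Sum>f\<in>A. 1)"
    unfolding Zat_def A_def[symmetric] by (intro sum.cong refl w1)
  moreover have "Zat root_pred (\<lambda>_ _. 1) ?T c d = (\<Sum>f\<in>H. 1)"
    unfolding Zat_def H_def[symmetric] by simp
  ultimately show ?thesis by simp
qed

end

section \<open>The contribution of a single cycle\<close>

lemma prod_lessThan_add:
  fixes f :: "nat \<Rightarrow> 'a::comm_monoid_mult"
  shows "(\<Prod>l<k + m. f l) = (\<Prod>l<k. f l) * (\<Prod>l<m. f (k + l))"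
  by (induction m) (auto simp: mult.assoc)

lemma prod_telescope_sign:
  fixes s :: "nat \<Rightarrow> int"
  assumes "\<And>k. s k * s k = 1"
  shows "(\<Prod>k<h. s k * s (Suc k)) = s 0 * s h"
proof (induction h)
  case (Suc h)
  then have "(\<Prod>k<Suc h. s k * s (Suc k)) = s 0 * (s h * s h) * s (Suc h)" by simp
  then show ?case using assms by simp
qed (simp add: assms)

context colored_perm
begin

text \<open>Once the images are forced, a configuration is nothing but its colouring.\<close>

lemma Zat_fixed_map:
  assumes C: "inv_set C" and c: "c \<in> C"
    and \<theta>: "\<And>i. i \<in> C \<Longrightarrow> \<theta> i \<in> C" "\<theta> c = d"
    and fixd: "\<And>f i. f \<in> config P C \<Longrightarrow> fst (f c) = d \<Longrightarrow> i \<in> C \<Longrightarrow> fst (f i) = \<theta> i"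
  shows "Zat P W C c d = (\<Sum>w\<in>{w \<in> C \<rightarrow>\<^sub>E Col. \<forall>i\<in>C. P (\<lambda>i\<in>C. (\<theta> i, w i)) i}. \<Prod>i\<in>C. W i (\<theta> i, w i))"
proof -
  let ?Y = "{w \<in> C \<rightarrow>\<^sub>E Col. \<forall>i\<in>C. P (\<lambda>i\<in>C. (\<theta> i, w i)) i}"
  have Y: "?Y = {w \<in> C \<rightarrow>\<^sub>E Col. (\<lambda>i\<in>C. (\<theta> i, w i)) \<in> config P C}"
    using \<theta>(1) by (auto simp: config_def)
  have eq: "(\<lambda>i\<in>C. (\<theta> i, restrict (\<lambda>i. snd (f i)) C i)) = f" if "f \<in> config P C" "fst (f c) = d" for f
  proof
    fix i
    show "(\<lambda>i\<in>C. (\<theta> i, restrict (\<lambda>i. snd (f i)) C i)) i = f i"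
      using fixd[OF that, of i] that(1) by (cases "i \<in> C") (auto simp: prod_eq_iff config_def PiE_def extensional_def)
  qed
  have bij: "bij_betw (\<lambda>w. \<lambda>i\<in>C. (\<theta> i, w i)) ?Y {f \<in> config P C. fst (f c) = d}"
    unfolding Y
  proof (rule bij_betw_byWitness[where f' = "\<lambda>f. \<lambda>i\<in>C. snd (f i)"])
    show "(\<lambda>f. \<lambda>i\<in>C. snd (f i)) ` {f \<in> config P C. fst (f c) = d} \<subseteq> {w \<in> C \<rightarrow>\<^sub>E Col. (\<lambda>i\<in>C. (\<theta> i, w i)) \<in> config P C}"
    proof (rule image_subsetI)
      fix f assume "f \<in> {f \<in> config P C. fst (f c) = d}"
      then have f: "f \<in> config P C" "fst (f c) = d" by auto
      then have "(\<lambda>i\<in>C. snd (f i)) \<in> C \<rightarrow>\<^sub>E Col" using config_mem(2)[OF f(1)] by auto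
      then show "(\<lambda>i\<in>C. snd (f i)) \<in> {w \<in> C \<rightarrow>\<^sub>E Col. (\<lambda>i\<in>C. (\<theta> i, w i)) \<in> config P C}"
        using eq[OF f] f by simp
    qed
  qed (use eq c \<theta>(2) in \<open>auto simp: fun_eq_iff PiE_def extensional_def\<close>)
  have "Zat P W C c d = (\<Sum>w\<in>?Y. \<Prod>i\<in>C. W i ((\<lambda>i\<in>C. (\<theta> i, w i)) i))"
    unfolding Zat_def by (rule sum.reindex_bij_betw[OF bij, symmetric])
  then show ?thesis by (simp cong: prod.cong)
qed

definition cocycle :: "nat set \<Rightarrow> (nat \<Rightarrow> int) \<Rightarrow> (nat \<Rightarrow> int) set" where
  "cocycle C u = {w \<in> C \<rightarrow>\<^sub>E Col. \<forall>i\<in>C. w (\<pi> i) = (w i + u i) mod int r}"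

lemma card_cocycle: "card (cocycle (cyc c) u) = (if int r dvd (\<Sum>i\<in>cyc c. u i) then r else 0)"
proof -
  obtain m where m: "m > 0" "(\<pi> ^^ m) c = c" "bij_betw (\<lambda>k. (\<pi> ^^ k) c) {..<m} (cyc c)"
    by (rule period)
  show ?thesis unfolding cocycle_def by (rule card_cyclic_cocycle[OF r m])
qed

lemma finite_cocycle: "finite C \<Longrightarrow> finite (cocycle C u)"
  unfolding cocycle_def by (rule finite_subset[of _ "C \<rightarrow>\<^sub>E Col"]) (auto intro!: finite_PiE)

lemma cocycle_pow:
  assumes "w \<in> cocycle (cyc c) u"
  shows "w ((\<pi> ^^ k) c) = (w c + (\<Sum>l<k. u ((\<pi> ^^ l) c))) mod int r"
proof (induction k)
  case 0
  then show ?case using assms cyc_self[of c] by (auto simp: cocycle_def dest!: PiE_mem)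
next
  case (Suc k)
  have "w ((\<pi> ^^ Suc k) c) = (w ((\<pi> ^^ k) c) + u ((\<pi> ^^ k) c)) mod int r"
    using assms cyc_pow[of k c] by (auto simp: cocycle_def)
  then show ?case using Suc by (simp add: mod_simps add.assoc)
qed

text \<open>
  Going once around a cycle of fixed points, the halved colours pick up one carry \<open>r / 2\<close> for every
  element counted with a sign, so that the total sign records the class of the sum of \<open>x\<close>.
\<close>

lemma Zat_fixed_cycle:
  "Zat sym_pred sg (cyc c) c c = (if int r dvd (\<Sum>i\<in>cyc c. x i) then int r else 0)"
proof -
  let ?C = "cyc c" and ?X = "\<Sum>i\<in>cyc c. x i"
  let ?W = "cocycle ?C (\<lambda>i. x i + x i)"
  have fixm: "fst (f i) = i" if "f \<in> config sym_pred ?C" "fst (f c) = c" "i \<in> ?C" for f i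
    using sym_commute[OF that(1) inv_set_cyc cyc_self] that(2,3) by (auto simp: cyc_def)
  have "Zat sym_pred sg ?C c c = (\<Sum>w\<in>{w \<in> ?C \<rightarrow>\<^sub>E Col. \<forall>i\<in>?C. sym_pred (\<lambda>i\<in>?C. (i, w i)) i}. \<Prod>i\<in>?C. sg i (i, w i))"
    by (rule Zat_fixed_map[OF inv_set_cyc cyc_self]) (use fixm in auto)
  also have "{w \<in> ?C \<rightarrow>\<^sub>E Col. \<forall>i\<in>?C. sym_pred (\<lambda>i\<in>?C. (i, w i)) i} = ?W"
    by (auto simp: cocycle_def sym_pred_def cyc_closed add.assoc)
  finally have Zeq: "Zat sym_pred sg ?C c c = (\<Sum>w\<in>?W. \<Prod>i\<in>?C. sg i (i, w i))" .
  have sum2: "(\<Sum>i\<in>?C. x i + x i) = 2 * ?X" by (simp add: sum_distrib_left)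
  have fW: "finite ?W" by (simp add: finite_cocycle finite_cyc)
  show ?thesis
  proof (cases "even r")
    case False
    \<comment> \<open>For odd \<open>r\<close> there are no signs and 2 is invertible modulo
      \<open>r\<close>, so the condition on \<open>2 * ?X\<close> is one on
      \<open>?X\<close>.\<close>
    then have cop: "coprime (int r) 2" by simp
    have "Zat sym_pred sg ?C c c = (\<Sum>w\<in>?W. 1)"
      unfolding Zeq using False by (intro sum.cong prod.neutral) (auto simp: sg_def)
    then show ?thesis using card_cocycle[of c "\<lambda>i. x i + x i"] cop unfolding sum2
      by (simp add: coprime_dvd_mult_right_iff)
  next
    case True
    then have r2: "int r = 2 * (int r div 2)" by simp
    let ?h = "int r div 2"
    have colW: "w i \<in> Col" "w (\<pi> i) = (w i + 2 * x i) mod int r" if "w \<in> ?W" "i \<in> ?C" for w i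
      using that by (auto simp: cocycle_def dest: PiE_mem)
    \<comment> \<open>The increments \<open>2 * x i\<close> and the modulus are even, so parity is
      constant along the cycle.\<close>
    have par: "even (w i) \<longleftrightarrow> even (w c)" if w: "w \<in> ?W" and i: "i \<in> ?C" for w i
    proof -
      from i obtain k where k: "i = (\<pi> ^^ k) c" by (auto simp: cyc_def)
      have "even (w ((\<pi> ^^ k) c)) \<longleftrightarrow> even (w c)"
        unfolding cocycle_pow[OF w] using True by (simp add: dvd_mod_iff flip: sum_distrib_left)
      then show ?thesis using k by simp
    qed
    define E where "E = {w \<in> ?W. even (w c)}"
    define O' where "O' = {w \<in> ?W. odd (w c)}"
    \<comment> \<open>Adding 1 to all colours matches the even solutions with the odd ones. There is
      no wrap-around, because an even colour differs from \<open>r - 1\<close>.\<close>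
    define sh where "sh w = (\<lambda>i\<in>?C. w i + 1)" for w :: "nat \<Rightarrow> int"
    have WEO: "?W = E \<union> O'" "E \<inter> O' = {}" "finite E" "finite O'" using fW by (auto simp: E_def O'_def)
    have bij: "bij_betw sh E O'"
    proof (rule bij_betw_byWitness[where f' = "\<lambda>w. \<lambda>i\<in>?C. w i - 1"])
      show "\<forall>w\<in>E. (\<lambda>i\<in>?C. sh w i - 1) = w" "\<forall>w\<in>O'. sh (\<lambda>i\<in>?C. w i - 1) = w"
        by (auto simp: E_def O'_def sh_def cocycle_def PiE_def extensional_def fun_eq_iff)
      show "sh ` E \<subseteq> O'"
      proof (rule image_subsetI)
        fix w assume "w \<in> E"
        then have w: "w \<in> ?W" "even (w c)" by (auto simp: E_def)
        have rng: "w i + 1 \<in> Col" if "i \<in> ?C" for i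
        proof -
          have "w i \<noteq> int r - 1" using par[OF w(1) that] w(2) True by auto
          then show ?thesis using colW(1)[OF w(1) that] by auto
        qed
        have "sh w (\<pi> i) = (sh w i + (x i + x i)) mod int r" if i: "i \<in> ?C" for i
        proof -
          have "w (\<pi> i) + 1 = (w (\<pi> i) + 1) mod int r" using rng[OF cyc_closed[OF i]] by simp
          also have "\<dots> = (w i + 1 + 2 * x i) mod int r" unfolding colW(2)[OF w(1) i] by (simp add: mod_simps algebra_simps)
          finally show ?thesis using i cyc_closed[OF i] by (simp add: sh_def)
        qed
        then show "sh w \<in> O'" using w(2) rng cyc_self[of c] by (auto simp: O'_def cocycle_def sh_def)
      qed
      show "(\<lambda>w. \<lambda>i\<in>?C. w i - 1) ` O' \<subseteq> E"
      proof (rule image_subsetI)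
        fix w assume "w \<in> O'"
        then have w: "w \<in> ?W" "odd (w c)" by (auto simp: O'_def)
        have rng: "w i - 1 \<in> Col" if "i \<in> ?C" for i
        proof -
          have "w i \<noteq> 0" using par[OF w(1) that] w(2) by auto
          then show ?thesis using colW(1)[OF w(1) that] by auto
        qed
        have "w (\<pi> i) - 1 = (w i - 1 + (x i + x i)) mod int r" if i: "i \<in> ?C" for i
        proof -
          have "w (\<pi> i) - 1 = (w (\<pi> i) - 1) mod int r" using rng[OF cyc_closed[OF i]] by simp
          also have "\<dots> = (w i - 1 + 2 * x i) mod int r" unfolding colW(2)[OF w(1) i] by (simp add: mod_simps algebra_simps)
          finally show ?thesis by simp
        qed
        then show "(\<lambda>i\<in>?C. w i - 1) \<in> E" using w(2) rng cyc_self[of c] cyc_closed by (auto simp: E_def cocycle_def)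
      qed
    qed
    have oneE: "(\<Prod>i\<in>?C. sg i (i, w i)) = 1" if "w \<in> E" for w
      by (rule prod.neutral) (use that par in \<open>auto simp: E_def sg_def\<close>)
    have oneO: "(\<Prod>i\<in>?C. sg i (i, sh w i)) = (if int r dvd ?X then 1 else -1)" if "w \<in> E" for w
    proof -
      have w: "w \<in> ?W" "even (w c)" using that by (auto simp: E_def)
      define q where "q i = (x i + w i div 2) mod int r" for i
      define \<kappa> where "\<kappa> i = (if ?h \<le> q i then 1 else 0 :: nat)" for i
      have sgi: "sg i (i, sh w i) = (-1) ^ \<kappa> i" if i: "i \<in> ?C" for i
      proof -
        have ev: "even (w i)" using par[OF w(1) i] w(2) by simp
        then have "(w i + 1) div 2 = w i div 2" by simp
        then show ?thesis using i ev True by (simp add: sg_def sh_def \<kappa>_def q_def)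
      qed
      \<comment> \<open>The halves \<open>v i = w i div 2\<close> satisfy
        \<open>v (\<pi> i) = v i + x i - ?h * \<kappa> i\<close> modulo \<open>r\<close>, with
        \<kappa> the carry. Summed over the cycle the halves cancel, and \<open>?X\<close> is
        \<open>?h\<close> times the number of carries modulo \<open>r\<close>.\<close>
      have step: "int r dvd (x i - (w (\<pi> i) div 2 - w i div 2 + ?h * int (\<kappa> i)))" if i: "i \<in> ?C" for i
      proof -
        have ev: "even (w i)" using par[OF w(1) i] w(2) by simp
        have q: "0 \<le> q i" "q i < int r" using r by (auto simp: q_def)
        have "w (\<pi> i) = (2 * (x i + w i div 2)) mod int r"
          unfolding colW(2)[OF w(1) i] using ev by (simp add: algebra_simps)
        also have "\<dots> = (2 * q i) mod (2 * ?h)" unfolding q_def r2[symmetric] by (simp add: mod_simps)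
        also have "\<dots> = 2 * (q i mod ?h)" by simp
        finally have "w (\<pi> i) div 2 = q i mod ?h" by simp
        also have "\<dots> = q i - ?h * int (\<kappa> i)"
        proof (cases "?h \<le> q i")
          case True
          then have "q i mod ?h = (q i - ?h) mod ?h" by simp
          also have "\<dots> = q i - ?h" using True q r2 by (intro mod_pos_pos_trivial) auto
          finally show ?thesis using True by (simp add: \<kappa>_def)
        qed (use q in \<open>simp add: \<kappa>_def\<close>)
        finally have "x i - (w (\<pi> i) div 2 - w i div 2 + ?h * int (\<kappa> i)) = (x i + w i div 2) - q i" by simp
        then show ?thesis unfolding q_def by (simp add: minus_mod_eq_mult_div)
      qed
      have "int r dvd (\<Sum>i\<in>?C. x i - (w (\<pi> i) div 2 - w i div 2 + ?h * int (\<kappa> i)))"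
        by (rule dvd_sum[OF step])
      also have "(\<Sum>i\<in>?C. x i - (w (\<pi> i) div 2 - w i div 2 + ?h * int (\<kappa> i))) = ?X - ?h * int (\<Sum>i\<in>?C. \<kappa> i)"
      proof -
        have "(\<Sum>i\<in>?C. w (\<pi> i) div 2) = (\<Sum>i\<in>\<pi> ` ?C. w i div 2)"
          by (rule sum.reindex[symmetric, unfolded comp_def]) (simp add: inj_on_def)
        then have "(\<Sum>i\<in>?C. w (\<pi> i) div 2) = (\<Sum>i\<in>?C. w i div 2)" by (simp only: image_cyc)
        then show ?thesis by (simp add: sum_subtractf sum.distrib sum_distrib_left)
      qed
      finally have d: "int r dvd ?X - ?h * int (\<Sum>i\<in>?C. \<kappa> i)" .
      have "int r dvd ?X \<longleftrightarrow> int r dvd ?h * int (\<Sum>i\<in>?C. \<kappa> i)"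
        using d by (metis dvd_diff_right_iff dvd_diff_left_iff)
      also have "\<dots> \<longleftrightarrow> even (\<Sum>i\<in>?C. \<kappa> i)"
      proof -
        have "?h \<noteq> 0" using r r2 by auto
        have "int r dvd ?h * int (\<Sum>i\<in>?C. \<kappa> i) \<longleftrightarrow> ?h * 2 dvd ?h * int (\<Sum>i\<in>?C. \<kappa> i)"
          using r2 by (metis mult.commute)
        also have "\<dots> \<longleftrightarrow> 2 dvd int (\<Sum>i\<in>?C. \<kappa> i)" using \<open>?h \<noteq> 0\<close> by (rule dvd_times_left_cancel_iff)
        finally show ?thesis by (simp only: even_of_nat_iff)
      qed
      finally have iff: "int r dvd ?X \<longleftrightarrow> even (\<Sum>i\<in>?C. \<kappa> i)" .
      have "(\<Prod>i\<in>?C. sg i (i, sh w i)) = (-1) ^ (\<Sum>i\<in>?C. \<kappa> i)"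
        unfolding power_sum by (intro prod.cong refl sgi)
      then show ?thesis using iff by simp
    qed
    have "Zat sym_pred sg ?C c c = (\<Sum>w\<in>E. \<Prod>i\<in>?C. sg i (i, w i)) + (\<Sum>w\<in>O'. \<Prod>i\<in>?C. sg i (i, w i))"
      unfolding Zeq WEO(1) by (rule sum.union_disjoint[OF WEO(3,4,2)])
    also have "(\<Sum>w\<in>O'. \<Prod>i\<in>?C. sg i (i, w i)) = (\<Sum>w\<in>E. \<Prod>i\<in>?C. sg i (i, sh w i))"
      by (rule sum.reindex_bij_betw[OF bij, symmetric])
    also have "(\<Sum>w\<in>E. \<Prod>i\<in>?C. sg i (i, w i)) + \<dots> = int (card E) * (1 + (if int r dvd ?X then 1 else -1))"
      by (simp add: oneE oneO algebra_simps)
    \<comment> \<open>If \<open>r\<close> divides \<open>2 * ?X\<close> but not \<open>?X\<close>,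
      the odd solutions cancel the even ones.\<close>
    finally have Z1: "Zat sym_pred sg ?C c c = int (card E) * (1 + (if int r dvd ?X then 1 else -1))" .
    have "card ?W = card E + card O'" unfolding WEO(1) using WEO by (intro card_Un_disjoint) auto
    also have "card O' = card E" using bij_betw_same_card[OF bij] by simp
    finally have "card E + card E = (if int r dvd 2 * ?X then r else 0)"
      using card_cocycle[of c "\<lambda>i. x i + x i"] unfolding sum2 by simp
    then show ?thesis unfolding Z1 by (auto split: if_splits)
  qed
qed

text \<open>The orientation signs telescope over half the cycle to the product of those at
  \<open>c\<close> and at its opposite point, which is -1. Each colour step adds \<open>x\<close> at
  two opposite points, so half a turn already accumulates the full sum of \<open>x\<close>; opposite
  points having equal colours therefore means that \<open>r\<close> divides this sum.\<close>

lemma Zat_half_turn: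
  assumes m: "(\<pi> ^^ m) c = c" "bij_betw (\<lambda>k. (\<pi> ^^ k) c) {..<m} (cyc c)"
    and h: "m = h + h" "h > 0"
  shows "Zat sym_pred sg (cyc c) c ((\<pi> ^^ h) c) = (if int r dvd (\<Sum>i\<in>cyc c. x i) then - int r else 0)"
proof -
  let ?C = "cyc c" and ?X = "\<Sum>i\<in>cyc c. x i"
  let ?\<theta> = "\<pi> ^^ h"
  define e where "e = (\<lambda>k. (\<pi> ^^ k) c)"
  have bij: "bij_betw e {..<m} ?C" using m(2) by (simp add: e_def)
  have eC: "e k \<in> ?C" for k by (simp add: e_def cyc_pow)
  have eS: "\<pi> (e k) = e (Suc k)" for k by (simp add: e_def)
  have e\<theta>: "?\<theta> (e k) = e (k + h)" for k by (simp add: e_def funpow_add add.commute)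
  have em: "e (k + m) = e k" for k by (simp add: e_def funpow_add m(1))
  have Cobt: "\<exists>k. i = e k" if "i \<in> ?C" for i using that by (auto simp: cyc_def e_def)
  have \<theta>\<theta>: "?\<theta> (?\<theta> i) = i" if "i \<in> ?C" for i
    using Cobt[OF that] em by (auto simp: e\<theta> h(1) add.assoc)
  have \<theta>C: "?\<theta> i \<in> ?C" if "i \<in> ?C" for i using Cobt[OF that] eC by (auto simp: e\<theta>)
  have \<theta>\<pi>: "?\<theta> (\<pi> i) = \<pi> (?\<theta> i)" for i by (simp add: funpow_swap1)
  have neq: "e h \<noteq> e 0" using bij h unfolding bij_betw_def by (auto dest: inj_onD)
  have \<theta>neq: "?\<theta> i \<noteq> i" if i: "i \<in> ?C" for i
  proof
    assume fx: "?\<theta> i = i"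
    obtain k where "i = e k" using Cobt[OF i] by blast
    then have "(\<pi> ^^ k) (e h) = (\<pi> ^^ k) (e 0)" using fx by (simp add: e\<theta>) (simp add: e_def funpow_add)
    then show False using neq by (simp add: inj_pow)
  qed
  define u where "u i = x i + x (?\<theta> i)" for i
  define Y where "Y = {w \<in> cocycle ?C u. \<forall>i\<in>?C. w (?\<theta> i) = w i}"
  have fixm: "fst (f i) = ?\<theta> i" if f: "f \<in> config sym_pred ?C" "fst (f c) = ?\<theta> c" "i \<in> ?C" for f i
  proof -
    obtain k where k: "i = (\<pi> ^^ k) c" using f(3) by (auto simp: cyc_def)
    have "fst (f i) = (\<pi> ^^ k) (?\<theta> c)"
      unfolding k sym_commute[OF f(1) inv_set_cyc cyc_self] f(2) ..
    also have "\<dots> = ?\<theta> i" unfolding k by (metis add.commute comp_apply funpow_add)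
    finally show ?thesis .
  qed
  have "Zat sym_pred sg ?C c (?\<theta> c) =
    (\<Sum>w\<in>{w \<in> ?C \<rightarrow>\<^sub>E Col. \<forall>i\<in>?C. sym_pred (\<lambda>i\<in>?C. (?\<theta> i, w i)) i}. \<Prod>i\<in>?C. sg i (?\<theta> i, w i))"
    by (rule Zat_fixed_map[where \<theta> = ?\<theta> and C = ?C and c = c and d = "?\<theta> c" and P = sym_pred]) (simp_all add: inv_set_cyc cyc_self \<theta>C fixm)
  also have "{w \<in> ?C \<rightarrow>\<^sub>E Col. \<forall>i\<in>?C. sym_pred (\<lambda>i\<in>?C. (?\<theta> i, w i)) i} = Y"
    by (auto simp: Y_def cocycle_def sym_pred_def cyc_closed \<theta>C \<theta>\<theta> \<theta>\<pi> u_def add.assoc)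
  also have "(\<Sum>w\<in>Y. \<Prod>i\<in>?C. sg i (?\<theta> i, w i)) = (\<Sum>w\<in>Y. -1)"
  proof (rule sum.cong[OF refl])
    fix w :: "nat \<Rightarrow> int"
    let ?f = "\<lambda>i. (?\<theta> i, w i)"
    define s where "s k = (if e k < e (k + h) then 1 else -1 :: int)" for k
    have "(\<Prod>i\<in>?C. sg i (?f i)) = (\<Prod>k<h + h. sg (e k) (?f (e k)))"
      using prod.reindex_bij_betw[OF bij, of "\<lambda>i. sg i (?f i)"] h(1) by simp
    also have "\<dots> = (\<Prod>k<h. sg (e k) (?f (e k)) * sg (e (h + k)) (?f (e (h + k))))"
      by (simp add: prod_lessThan_add prod.distrib)
    also have "\<dots> = (\<Prod>k<h. s k * s (Suc k))"
    proof (rule prod.cong[OF refl])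
      fix k
      have "sg (e k) (?f (e k)) * sg (e (h + k)) (?f (e (h + k))) =
          (if e k < fst (?f (e k)) then 1 else -1) * (if \<pi> (e k) < fst (?f (\<pi> (e k))) then 1 else -1)"
      proof (rule sg_pair)
        show "fst (?f (e k)) = e (h + k)" by (simp add: e\<theta> add.commute)
        show "fst (?f (e (h + k))) = e k" using em[of k] by (simp add: e\<theta> h(1) add.commute add.left_commute)
        show "e k \<noteq> e (h + k)" using \<theta>neq[OF eC, of k] by (simp add: e\<theta> add.commute)
        show "fst (?f (\<pi> (e k))) = \<pi> (e (h + k))" by (simp add: \<theta>\<pi> e\<theta> add.commute)
      qed
      then show "sg (e k) (?f (e k)) * sg (e (h + k)) (?f (e (h + k))) = s k * s (Suc k)"
        by (simp add: s_def e\<theta> eS)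
    qed
    also have "\<dots> = s 0 * s h" by (rule prod_telescope_sign) (simp add: s_def)
    also have "\<dots> = -1" using neq em[of 0] h(1) by (auto simp: s_def)
    finally show "(\<Prod>i\<in>?C. sg i (?\<theta> i, w i)) = -1" .
  qed
  finally have Z: "Zat sym_pred sg ?C c (?\<theta> c) = - int (card Y)" by simp
  have halfsum: "(\<Sum>l<h. u ((\<pi> ^^ l) c)) = ?X"
  proof -
    have "?X = (\<Sum>k<h + h. x (e k))" using sum.reindex_bij_betw[OF bij, of x] h(1) by simp
    also have "\<dots> = (\<Sum>k<h. x (e k)) + (\<Sum>k<h. x (e (k + h)))"
      by (simp add: sum_lessThan_add add.commute)
    finally have "?X = (\<Sum>k<h. x (e k) + x (e (k + h)))" by (simp add: sum.distrib)
    moreover have "u ((\<pi> ^^ k) c) = x (e k) + x (e (k + h))" for k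
      using e\<theta>[of k] by (simp add: u_def e_def)
    ultimately show ?thesis by simp
  qed
  have "int (card Y) = (if int r dvd ?X then int r else 0)"
  proof (cases "int r dvd ?X")
    case True
    have "w ((\<pi> ^^ h) i) = w i" if w: "w \<in> cocycle ?C u" and i: "i \<in> ?C" for w i
    proof -
      have wS: "w (e (Suc k)) = (w (e k) + u (e k)) mod int r" for k
        using w eC[of k] by (auto simp: cocycle_def eS[symmetric])
      have "w (e (k + h)) = w (e k)" for k
      proof (induction k)
        case 0
        have "w c = w c mod int r" using w cyc_self[of c] by (auto simp: cocycle_def dest!: PiE_mem)
        moreover have "w (e h) = (w c + ?X) mod int r"
          using cocycle_pow[OF w, of h] halfsum by (simp add: e_def)
        ultimately have "w (e h) = w c" using True by (metis add.right_neutral dvd_imp_mod_0 mod_add_right_eq)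
        then show ?case by (simp add: e_def)
      next
        case (Suc k)
        have "u (e (k + h)) = u (e k)" unfolding u_def e\<theta> using em[of k] by (simp add: h(1) add.assoc)
        then show ?case using wS[of "k + h"] wS[of k] Suc by simp
      qed
      then show ?thesis using Cobt[OF i] e\<theta> by auto
    qed
    then have "Y = cocycle ?C u" by (auto simp: Y_def)
    moreover have "(\<Sum>i\<in>?C. u i) = 2 * ?X"
    proof -
      have "bij_betw ?\<theta> ?C ?C" by (rule bij_betw_byWitness[where f' = ?\<theta>]) (auto simp: \<theta>\<theta> \<theta>C)
      then have "(\<Sum>i\<in>?C. x (?\<theta> i)) = ?X" by (rule sum.reindex_bij_betw)
      then show ?thesis by (simp add: u_def sum.distrib)
    qed
    ultimately show ?thesis using True card_cocycle[of c u] by simp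
  next
    case False
    have "w \<notin> Y" for w
    proof
      assume w: "w \<in> Y"
      then have "w c = (w c + ?X) mod int r"
        using cocycle_pow[of w c u h] halfsum cyc_self[of c] by (auto simp: Y_def)
      moreover have "w c = w c mod int r" using w cyc_self[of c] by (auto simp: Y_def cocycle_def dest!: PiE_mem)
      ultimately have "[w c + 0 = w c + ?X] (mod int r)" by (simp add: cong_def)
      then have "int r dvd ?X" by (simp add: cong_iff_dvd_diff)
      then show False using False by simp
    qed
    then have "Y = {}" by blast
    then show ?thesis using False by simp
  qed
  then show ?thesis using Z by simp
qed

lemma Zat_eq_0: "(\<And>f. f \<in> config P S \<Longrightarrow> fst (f c) \<noteq> d) \<Longrightarrow> Zat P W S c d = 0"
  unfolding Zat_def by (rule sum.neutral) auto

text \<open>On one cycle the commuting involution is \<open>\<pi> ^^ j\<close> with \<open>m\<close>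
  dividing \<open>2 * j\<close>, that is the identity or, for even \<open>m\<close>, the half turn,
  and then the two contributions cancel.\<close>

lemma Z_sym_cycle:
  assumes m: "m > 0" "(\<pi> ^^ m) c = c" "bij_betw (\<lambda>k. (\<pi> ^^ k) c) {..<m} (cyc c)"
    and eq: "\<And>a b. (\<pi> ^^ a) c = (\<pi> ^^ b) c \<longleftrightarrow> a mod m = b mod m"
  shows "Z sym_pred sg (cyc c) = (if odd m \<and> int r dvd (\<Sum>i\<in>cyc c. x i) then int r else 0)"
proof -
  let ?C = "cyc c"
  have sq: "(j + j) mod m = 0" if "f \<in> config sym_pred ?C" "fst (f c) = (\<pi> ^^ j) c" for f j
  proof -
    have "c = fst (f ((\<pi> ^^ j) c))" using config_mem(3)[OF that(1) cyc_self] that(2) by (simp add: sym_pred_def)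
    also have "\<dots> = (\<pi> ^^ (j + j)) c" using sym_commute[OF that(1) inv_set_cyc cyc_self, of j] that(2) by (simp add: funpow_add)
    finally show ?thesis using eq[of 0 "j + j"] by simp
  qed
  have zero: "Zat sym_pred sg ?C c d = 0" if "d \<in> ?C" "d \<noteq> c" "odd m \<or> d \<noteq> (\<pi> ^^ (m div 2)) c" for d
  proof (rule Zat_eq_0)
    fix f assume f: "f \<in> config sym_pred ?C"
    show "fst (f c) \<noteq> d"
    proof
      assume fd: "fst (f c) = d"
      from that(1) obtain j where j: "j < m" "d = (\<pi> ^^ j) c" using m(3) by (auto simp: bij_betw_def)
      have "m dvd j + j" using sq[OF f, of j] fd j by auto
      then obtain q where q: "j + j = m * q" by blast
      have "m * q < m * 2" using j q by linarith
      then have "q < 2" by simp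
      then have "q = 0 \<or> q = 1" by auto
      then show False
      proof
        assume "q = 0" then show False using q j that(2) by simp
      next
        assume "q = 1" then have "m = 2 * j" using q by simp
        then show False using j that(3) by simp
      qed
    qed
  qed
  show ?thesis
  proof (cases "even m")
    case False
    have "Z sym_pred sg ?C = (\<Sum>d\<in>?C. if d = c then Zat sym_pred sg ?C c c else 0)"
      unfolding Z_eq_sum_Zat[OF inv_set_cyc cyc_self] using zero False by (intro sum.cong) auto
    then show ?thesis using False by (simp add: finite_cyc cyc_self Zat_fixed_cycle)
  next
    case True
    then obtain h where h: "m = h + h" by (metis evenE mult_2)
    then have h': "h > 0" "m div 2 = h" using m(1) by auto
    let ?d = "(\<pi> ^^ h) c"
    have dc: "?d \<noteq> c" using eq[of h 0] h h' by simp
    have "Z sym_pred sg ?C = (\<Sum>d\<in>?C. (if d = c then Zat sym_pred sg ?C c c else 0) + (if d = ?d then Zat sym_pred sg ?C c ?d else 0))"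
      unfolding Z_eq_sum_Zat[OF inv_set_cyc cyc_self] using zero dc h' by (intro sum.cong) auto
    then show ?thesis using True Zat_half_turn[OF m(2,3) h h'(1)]
      by (simp add: sum.distrib finite_cyc cyc_self cyc_pow Zat_fixed_cycle)
  qed
qed

text \<open>On one cycle a root is \<open>\<pi> ^^ j\<close> with \<open>2 * j\<close> congruent to
  1 modulo \<open>m\<close>; this is impossible for even \<open>m\<close> and determines
  \<open>j\<close> modulo \<open>m\<close> for odd \<open>m\<close>.\<close>

lemma Z_root_cycle:
  assumes m: "m > 0" "(\<pi> ^^ m) c = c" "bij_betw (\<lambda>k. (\<pi> ^^ k) c) {..<m} (cyc c)"
    and eq: "\<And>a b. (\<pi> ^^ a) c = (\<pi> ^^ b) c \<longleftrightarrow> a mod m = b mod m"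
  shows "Z root_pred (\<lambda>_ _. 1) (cyc c) = (if odd m \<and> int r dvd (\<Sum>i\<in>cyc c. x i) then int r else 0)"
proof -
  let ?C = "cyc c"
  have sq: "[j + j = 1] (mod m)" if "f \<in> config root_pred ?C" "fst (f c) = (\<pi> ^^ j) c" for f j
  proof -
    have "(\<pi> ^^ 1) c = fst (f ((\<pi> ^^ j) c))" using config_mem(3)[OF that(1) cyc_self] that(2) by (simp add: root_pred_def)
    also have "\<dots> = (\<pi> ^^ (j + j)) c" using root_commute[OF that(1) inv_set_cyc cyc_self, of j] that(2) by (simp add: funpow_add)
    finally show ?thesis using eq[of 1 "j + j"] by (simp add: cong_def)
  qed
  show ?thesis
  proof (cases "even m")
    case True
    have "Zat root_pred (\<lambda>_ _. 1) ?C c d = 0" if "d \<in> ?C" for d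
    proof (rule Zat_eq_0)
      fix f assume f: "f \<in> config root_pred ?C"
      from that obtain j where j: "d = (\<pi> ^^ j) c" by (auto simp: cyc_def)
      have "\<not> [j + j = 1] (mod m)"
      proof
        assume "[j + j = 1] (mod m)"
        then have "[j + j = 1] (mod 2)" using True cong_dvd_modulus_nat by blast
        then show False by (simp add: cong_def)
      qed
      then show "fst (f c) \<noteq> d" using sq[OF f, of j] j by auto
    qed
    then show ?thesis using True by (simp add: Z_eq_sum_Zat[OF inv_set_cyc cyc_self])
  next
    case False
    \<comment> \<open>The inverse of 2 modulo the odd number \<open>m\<close>.\<close>
    define j where "j = (m + 1) div 2"
    have j2: "j + j = m + 1" using False by (auto simp: j_def elim!: oddE)
    let ?\<theta> = "\<pi> ^^ j" and ?d = "(\<pi> ^^ j) c"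
    have cop: "coprime 2 m" using False by simp
    have zero: "Zat root_pred (\<lambda>_ _. 1) ?C c d = 0" if "d \<in> ?C" "d \<noteq> ?d" for d
    proof (rule Zat_eq_0)
      fix f assume f: "f \<in> config root_pred ?C"
      show "fst (f c) \<noteq> d"
      proof
        assume fd: "fst (f c) = d"
        from that(1) obtain k where k: "d = (\<pi> ^^ k) c" by (auto simp: cyc_def)
        have "[k + k = j + j] (mod m)" using sq[OF f, of k] fd k unfolding j2 by (simp only: cong_def mod_add_self1)
        then have "[2 * k = 2 * j] (mod m)" by (simp add: mult_2)
        then have "[k = j] (mod m)" using cop cong_mult_lcancel_nat by blast
        then show False using eq[of k j] k that(2) by (simp add: cong_def)
      qed
    qed
    have com: "(\<pi> ^^ k) (?\<theta> i) = ?\<theta> ((\<pi> ^^ k) i)" for k i by (metis add.commute comp_apply funpow_add)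
    have fixm: "fst (f i) = ?\<theta> i" if f: "f \<in> config root_pred ?C" "fst (f c) = ?d" "i \<in> ?C" for f i
    proof -
      obtain k where k: "i = (\<pi> ^^ k) c" using f(3) by (auto simp: cyc_def)
      show ?thesis unfolding k root_commute[OF f(1) inv_set_cyc cyc_self] f(2) by (rule com)
    qed
    have \<theta>C: "?\<theta> i \<in> ?C" if "i \<in> ?C" for i by (rule inv_set_pow[OF inv_set_cyc that])
    have \<theta>\<theta>: "?\<theta> (?\<theta> i) = \<pi> i" if i: "i \<in> ?C" for i
    proof -
      obtain k where k: "i = (\<pi> ^^ k) c" using i by (auto simp: cyc_def)
      have "?\<theta> (?\<theta> i) = (\<pi> ^^ (m + 1)) i" unfolding j2[symmetric] by (simp add: funpow_add)
      also have "\<dots> = (\<pi> ^^ (k + 1)) ((\<pi> ^^ m) c)" unfolding k by (metis (no_types, lifting) add.assoc add.commute comp_apply funpow_add)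
      finally show ?thesis using m(2) k by simp
    qed
    \<comment> \<open>As \<open>?\<theta>\<close> squares to \<pi> on the cycle, it runs through the
      same points, and the colours of a root form a cocycle along \<open>?\<theta>\<close>.\<close>
    have bij: "bij_betw (\<lambda>k. (?\<theta> ^^ k) c) {..<m} ?C"
    proof -
      have inj: "inj_on (\<lambda>k. (?\<theta> ^^ k) c) {..<m}"
      proof (rule inj_onI)
        fix a b assume ab: "a \<in> {..<m}" "b \<in> {..<m}" "(?\<theta> ^^ a) c = (?\<theta> ^^ b) c"
        then have "[a * j = b * j] (mod m)" using eq by (simp add: funpow_mult cong_def mult.commute)
        then have "[(a * j) * 2 = (b * j) * 2] (mod m)" by (rule cong_scalar_right)
        moreover have "(k * j) * 2 = k * m + k" for k using arg_cong[OF j2, of "\<lambda>t. k * t"] by (simp add: algebra_simps)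
        ultimately have "[a = b] (mod m)" by (simp add: cong_def)
        then show "a = b" using ab by (simp add: cong_def)
      qed
      have "(\<lambda>k. (?\<theta> ^^ k) c) ` {..<m} \<subseteq> ?C" by (auto simp: funpow_mult cyc_pow)
      moreover have "card ?C = m" using bij_betw_same_card[OF m(3)] by simp
      ultimately have "(\<lambda>k. (?\<theta> ^^ k) c) ` {..<m} = ?C"
        using inj by (intro card_subset_eq[OF finite_cyc]) (auto simp: card_image)
      then show ?thesis using inj by (simp add: bij_betw_def)
    qed
    have per: "(?\<theta> ^^ m) c = c" using eq[of "m * j" 0] by (simp add: funpow_mult mult.commute)
    have "Zat root_pred (\<lambda>_ _. 1) ?C c ?d =
      (\<Sum>w\<in>{w \<in> ?C \<rightarrow>\<^sub>E Col. \<forall>i\<in>?C. root_pred (\<lambda>i\<in>?C. (?\<theta> i, w i)) i}. \<Prod>i\<in>?C. 1)"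
      by (rule Zat_fixed_map[where \<theta> = ?\<theta> and C = ?C and c = c and d = ?d and P = root_pred]) (simp_all add: inv_set_cyc cyc_self \<theta>C fixm)
    also have "{w \<in> ?C \<rightarrow>\<^sub>E Col. \<forall>i\<in>?C. root_pred (\<lambda>i\<in>?C. (?\<theta> i, w i)) i} =
        {w \<in> ?C \<rightarrow>\<^sub>E Col. \<forall>i\<in>?C. w (?\<theta> i) = (w i + x i) mod int r}"
      by (auto simp: root_pred_def \<theta>C \<theta>\<theta>)
    finally have Z: "Zat root_pred (\<lambda>_ _. 1) ?C c ?d = (if int r dvd (\<Sum>i\<in>?C. x i) then int r else 0)"
      using card_cyclic_cocycle[OF r m(1) per bij, of x] by simp
    have "Z root_pred (\<lambda>_ _. 1) ?C = (\<Sum>d\<in>?C. if d = ?d then Zat root_pred (\<lambda>_ _. 1) ?C c ?d else 0)"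
      unfolding Z_eq_sum_Zat[OF inv_set_cyc cyc_self] using zero by (intro sum.cong) auto
    then show ?thesis using False Z by (simp add: finite_cyc cyc_pow)
  qed
qed

text \<open>Both sums obey the same recursion, so agreement on single cycles and on pairs of
  exchanged cycles is enough.\<close>

theorem Z_sym_eq_Z_root:
  assumes "inv_set S"
  shows "Z sym_pred sg S = Z root_pred (\<lambda>_ _. 1) S"
  using assms
proof (induction "card S" arbitrary: S rule: less_induct)
  case less
  show ?case
  proof (cases "S = {}")
    case True
    then show ?thesis by (simp add: Z_def config_def)
  next
    case False
    then obtain c where c: "c \<in> S" by blast
    have fin: "finite S" using less(2) by (rule inv_set_finite)
    have IH: "Z sym_pred sg (S - T) = Z root_pred (\<lambda>_ _. 1) (S - T)" if "inv_set T" "c \<in> T" for T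
    proof (rule less(1))
      show "card (S - T) < card S" using c that fin by (intro psubset_card_mono) auto
      show "inv_set (S - T)" by (rule inv_set_Diff[OF less(2) that(1)])
    qed
    obtain m where m: "m > 0" "(\<pi> ^^ m) c = c" "bij_betw (\<lambda>k. (\<pi> ^^ k) c) {..<m} (cyc c)"
      "\<And>a b. (\<pi> ^^ a) c = (\<pi> ^^ b) c \<longleftrightarrow> a mod m = b mod m"
      by (rule period[of c]) (rule that; blast)
    have "Z sym_pred sg (cyc c) = Z root_pred (\<lambda>_ _. 1) (cyc c)"
      by (simp only: Z_sym_cycle[OF m] Z_root_cycle[OF m])
    moreover have "Z sym_pred sg S = Z sym_pred sg (cyc c) * Z sym_pred sg (S - cyc c) +
        (\<Sum>d\<in>S - cyc c. Zat sym_pred sg (cyc c \<union> cyc d) c d * Z sym_pred sg (S - (cyc c \<union> cyc d)))"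
      by (rule Z_recursion[OF local_sym_pred less(2) c]) (rule sym_preserves)
    moreover have "Z root_pred (\<lambda>_ _. 1) S = Z root_pred (\<lambda>_ _. 1) (cyc c) * Z root_pred (\<lambda>_ _. 1) (S - cyc c) +
        (\<Sum>d\<in>S - cyc c. Zat root_pred (\<lambda>_ _. 1) (cyc c \<union> cyc d) c d * Z root_pred (\<lambda>_ _. 1) (S - (cyc c \<union> cyc d)))"
      by (rule Z_recursion[OF local_root_pred less(2) c]) (rule root_preserves)
    moreover have "(\<Sum>d\<in>S - cyc c. Zat sym_pred sg (cyc c \<union> cyc d) c d * Z sym_pred sg (S - (cyc c \<union> cyc d))) =
        (\<Sum>d\<in>S - cyc c. Zat root_pred (\<lambda>_ _. 1) (cyc c \<union> cyc d) c d * Z root_pred (\<lambda>_ _. 1) (S - (cyc c \<union> cyc d)))"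
      by (intro sum.cong refl arg_cong2[where f = "(*)"] Zat_two_cycles IH) (auto simp: inv_set_cyc cyc_self inv_set_Un)
    moreover have "Z sym_pred sg (S - cyc c) = Z root_pred (\<lambda>_ _. 1) (S - cyc c)"
      by (rule IH) (auto simp: inv_set_cyc cyc_self)
    ultimately show ?thesis by simp
  qed
qed

section \<open>Conjugating an element to its transpose\<close>

definition conj_pred :: "(nat \<Rightarrow> nat \<times> int) \<Rightarrow> nat \<Rightarrow> bool" where
  "conj_pred f i \<longleftrightarrow> fst (f (fst (f i))) = i \<and> \<pi> (fst (f (\<pi> i))) = fst (f i) \<and>
     snd (f (\<pi> i)) = (snd (f i) + x i - x (fst (f (\<pi> i)))) mod int r"

lemma local_conj_pred: "local_pred conj_pred"
  unfolding local_pred_def conj_pred_def by metis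

text \<open>A reflection of the cycle inverts \<pi>. The matching colours solve a cocycle equation
  whose total is 0, because reflection after \<pi> permutes the cycle, so a solution exists.\<close>

lemma conj_config_cycle: "config conj_pred (cyc c) \<noteq> {}"
proof -
  let ?C = "cyc c"
  obtain m where m: "m > 0" "(\<pi> ^^ m) c = c" "bij_betw (\<lambda>k. (\<pi> ^^ k) c) {..<m} (cyc c)"
    by (rule period[of c])
  define e where "e = (\<lambda>k. (\<pi> ^^ k) c)"
  have bij: "bij_betw e {..<m} ?C" using m(3) by (simp add: e_def)
  have eC: "e k \<in> ?C" for k by (simp add: e_def cyc_pow)
  have eS: "\<pi> (e k) = e (Suc k)" for k by (simp add: e_def)
  have em: "e m = e 0" by (simp add: e_def m(2))
  have Cobt: "\<exists>k<m. i = e k" if "i \<in> ?C" for i using that bij by (auto simp: bij_betw_def)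
  \<comment> \<open>The point with index \<open>k\<close> goes to index \<open>m - k\<close>; for
    \<open>k = 0\<close> this is \<open>e m = e 0\<close>, so nothing has to be reduced modulo
    \<open>m\<close>.\<close>
  define \<theta> where "\<theta> i = e (m - inv_into {..<m} e i)" for i
  have \<theta>e: "\<theta> (e k) = e (m - k)" if "k < m" for k
    using that bij unfolding \<theta>_def by (simp add: bij_betw_def inv_into_f_f)
  have \<theta>e': "\<theta> (e k) = e (m - k)" if "k \<le> m" for k
    using that \<theta>e[of k] \<theta>e[of 0] em m(1) by (cases "k = m") auto
  have \<theta>\<theta>: "\<theta> (\<theta> i) = i" if i: "i \<in> ?C" for i
  proof -
    obtain k where "k < m" "i = e k" using Cobt[OF i] by blast
    then show ?thesis using \<theta>e'[of k] \<theta>e'[of "m - k"] by simp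
  qed
  have \<theta>C: "\<theta> i \<in> ?C" for i by (simp add: \<theta>_def eC)
  have \<theta>\<pi>: "\<pi> (\<theta> (\<pi> i)) = \<theta> i" if i: "i \<in> ?C" for i
  proof -
    obtain k where "k < m" "i = e k" using Cobt[OF i] by blast
    then show ?thesis using \<theta>e'[of k] \<theta>e'[of "Suc k"] by (simp add: eS Suc_diff_Suc)
  qed
  define u where "u i = x i - x (\<theta> (\<pi> i))" for i
  have "bij_betw (\<lambda>i. \<theta> (\<pi> i)) ?C ?C"
    by (rule bij_betw_byWitness[where f' = "\<lambda>i. \<theta> (\<pi> i)"])
      (auto simp: \<theta>C \<theta>\<pi> \<theta>\<theta>)
  then have "(\<Sum>i\<in>?C. x (\<theta> (\<pi> i))) = (\<Sum>i\<in>?C. x i)" by (rule sum.reindex_bij_betw)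
  then have "(\<Sum>i\<in>?C. u i) = 0" by (simp add: u_def sum_subtractf)
  then have "card (cocycle ?C u) > 0" using card_cocycle[of c u] r by simp
  then obtain w where w: "w \<in> cocycle ?C u" by (metis card_gt_0_iff ex_in_conv)
  have "(\<lambda>i\<in>?C. (\<theta> i, w i)) \<in> config conj_pred ?C"
    unfolding config_def conj_pred_def using w \<theta>C \<theta>\<theta> \<theta>\<pi> cyc_closed[of _ c]
    by (auto simp: cocycle_def u_def add_diff_eq dest: PiE_mem)
  then show ?thesis by blast
qed

theorem conj_config_nonempty:
  assumes "inv_set S"
  shows "config conj_pred S \<noteq> {}"
  using assms
proof (induction "card S" arbitrary: S rule: less_induct)
  case less
  show ?case
  proof (cases "S = {}")
    case True
    then show ?thesis by (simp add: config_def)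
  next
    case False
    then obtain c where c: "c \<in> S" by blast
    have fin: "finite S" using less(2) by (rule inv_set_finite)
    let ?T = "cyc c"
    have T: "inv_set ?T" "?T \<subseteq> S" using cyc_subset[OF less(2) c] by (auto simp: inv_set_cyc)
    have "card (S - ?T) < card S" using c fin cyc_self by (intro psubset_card_mono) auto
    then have "config conj_pred (S - ?T) \<noteq> {}" using less(1) inv_set_Diff[OF less(2) T(1)] by blast
    then have "config conj_pred ?T \<times> config conj_pred (S - ?T) \<noteq> {}" using conj_config_cycle by simp
    then show ?thesis using bij_betw_config_split[OF local_conj_pred less(2) T] unfolding bij_betw_def by auto
  qed
qed

end

section \<open>Wreath products\<close>

lemma carrier_wreath:
  assumes "r > 0"
  shows "carrier (wreath r n) = ({1..n} \<rightarrow>\<^sub>E {0..<int r}) \<times> {\<pi>. \<pi> permutes {1..n}}"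
  using assms by (simp add: wreath_def sym_group_def carrier_integer_mod_group)

lemma permutes_inv_mem: "\<pi> permutes S \<Longrightarrow> inv' \<pi> i \<in> S \<longleftrightarrow> i \<in> S"
  by (metis permutes_in_image permutes_inv)

text \<open>The inverse inside \<open>perm_act\<close> meets the inverse in the group law, which
  leaves plain composition of \<open>x\<close> with \<sigma>.\<close>

lemma wreath_mult:
  assumes "\<sigma> permutes {1..n}"
  shows "(x, \<pi>) \<otimes>\<^bsub>wreath r n\<^esub> (y, \<sigma>) = (\<lambda>i\<in>{1..n}. (x (\<sigma> i) + y i) mod int r, \<pi> \<circ> \<sigma>)"
  using permutes_inv_inv[OF assms] by (auto simp: wreath_def perm_act_def sym_group_def)

lemma wreath_one: "\<one>\<^bsub>wreath r n\<^esub> = (\<lambda>i\<in>{1..n}. 0, id)"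
  by (simp add: wreath_def sym_group_def)

lemma PiE_int_eqI:
  assumes "x \<in> {1..n} \<rightarrow>\<^sub>E {0..<int r}" "y \<in> {1..n} \<rightarrow>\<^sub>E {0..<int r}" "\<And>i. i \<in> {1..n} \<Longrightarrow> x i mod int r = y i mod int r"
  shows "x = y"
proof (rule PiE_ext[OF assms(1,2)])
  fix i assume i: "i \<in> {1..n}"
  then show "x i = y i" using assms(3)[OF i] PiE_mem[OF assms(1) i] PiE_mem[OF assms(2) i] by simp
qed

lemma restrict_mod_PiE: "r > 0 \<Longrightarrow> (\<lambda>i\<in>S. f i mod int r) \<in> S \<rightarrow>\<^sub>E {0..<int r}"
  by auto

lemma group_wreath:
  assumes r: "r > 0"
  shows "group (wreath r n)"
proof (rule groupI)
  fix g h assume "g \<in> carrier (wreath r n)" "h \<in> carrier (wreath r n)"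
  then show "g \<otimes>\<^bsub>wreath r n\<^esub> h \<in> carrier (wreath r n)"
    using r by (cases g, cases h) (auto simp: carrier_wreath wreath_mult permutes_compose)
next
  show "\<one>\<^bsub>wreath r n\<^esub> \<in> carrier (wreath r n)" using r by (auto simp: carrier_wreath wreath_one permutes_id)
next
  fix g h k assume "g \<in> carrier (wreath r n)" "h \<in> carrier (wreath r n)" "k \<in> carrier (wreath r n)"
  then show "g \<otimes>\<^bsub>wreath r n\<^esub> h \<otimes>\<^bsub>wreath r n\<^esub> k = g \<otimes>\<^bsub>wreath r n\<^esub> (h \<otimes>\<^bsub>wreath r n\<^esub> k)"
    using r by (cases g, cases h, cases k)
      (auto simp: carrier_wreath wreath_mult permutes_compose permutes_in_image[where S = "{1..n}", simplified] comp_assoc mod_simps add.assoc fun_eq_iff)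
next
  fix g assume g: "g \<in> carrier (wreath r n)"
  then show "\<one>\<^bsub>wreath r n\<^esub> \<otimes>\<^bsub>wreath r n\<^esub> g = g"
    using r by (cases g) (auto simp: carrier_wreath wreath_mult wreath_one permutes_in_image[where S = "{1..n}", simplified] fun_eq_iff PiE_def Pi_def extensional_def)
  obtain x \<pi> where xp: "g = (x, \<pi>)" by (cases g)
  then have p: "\<pi> permutes {1..n}" using g r by (simp add: carrier_wreath)
  let ?h = "(\<lambda>i\<in>{1..n}. (- x (inv' \<pi> i)) mod int r, inv' \<pi>)"
  have "?h \<in> carrier (wreath r n)" using r p by (auto simp: carrier_wreath permutes_inv)
  moreover have "?h \<otimes>\<^bsub>wreath r n\<^esub> g = \<one>\<^bsub>wreath r n\<^esub>"
    unfolding xp wreath_mult[OF p] wreath_one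
    using permutes_in_image[OF p] permutes_inverses[OF p] permutes_inv_o[OF p] by (auto simp: mod_simps fun_eq_iff)
  ultimately show "\<exists>h\<in>carrier (wreath r n). h \<otimes>\<^bsub>wreath r n\<^esub> g = \<one>\<^bsub>wreath r n\<^esub>" by blast
qed

locale wreath_product =
  fixes r n :: nat
  assumes r: "r > 0"
begin

abbreviation W where "W \<equiv> wreath r n"
abbreviation N where "N \<equiv> {1..n}"

sublocale W: group W by (rule group_wreath[OF r])

lemma finite_W: "finite (carrier W)"
  using r by (auto simp: carrier_wreath intro!: finite_PiE finite_permutations)

lemma W_cases:
  assumes "g \<in> carrier W"
  obtains x \<pi> where "g = (x, \<pi>)" "x \<in> N \<rightarrow>\<^sub>E {0..<int r}" "\<pi> permutes N"
  using assms r by (cases g) (auto simp: carrier_wreath)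

lemma W_inv:
  assumes "(x, \<pi>) \<in> carrier W"
  shows "inv\<^bsub>W\<^esub> (x, \<pi>) = (\<lambda>i\<in>N. (- x (inv' \<pi> i)) mod int r, inv' \<pi>)"
proof (rule W.inv_equality)
  have p: "\<pi> permutes N" using assms r by (simp add: carrier_wreath)
  show "(\<lambda>i\<in>N. (- x (inv' \<pi> i)) mod int r, inv' \<pi>) \<otimes>\<^bsub>W\<^esub> (x, \<pi>) = \<one>\<^bsub>W\<^esub>"
    unfolding wreath_mult[OF p] wreath_one
    using permutes_in_image[OF p] permutes_inverses[OF p] permutes_inv_o[OF p] by (auto simp: mod_simps fun_eq_iff)
  show "(\<lambda>i\<in>N. (- x (inv' \<pi> i)) mod int r, inv' \<pi>) \<in> carrier W"
    using r p by (auto simp: carrier_wreath permutes_inv)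
qed (fact assms)

lemma W_bar:
  assumes "(x, \<pi>) \<in> carrier W"
  shows "wr_bar r n (x, \<pi>) = (\<lambda>i\<in>N. (- x i) mod int r, \<pi>)"
proof -
  have x: "x i \<in> {0..<int r}" if "i \<in> N" for i using assms r that by (auto simp: carrier_wreath)
  have "x \<in> carrier (Zr_pow r n)" using assms r by (simp add: carrier_wreath carrier_integer_mod_group)
  then have "inv\<^bsub>Zr_pow r n\<^esub> x = (\<lambda>i\<in>N. inv\<^bsub>integer_mod_group r\<^esub> (x i))" by (intro inv_product_group) auto
  also have "\<dots> = (\<lambda>i\<in>N. (- x i) mod int r)"
    using x r by (intro restrict_ext inv_integer_mod_group) (auto simp: carrier_integer_mod_group)
  finally show ?thesis by (simp add: wr_bar_def)
qed

lemma W_transpose: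
  assumes "(x, \<pi>) \<in> carrier W"
  shows "wr_transpose r n (x, \<pi>) = (\<lambda>i\<in>N. x (inv' \<pi> i), inv' \<pi>)"
proof -
  have p: "\<pi> permutes N" and x: "x \<in> N \<rightarrow>\<^sub>E {0..<int r}" using assms r by (auto simp: carrier_wreath)
  have "wr_transpose r n (x, \<pi>) = (\<lambda>i\<in>N. (- ((\<lambda>i\<in>N. (- x (inv' \<pi> i)) mod int r) i)) mod int r, inv' \<pi>)"
    unfolding wr_transpose_def using W_bar W_inv[OF assms] W.inv_closed[OF assms] by metis
  also have "\<dots> = (\<lambda>i\<in>N. x (inv' \<pi> i), inv' \<pi>)"
  proof -
    have "x (inv' \<pi> i) \<in> {0..<int r}" if "i \<in> N" for i
      using x permutes_inv_mem[OF p, of i] that by blast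
    then show ?thesis by (auto simp: mod_simps intro!: restrict_ext)
  qed
  finally show ?thesis .
qed

lemma bar_closed:
  assumes "g \<in> carrier W"
  shows "wr_bar r n g \<in> carrier W"
proof -
  obtain x \<pi> where g: "g = (x, \<pi>)" using assms by (rule W_cases)
  show ?thesis using assms r unfolding g by (auto simp: W_bar carrier_wreath)
qed

lemma bar_mult:
  assumes "g \<in> carrier W" "h \<in> carrier W"
  shows "wr_bar r n (g \<otimes>\<^bsub>W\<^esub> h) = wr_bar r n g \<otimes>\<^bsub>W\<^esub> wr_bar r n h"
proof -
  obtain x \<pi> where g: "g = (x, \<pi>)" using assms(1) by (rule W_cases)
  obtain y \<sigma> where h: "h = (y, \<sigma>)" and \<sigma>: "\<sigma> permutes N" using assms(2) by (rule W_cases)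
  have gh: "(\<lambda>i\<in>N. (x (\<sigma> i) + y i) mod int r, \<pi> \<circ> \<sigma>) \<in> carrier W"
    using W.m_closed[OF assms] unfolding g h wreath_mult[OF \<sigma>] .
  have \<sigma>N: "\<sigma> i \<in> N" if "i \<in> N" for i using permutes_in_image[OF \<sigma>] that by simp
  have key: "(- ((a + b) mod m)) mod m = ((- a) mod m + (- b) mod m) mod m" for a b m :: int
    by (metis minus_add_distrib mod_add_eq mod_minus_eq)
  have "(\<lambda>i\<in>N. (- ((\<lambda>i\<in>N. (x (\<sigma> i) + y i) mod int r) i)) mod int r) =
      (\<lambda>i\<in>N. ((\<lambda>i\<in>N. (- x i) mod int r) (\<sigma> i) + (\<lambda>i\<in>N. (- y i) mod int r) i) mod int r)"
  proof (rule restrict_ext)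
    fix i assume i: "i \<in> N"
    show "(- ((\<lambda>i\<in>N. (x (\<sigma> i) + y i) mod int r) i)) mod int r =
      ((\<lambda>i\<in>N. (- x i) mod int r) (\<sigma> i) + (\<lambda>i\<in>N. (- y i) mod int r) i) mod int r"
      unfolding restrict_apply'[OF i] restrict_apply'[OF \<sigma>N[OF i]] by (rule key)
  qed
  then show ?thesis
    unfolding g h wreath_mult[OF \<sigma>] W_bar[OF gh] W_bar[OF assms(1)[unfolded g]] W_bar[OF assms(2)[unfolded h]] by (simp only: prod.inject)
qed

lemma bar_bar:
  assumes "g \<in> carrier W"
  shows "wr_bar r n (wr_bar r n g) = g"
proof -
  obtain x \<pi> where g: "g = (x, \<pi>)" "x \<in> N \<rightarrow>\<^sub>E {0..<int r}" "\<pi> permutes N"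
    using assms by (rule W_cases)
  then have c: "(x, \<pi>) \<in> carrier W" using r by (simp add: carrier_wreath)
  have c': "(\<lambda>i\<in>N. (- x i) mod int r, \<pi>) \<in> carrier W" using bar_closed[OF c] unfolding W_bar[OF c] .
  have "(\<lambda>i\<in>N. (- ((\<lambda>i\<in>N. (- x i) mod int r) i)) mod int r) = x"
    by (rule PiE_int_eqI[OF restrict_mod_PiE[OF r] g(2)]) (simp add: mod_simps)
  then show ?thesis unfolding g(1) W_bar[OF c] W_bar[OF c'] by simp
qed

lemma bar_inv: "g \<in> carrier W \<Longrightarrow> wr_bar r n (inv\<^bsub>W\<^esub> g) = inv\<^bsub>W\<^esub> (wr_bar r n g)"
proof (rule W.inv_equality[symmetric])
  assume g: "g \<in> carrier W"
  have "wr_bar r n \<one>\<^bsub>W\<^esub> = \<one>\<^bsub>W\<^esub>" using W_bar[of "\<lambda>i\<in>N. 0" id] W.one_closed unfolding wreath_one by auto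
  then show "wr_bar r n (inv\<^bsub>W\<^esub> g) \<otimes>\<^bsub>W\<^esub> wr_bar r n g = \<one>\<^bsub>W\<^esub>"
    using g by (simp flip: bar_mult)
qed (auto simp: bar_closed)

lemma transpose_mult:
  assumes "g \<in> carrier W" "h \<in> carrier W"
  shows "wr_transpose r n (g \<otimes>\<^bsub>W\<^esub> h) = wr_transpose r n h \<otimes>\<^bsub>W\<^esub> wr_transpose r n g"
  using assms by (simp add: wr_transpose_def W.inv_mult_group bar_mult)

lemma transpose_closed: "g \<in> carrier W \<Longrightarrow> wr_transpose r n g \<in> carrier W"
  by (simp add: wr_transpose_def bar_closed)

lemma transpose_transpose: "g \<in> carrier W \<Longrightarrow> wr_transpose r n (wr_transpose r n g) = g"
  by (simp add: wr_transpose_def bar_inv[symmetric] bar_bar bar_closed)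

lemma twist_closed: "g \<in> carrier W \<Longrightarrow> \<omega> \<in> carrier W \<Longrightarrow> wr_twist r n g \<omega> \<in> carrier W"
  by (simp add: wr_twist_def transpose_closed)

lemma transpose_twist:
  assumes "g \<in> carrier W" "\<omega> \<in> carrier W"
  shows "wr_transpose r n (wr_twist r n g \<omega>) = wr_twist r n g (wr_transpose r n \<omega>)"
  using assms by (simp add: wr_twist_def transpose_mult transpose_closed transpose_transpose W.m_assoc)

lemma twist_mult:
  assumes "g \<in> carrier W" "h \<in> carrier W" "\<omega> \<in> carrier W"
  shows "wr_twist r n (g \<otimes>\<^bsub>W\<^esub> h) \<omega> = wr_twist r n g (wr_twist r n h \<omega>)"
  using assms by (simp add: wr_twist_def transpose_mult transpose_closed W.m_assoc)

lemma twist_one: "\<omega> \<in> carrier W \<Longrightarrow> wr_twist r n \<one>\<^bsub>W\<^esub> \<omega> = \<omega>"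
proof -
  have "wr_transpose r n \<one>\<^bsub>W\<^esub> = \<one>\<^bsub>W\<^esub>"
    using bar_inv[of "\<one>\<^bsub>W\<^esub>"] transpose_mult[of "\<one>\<^bsub>W\<^esub>" "\<one>\<^bsub>W\<^esub>"] transpose_closed[of "\<one>\<^bsub>W\<^esub>"]
    by (metis W.l_cancel_one' W.one_closed W.r_one)
  then show "\<omega> \<in> carrier W \<Longrightarrow> wr_twist r n \<one>\<^bsub>W\<^esub> \<omega> = \<omega>" by (simp add: wr_twist_def)
qed

lemma twist_eq:
  assumes "(x, \<pi>) \<in> carrier W" "(w, \<iota>) \<in> carrier W"
  shows "wr_twist r n (x, \<pi>) (w, \<iota>) =
    (\<lambda>j\<in>N. (w (inv' \<pi> j) + x (inv' \<pi> j) + x (\<iota> (inv' \<pi> j))) mod int r, \<pi> \<circ> \<iota> \<circ> inv' \<pi>)"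
proof -
  have p: "\<pi> permutes N" "\<iota> permutes N" using assms r by (auto simp: carrier_wreath)
  have key: "((a + b) mod m + c) mod m = (b + c + a) mod m" for a b c m :: int
    unfolding mod_add_left_eq by (simp add: algebra_simps)
  have "(\<lambda>i\<in>N. ((\<lambda>i\<in>N. (x (\<iota> i) + w i) mod int r) (inv' \<pi> i) + (\<lambda>i\<in>N. x (inv' \<pi> i)) i) mod int r) =
      (\<lambda>j\<in>N. (w (inv' \<pi> j) + x (inv' \<pi> j) + x (\<iota> (inv' \<pi> j))) mod int r)"
  proof (rule restrict_ext)
    fix i assume i: "i \<in> N"
    then have i': "inv' \<pi> i \<in> N" using permutes_inv_mem[OF p(1)] by blast
    show "((\<lambda>i\<in>N. (x (\<iota> i) + w i) mod int r) (inv' \<pi> i) + (\<lambda>i\<in>N. x (inv' \<pi> i)) i) mod int r =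
       (w (inv' \<pi> i) + x (inv' \<pi> i) + x (\<iota> (inv' \<pi> i))) mod int r"
      unfolding restrict_apply'[OF i] restrict_apply'[OF i'] by (rule key)
  qed
  then show ?thesis
    unfolding wr_twist_def wreath_mult[OF p(2)] W_transpose[OF assms(1)] wreath_mult[OF permutes_inv[OF p(1)]]
    by (simp only: prod.inject)
qed

text \<open>Kept as an unreduced integer: its laws are congruences modulo \<open>r\<close> and pass
  to every divisor of \<open>r\<close>, in particular to \<open>p\<close>.\<close>

definition colsum where "colsum g = (\<Sum>i\<in>N. wr_col g i)"

lemma colsum_mult: "g \<in> carrier W \<Longrightarrow> h \<in> carrier W \<Longrightarrow> [colsum (g \<otimes>\<^bsub>W\<^esub> h) = colsum g + colsum h] (mod int r)"
proof -
  assume gh: "g \<in> carrier W" "h \<in> carrier W"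
  obtain x \<pi> where g: "g = (x, \<pi>)" using gh(1) by (rule W_cases)
  obtain y \<sigma> where h: "h = (y, \<sigma>)" and \<sigma>: "\<sigma> permutes N" using gh(2) by (rule W_cases)
  have "colsum (g \<otimes>\<^bsub>W\<^esub> h) = (\<Sum>i\<in>N. (x (\<sigma> i) + y i) mod int r)" unfolding g h wreath_mult[OF \<sigma>] by (simp add: colsum_def)
  also have "[\<dots> = (\<Sum>i\<in>N. x (\<sigma> i) + y i)] (mod int r)" by (simp add: cong_def mod_sum_eq)
  also have "(\<Sum>i\<in>N. x (\<sigma> i) + y i) = (\<Sum>i\<in>N. x (\<sigma> i)) + (\<Sum>i\<in>N. y i)" by (rule sum.distrib)
  also have "(\<Sum>i\<in>N. x (\<sigma> i)) = (\<Sum>i\<in>N. x i)" by (rule sum.reindex_bij_betw[OF permutes_imp_bij[OF \<sigma>]])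
  finally show ?thesis by (simp add: colsum_def g h)
qed

lemma colsum_bar: "g \<in> carrier W \<Longrightarrow> [colsum (wr_bar r n g) = - colsum g] (mod int r)"
proof -
  assume gW: "g \<in> carrier W"
  then obtain x \<pi> where g: "g = (x, \<pi>)" by (rule W_cases)
  have "colsum (wr_bar r n g) = (\<Sum>i\<in>N. (- x i) mod int r)" using W_bar gW unfolding g by (simp add: colsum_def)
  also have "[\<dots> = (\<Sum>i\<in>N. - x i)] (mod int r)" by (simp add: cong_def mod_sum_eq)
  finally show ?thesis by (simp add: colsum_def g sum_negf)
qed

lemma colsum_one: "colsum \<one>\<^bsub>W\<^esub> = 0" by (simp add: colsum_def wreath_one)

lemma colsum_inv: "g \<in> carrier W \<Longrightarrow> [colsum (inv\<^bsub>W\<^esub> g) = - colsum g] (mod int r)"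
  using cong_sym[OF colsum_mult[of "inv\<^bsub>W\<^esub> g" g]] by (simp add: colsum_one cong_iff_dvd_diff)

lemma colsum_transpose: "g \<in> carrier W \<Longrightarrow> [colsum (wr_transpose r n g) = colsum g] (mod int r)"
  using colsum_bar[of "inv\<^bsub>W\<^esub> g"] colsum_inv[of g] unfolding wr_transpose_def
  by (simp add: cong_def) (metis cong_def cong_minus_minus_iff minus_minus)

lemma colsum_twist: "g \<in> carrier W \<Longrightarrow> \<omega> \<in> carrier W \<Longrightarrow> [colsum (wr_twist r n g \<omega>) = colsum \<omega> + 2 * colsum g] (mod int r)"
proof -
  assume *: "g \<in> carrier W" "\<omega> \<in> carrier W"
  have "[colsum (wr_twist r n g \<omega>) = colsum g + colsum \<omega> + colsum g] (mod int r)"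
    unfolding wr_twist_def using * colsum_mult[of "g \<otimes>\<^bsub>W\<^esub> \<omega>" "wr_transpose r n g"] colsum_mult[of g \<omega>] colsum_transpose[of g] transpose_closed
    by (meson W.m_closed cong_add cong_trans)
  then show ?thesis by (simp add: algebra_simps)
qed

end

section \<open>The sign as a cocycle for the twisted action\<close>

lemma prod_sign_card:
  "finite A \<Longrightarrow> (\<Prod>i\<in>A. if P i then -1 else 1 :: int) = (-1) ^ card {i \<in> A. P i}"
  by (simp add: prod.inter_filter[symmetric])

text \<open>The sign tests whether adding to the half of an odd colour ends in the upper half of the
  residues. Adding \<open>y\<close> first leaves the new half reduced modulo \<open>r / 2\<close>;
  if this drops \<open>r / 2\<close>, the later test for \<open>x\<close> is toggled, and exactly
  then the factor for \<open>y\<close> is -1.\<close>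

lemma carry_cocycle:
  fixes x y w :: int and r :: nat
  assumes "even r" "r > 0" "odd w"
  shows "(if int r div 2 \<le> ((x + y) mod int r + w div 2) mod int r then -1 else 1 :: int) =
    (if int r div 2 \<le> (x + ((w + 2 * y) mod int r) div 2) mod int r then -1 else 1) *
    (if int r div 2 \<le> (y + w div 2) mod int r then -1 else 1)"
proof -
  define h where "h = int r div 2"
  define q where "q = (y + w div 2) mod int r"
  have rh: "int r = 2 * h" and h: "h > 0" using assms by (auto simp: h_def)
  have q: "0 \<le> q" "q < 2 * h" using assms(2) unfolding q_def rh[symmetric] by auto
  have w2: "w + 2 * y = 1 + 2 * (y + w div 2)" using assms(3) by presburger
  have "(w + 2 * y) mod int r = 1 + 2 * ((y + w div 2) mod h)"
    unfolding w2 rh using h by (intro pos_zmod_mult_2) simp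
  then have "((w + 2 * y) mod int r) div 2 = (y + w div 2) mod h" by simp
  also have "\<dots> = q mod h" unfolding q_def rh by (simp add: mod_mod_cancel)
  finally have w': "((w + 2 * y) mod int r) div 2 = q mod h" .
  have xy: "((x + y) mod int r + w div 2) mod int r = (x + q) mod int r"
    unfolding q_def by (simp add: mod_add_left_eq mod_add_right_eq add.assoc)
  show ?thesis
  proof (cases "q < h")
    case True
    then have "q mod h = q" using q by simp
    then show ?thesis unfolding w' xy q_def[symmetric] h_def[symmetric] using True by simp
  next
    case False
    have "q mod h = (q - h) mod h" by simp
    also have "\<dots> = q - h" using False q by (intro mod_pos_pos_trivial) auto
    finally have qm: "q mod h = q - h" .
    define z where "z = (x + (q - h)) mod int r"
    have z: "0 \<le> z" "z < 2 * h" using assms(2) unfolding z_def rh[symmetric] by auto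
    have "(x + q) mod int r = (z + h) mod int r" unfolding z_def by (simp add: mod_add_left_eq)
    also have "\<dots> = (if z < h then z + h else z - h)"
    proof (cases "z < h")
      case False
      have "(z + h) mod int r = (z - h + int r) mod int r" by (simp add: rh add.commute)
      also have "\<dots> = (z - h) mod int r" by simp
      also have "\<dots> = z - h" using False z unfolding rh by (intro mod_pos_pos_trivial) auto
      finally show ?thesis using False by simp
    qed (use z rh in auto)
    finally have "h \<le> (x + q) mod int r \<longleftrightarrow> z < h" using z by auto
    then show ?thesis
      unfolding w' xy q_def[symmetric] h_def[symmetric] qm z_def[symmetric] using False by auto
  qed
qed

context wreath_product
begin

text \<open>Products over all points, here and in \<open>cs\<close>, replace the cardinalities in
  \<open>sign_rn\<close> because they reindex well when \<iota> is conjugated.\<close>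

definition ps :: "(nat \<Rightarrow> nat) \<Rightarrow> (nat \<Rightarrow> nat) \<Rightarrow> int" where
  "ps \<pi> \<iota> = (\<Prod>i\<in>N. if i < \<iota> i \<and> \<pi> i > \<pi> (\<iota> i) then -1 else 1)"

definition cs :: "(nat \<Rightarrow> int) \<Rightarrow> (nat \<Rightarrow> int) \<Rightarrow> (nat \<Rightarrow> nat) \<Rightarrow> int" where
  "cs x w \<iota> = (\<Prod>i\<in>N. if even r \<and> \<iota> i = i \<and> odd (w i) \<and> int r div 2 \<le> (x i + w i div 2) mod int r then -1 else 1)"

text \<open>The only candidate for \<open>k\<close> in \<open>B_set\<close> is
  \<open>w i div 2\<close>, and it is in range because \<open>w i < r\<close>. Inverted pairs are
  counted at their smaller entry.\<close>

lemma sign_eq_ps_cs: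
  assumes w: "\<And>i. i \<in> N \<Longrightarrow> w i \<in> {0..<int r}" and \<iota>: "\<And>i. i \<in> N \<Longrightarrow> \<iota> i \<in> N" "\<And>i. i \<in> N \<Longrightarrow> \<iota> (\<iota> i) = i"
  shows "sign_rn r n (x, \<pi>) (w, \<iota>) = of_int (cs x w \<iota> * ps \<pi> \<iota>)"
proof -
  have B: "B_set r n (x, \<pi>) (w, \<iota>) = {i \<in> N. even r \<and> \<iota> i = i \<and> odd (w i) \<and> int r div 2 \<le> (x i + w i div 2) mod int r}"
  proof (cases "even r")
    case True
    have "(\<exists>k\<in>{0..int r div 2 - 1}. 2 * k + 1 = w i \<and> (x i + k) mod int r \<in> {int r div 2..int r - 1}) \<longleftrightarrow>
        int r div 2 \<le> (x i + w i div 2) mod int r" if "i \<in> N" "odd (w i)" for i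
    proof -
      obtain k where k: "w i = 2 * k + 1" using \<open>odd (w i)\<close> by (rule oddE)
      have "even (int r)" using True by simp
      then obtain h where h: "int r = 2 * h" by (rule evenE)
      have "0 \<le> 2 * k + 1" "2 * k + 1 < 2 * h" using w[OF that(1)] unfolding k h by auto
      then have kh: "0 \<le> k" "k \<le> h - 1" by linarith+
      have div: "w i div 2 = k" "int r div 2 = h" by (simp_all add: k h)
      have lt: "(x i + k) mod int r \<le> int r - 1" using r pos_mod_bound[of "int r" "x i + k"] by linarith
      show ?thesis
        unfolding div
      proof
        assume "h \<le> (x i + k) mod int r"
        then show "\<exists>k\<in>{0..h - 1}. 2 * k + 1 = w i \<and> (x i + k) mod int r \<in> {h..int r - 1}"
          using kh lt by (intro bexI[of _ k] conjI) (simp_all only: k atLeastAtMost_iff simp_thms)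
      next
        assume "\<exists>k\<in>{0..h - 1}. 2 * k + 1 = w i \<and> (x i + k) mod int r \<in> {h..int r - 1}"
        then obtain l where l: "2 * l + 1 = w i" "(x i + l) mod int r \<in> {h..int r - 1}" by blast
        then have "l = k" unfolding k by simp
        then show "h \<le> (x i + k) mod int r" using l(2) by simp
      qed
    qed
    then have "B_set r n (x, \<pi>) (w, \<iota>) = {i \<in> N. \<iota> i = i \<and> odd (w i) \<and> int r div 2 \<le> (x i + w i div 2) mod int r}"
      using True unfolding B_set_def Fix_set_def mult_integer_mod_group fst_conv snd_conv by auto
    then show ?thesis using True by simp
  qed (simp add: B_set_def)
  have 1: "cs x w \<iota> = (-1) ^ card (B_set r n (x, \<pi>) (w, \<iota>))"
    unfolding cs_def prod_sign_card[OF finite_atLeastAtMost] B ..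
  have "bij_betw (\<lambda>i. (i, \<iota> i)) {i \<in> N. i < \<iota> i \<and> \<pi> i > \<pi> (\<iota> i)} (Inv_set n \<pi> \<inter> Pair_set n \<iota>)"
    by (rule bij_betw_byWitness[where f' = fst]) (use \<iota> in \<open>auto simp: Inv_set_def Pair_set_def\<close>)
  then have 2: "ps \<pi> \<iota> = (-1) ^ card (Inv_set n \<pi> \<inter> Pair_set n \<iota>)"
    unfolding ps_def prod_sign_card[OF finite_atLeastAtMost] by (simp only: bij_betw_same_card)
  show ?thesis unfolding sign_rn_def 1 2 by simp
qed

text \<open>Conjugation by \<sigma> carries the pairs of \<iota> to those of the conjugate, and a
  composite reverses a pair iff exactly one of its factors does. \<open>b\<close> names the image of
  a pair by its smaller point.\<close>

lemma ps_mult: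
  assumes \<sigma>: "\<sigma> permutes N" and inj: "inj \<pi>" and \<iota>: "\<And>i. i \<in> N \<Longrightarrow> \<iota> i \<in> N" "\<And>i. i \<in> N \<Longrightarrow> \<iota> (\<iota> i) = i"
  shows "ps (\<pi> \<circ> \<sigma>) \<iota> = ps \<pi> (\<sigma> \<circ> \<iota> \<circ> inv' \<sigma>) * ps \<sigma> \<iota>"
proof -
  note [simp del] = atLeastAtMost_iff One_nat_def
  let ?i' = "\<sigma> \<circ> \<iota> \<circ> inv' \<sigma>"
  have s: "\<sigma> i = \<sigma> j \<longleftrightarrow> i = j" "inv' \<sigma> (\<sigma> i) = i" "\<sigma> (inv' \<sigma> i) = i" "\<sigma> i \<in> N \<longleftrightarrow> i \<in> N" "inv' \<sigma> i \<in> N \<longleftrightarrow> i \<in> N" for i j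
    using permutes_inverses[OF \<sigma>] permutes_inj[OF \<sigma>] permutes_in_image[OF \<sigma>] permutes_inv_mem[OF \<sigma>] by (auto dest: injD)
  define A where "A = {i \<in> N. i < \<iota> i}"
  define A' where "A' = {i \<in> N. i < ?i' i}"
  have ps_A: "ps \<tau> \<kappa> = (\<Prod>i\<in>{i \<in> N. i < \<kappa> i}. if \<tau> i > \<tau> (\<kappa> i) then -1 else 1)" for \<tau> \<kappa>
    unfolding ps_def by (subst prod.inter_filter) (auto intro!: prod.cong)
  define b where "b i = min (\<sigma> i) (\<sigma> (\<iota> i))" for i
  have bcase: "b i = \<sigma> i \<and> ?i' (b i) = \<sigma> (\<iota> i) \<or> b i = \<sigma> (\<iota> i) \<and> ?i' (b i) = \<sigma> i" if "i \<in> N" for i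
    using that by (auto simp: b_def min_def s \<iota>)
  have bij: "bij_betw b A A'"
  proof (rule bij_betw_byWitness[where f' = "\<lambda>j. min (inv' \<sigma> j) (inv' \<sigma> (?i' j))"])
    show "\<forall>i\<in>A. min (inv' \<sigma> (b i)) (inv' \<sigma> (?i' (b i))) = i"
    proof
      fix i assume "i \<in> A"
      then have i: "i \<in> N" "i < \<iota> i" by (auto simp: A_def)
      then show "min (inv' \<sigma> (b i)) (inv' \<sigma> (?i' (b i))) = i"
        using bcase[OF i(1)] by (elim disjE) (auto simp: s min_def)
    qed
    show "\<forall>j\<in>A'. b (min (inv' \<sigma> j) (inv' \<sigma> (?i' j))) = j"
      by (auto simp: A'_def b_def s \<iota> min_def)
    show "b ` A \<subseteq> A'"
    proof (rule image_subsetI)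
      fix i assume "i \<in> A"
      then have i: "i \<in> N" "i < \<iota> i" by (auto simp: A_def)
      then have "\<sigma> i \<noteq> \<sigma> (\<iota> i)" by (simp add: s)
      then have "\<sigma> i < \<sigma> (\<iota> i) \<or> \<sigma> (\<iota> i) < \<sigma> i" by linarith
      then show "b i \<in> A'" using i \<iota> by (auto simp: A'_def b_def s min_def)
    qed
    show "(\<lambda>j. min (inv' \<sigma> j) (inv' \<sigma> (?i' j))) ` A' \<subseteq> A"
    proof (rule image_subsetI)
      fix j assume "j \<in> A'"
      then have j: "j \<in> N" "j < ?i' j" by (auto simp: A'_def)
      then have "\<iota> (inv' \<sigma> j) \<noteq> inv' \<sigma> j" by (auto simp: s)
      then show "min (inv' \<sigma> j) (inv' \<sigma> (?i' j)) \<in> A" using j \<iota> by (auto simp: A_def s min_def)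
    qed
  qed
  have "ps \<pi> ?i' = (\<Prod>i\<in>A. if \<pi> (b i) > \<pi> (?i' (b i)) then -1 else 1)"
    unfolding ps_A A'_def[symmetric] by (rule prod.reindex_bij_betw[OF bij, symmetric])
  moreover have "ps (\<pi> \<circ> \<sigma>) \<iota> = (\<Prod>i\<in>A. (if \<pi> (b i) > \<pi> (?i' (b i)) then -1 else 1) * (if \<sigma> i > \<sigma> (\<iota> i) then -1 else 1))"
    unfolding ps_A A_def[symmetric]
  proof (rule prod.cong[OF refl])
    fix i assume "i \<in> A"
    then have i: "i \<in> N" "i < \<iota> i" by (auto simp: A_def)
    then have ne: "\<sigma> i \<noteq> \<sigma> (\<iota> i)" by (simp add: s)
    then have ne': "\<pi> (\<sigma> i) \<noteq> \<pi> (\<sigma> (\<iota> i))" using inj by (auto dest: injD)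
    show "(if (\<pi> \<circ> \<sigma>) (\<iota> i) < (\<pi> \<circ> \<sigma>) i then -1 else 1 :: int) =
      (if \<pi> (b i) > \<pi> (?i' (b i)) then -1 else 1) * (if \<sigma> i > \<sigma> (\<iota> i) then -1 else 1)"
    proof (cases "\<sigma> i < \<sigma> (\<iota> i)")
      case True
      then show ?thesis by (simp add: b_def s)
    next
      case False
      then have "b i = \<sigma> (\<iota> i)" "?i' (b i) = \<sigma> i" using i \<iota> by (auto simp: b_def min_def s)
      then show ?thesis using False ne ne' by auto
    qed
  qed
  ultimately show ?thesis unfolding ps_A[of \<sigma>] A_def[symmetric] by (simp add: prod.distrib)
qed

text \<open>Fixed points of \<iota> go to fixed points of the conjugate, with the colour raised by
  \<open>2 * y i\<close>. Parity survives since \<open>r\<close> is even, and for odd colours the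
  claim is \<open>carry_cocycle\<close>.\<close>

lemma cs_mult:
  assumes \<sigma>: "\<sigma> permutes N" and \<iota>: "\<And>i. i \<in> N \<Longrightarrow> \<iota> i \<in> N"
  shows "cs (\<lambda>i\<in>N. (x (\<sigma> i) + y i) mod int r) w \<iota> =
     cs x (\<lambda>j\<in>N. (w (inv' \<sigma> j) + y (inv' \<sigma> j) + y (\<iota> (inv' \<sigma> j))) mod int r) (\<sigma> \<circ> \<iota> \<circ> inv' \<sigma>) * cs y w \<iota>"
proof -
  let ?w = "\<lambda>j\<in>N. (w (inv' \<sigma> j) + y (inv' \<sigma> j) + y (\<iota> (inv' \<sigma> j))) mod int r"
  let ?i' = "\<sigma> \<circ> \<iota> \<circ> inv' \<sigma>"
  have s: "\<sigma> i = \<sigma> j \<longleftrightarrow> i = j" "inv' \<sigma> (\<sigma> i) = i" "\<sigma> i \<in> N \<longleftrightarrow> i \<in> N" for i j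
    using permutes_inverses[OF \<sigma>] permutes_inj[OF \<sigma>] permutes_in_image[OF \<sigma>] by (auto dest: injD)
  define t where "t x w \<iota> i = (if even r \<and> \<iota> i = i \<and> odd (w i) \<and> int r div 2 \<le> (x i + w i div 2) mod int r then -1 else 1 :: int)"
    for x w :: "nat \<Rightarrow> int" and \<iota> :: "nat \<Rightarrow> nat" and i
  have "cs x ?w ?i' = (\<Prod>i\<in>N. t x ?w ?i' (\<sigma> i))"
    unfolding cs_def t_def[symmetric] by (rule prod.reindex_bij_betw[OF permutes_imp_bij[OF \<sigma>], symmetric])
  moreover have "cs (\<lambda>i\<in>N. (x (\<sigma> i) + y i) mod int r) w \<iota> = (\<Prod>i\<in>N. t x ?w ?i' (\<sigma> i) * t y w \<iota> i)"
    unfolding cs_def t_def[symmetric]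
  proof (rule prod.cong[OF refl])
    fix i assume i: "i \<in> N"
    show "t (\<lambda>i\<in>N. (x (\<sigma> i) + y i) mod int r) w \<iota> i = t x ?w ?i' (\<sigma> i) * t y w \<iota> i"
    proof (cases "even r \<and> \<iota> i = i")
      case True
      have wi: "?w (\<sigma> i) = (w i + 2 * y i) mod int r"
        using restrict_apply'[of "\<sigma> i" N] i True s(2,3) by (simp add: add.commute)
      have xi: "(\<lambda>i\<in>N. (x (\<sigma> i) + y i) mod int r) i = (x (\<sigma> i) + y i) mod int r"
        by (rule restrict_apply'[OF i])
      have odd: "odd ((w i + 2 * y i) mod int r) \<longleftrightarrow> odd (w i)"
        using True by (simp add: dvd_mod_iff)
      show ?thesis
      proof (cases "odd (w i)")
        case odd': True
        have "t (\<lambda>i\<in>N. (x (\<sigma> i) + y i) mod int r) w \<iota> i =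
           (if int r div 2 \<le> ((x (\<sigma> i) + y i) mod int r + w i div 2) mod int r then -1 else 1)"
          using True odd' by (simp only: t_def xi simp_thms)
        also have "\<dots> = (if int r div 2 \<le> (x (\<sigma> i) + ((w i + 2 * y i) mod int r) div 2) mod int r then -1 else 1) *
             (if int r div 2 \<le> (y i + w i div 2) mod int r then -1 else 1)"
          by (rule carry_cocycle) (use True odd' r in auto)
        also have "\<dots> = t x ?w ?i' (\<sigma> i) * t y w \<iota> i"
        proof -
          have "?i' (\<sigma> i) = \<sigma> i" using True by (simp only: comp_apply s(2))
          then show ?thesis using True odd' odd by (simp only: t_def wi simp_thms)
        qed
        finally show ?thesis .
      next
        case False
        then show ?thesis using odd by (simp only: t_def wi simp_thms if_False mult_1)
      qed
    next
      case False
      moreover have "?i' (\<sigma> i) = \<sigma> i \<longleftrightarrow> \<iota> i = i" by (simp only: comp_apply s(1,2))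
      ultimately show ?thesis by (auto simp only: t_def simp_thms if_False mult_1)
    qed
  qed
  ultimately show ?thesis unfolding cs_def[of y] t_def[symmetric] by (simp add: prod.distrib)
qed

definition is_sym :: "wr \<Rightarrow> bool" where
  "is_sym \<omega> \<longleftrightarrow> \<omega> \<in> carrier W \<and> wr_transpose r n \<omega> = \<omega>"

lemma is_sym_iff:
  assumes "(w, \<iota>) \<in> carrier W"
  shows "is_sym (w, \<iota>) \<longleftrightarrow> (\<forall>i\<in>N. \<iota> (\<iota> i) = i \<and> w (\<iota> i) = w i)"
proof -
  have \<iota>: "\<iota> permutes N" and w: "w \<in> N \<rightarrow>\<^sub>E {0..<int r}" using assms r by (auto simp: carrier_wreath)
  note inv = permutes_inverses[OF \<iota>]
  show ?thesis
  proof
    assume "is_sym (w, \<iota>)"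
    then have eq: "(\<lambda>i\<in>N. w (inv' \<iota> i)) = w" "inv' \<iota> = \<iota>"
      unfolding is_sym_def W_transpose[OF assms] by auto
    show "\<forall>i\<in>N. \<iota> (\<iota> i) = i \<and> w (\<iota> i) = w i"
    proof
      fix i assume i: "i \<in> N"
      have "w i = w (\<iota> i)" using fun_cong[OF eq(1), of i] restrict_apply'[OF i, of "\<lambda>i. w (inv' \<iota> i)"] unfolding eq(2) by simp
      moreover have "\<iota> (\<iota> i) = i" using inv(1)[of i] unfolding eq(2) .
      ultimately show "\<iota> (\<iota> i) = i \<and> w (\<iota> i) = w i" by simp
    qed
  next
    assume s: "\<forall>i\<in>N. \<iota> (\<iota> i) = i \<and> w (\<iota> i) = w i"
    have "\<iota> (\<iota> i) = i" for i using s permutes_not_in[OF \<iota>, of i] by (cases "i \<in> N") auto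
    then have i: "inv' \<iota> = \<iota>" using inv(2) by (metis ext)
    have "(\<lambda>i\<in>N. w (inv' \<iota> i)) = w"
      unfolding i using s w by (auto simp: fun_eq_iff PiE_def extensional_def)
    then show "is_sym (w, \<iota>)" unfolding is_sym_def W_transpose[OF assms] using assms i by simp
  qed
qed

lemma is_sym_cases:
  assumes "is_sym \<omega>"
  obtains w \<iota> where "\<omega> = (w, \<iota>)" "(w, \<iota>) \<in> carrier W" "\<And>i. i \<in> N \<Longrightarrow> w i \<in> {0..<int r}" "\<iota> permutes N" "\<And>i. i \<in> N \<Longrightarrow> \<iota> i \<in> N"
    "\<And>i. i \<in> N \<Longrightarrow> \<iota> (\<iota> i) = i" "\<And>i. i \<in> N \<Longrightarrow> w (\<iota> i) = w i"
proof -
  have "\<omega> \<in> carrier W" using assms by (simp add: is_sym_def)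
  then obtain w \<iota> where *: "\<omega> = (w, \<iota>)" "w \<in> N \<rightarrow>\<^sub>E {0..<int r}" "\<iota> permutes N" by (rule W_cases)
  have c: "(w, \<iota>) \<in> carrier W" using \<open>\<omega> \<in> carrier W\<close> * by simp
  show thesis
    by (rule that[OF *(1) c _ *(3)])
      (use assms * is_sym_iff[OF c] permutes_in_image[OF *(3)] in auto)
qed

lemma is_sym_twist: "g \<in> carrier W \<Longrightarrow> is_sym \<omega> \<Longrightarrow> is_sym (wr_twist r n g \<omega>)"
  by (simp add: is_sym_def twist_closed transpose_twist)

text \<open>Exactly the condition under which the signed permutations of the basis compose like the
  group elements.\<close>

lemma sign_cocycle:
  assumes "g \<in> carrier W" "h \<in> carrier W" "is_sym \<omega>"
  shows "sign_rn r n (g \<otimes>\<^bsub>W\<^esub> h) \<omega> = sign_rn r n g (wr_twist r n h \<omega>) * sign_rn r n h \<omega>"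
proof -
  obtain x \<pi> where g: "g = (x, \<pi>)" and \<pi>: "\<pi> permutes N" using assms(1) by (rule W_cases)
  obtain y \<sigma> where h: "h = (y, \<sigma>)" and \<sigma>: "\<sigma> permutes N" using assms(2) by (rule W_cases)
  obtain w \<iota> where w: "\<omega> = (w, \<iota>)" "(w, \<iota>) \<in> carrier W" "\<And>i. i \<in> N \<Longrightarrow> w i \<in> {0..<int r}" "\<iota> permutes N" "\<And>i. i \<in> N \<Longrightarrow> \<iota> i \<in> N"
    "\<And>i. i \<in> N \<Longrightarrow> \<iota> (\<iota> i) = i" "\<And>i. i \<in> N \<Longrightarrow> w (\<iota> i) = w i" using is_sym_cases[OF assms(3)] by blast
  have hW: "(y, \<sigma>) \<in> carrier W" using assms(2) h by simp
  note tw = twist_eq[OF hW w(2)]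
  obtain w' \<iota>' where w': "wr_twist r n h \<omega> = (w', \<iota>')" "(w', \<iota>') \<in> carrier W" "\<And>i. i \<in> N \<Longrightarrow> w' i \<in> {0..<int r}" "\<iota>' permutes N" "\<And>i. i \<in> N \<Longrightarrow> \<iota>' i \<in> N"
    "\<And>i. i \<in> N \<Longrightarrow> \<iota>' (\<iota>' i) = i" using is_sym_cases[OF is_sym_twist[OF assms(2,3)]] by metis
  have w'eq: "w' = (\<lambda>j\<in>N. (w (inv' \<sigma> j) + y (inv' \<sigma> j) + y (\<iota> (inv' \<sigma> j))) mod int r)" "\<iota>' = \<sigma> \<circ> \<iota> \<circ> inv' \<sigma>"
    using w'(1) tw unfolding h w(1) by auto
  have 1: "sign_rn r n (g \<otimes>\<^bsub>W\<^esub> h) \<omega> = of_int (cs (\<lambda>i\<in>N. (x (\<sigma> i) + y i) mod int r) w \<iota> * ps (\<pi> \<circ> \<sigma>) \<iota>)"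
    unfolding g h w(1) wreath_mult[OF \<sigma>] by (rule sign_eq_ps_cs[OF w(3,5,6)])
  have 2: "sign_rn r n g (wr_twist r n h \<omega>) = of_int (cs x w' \<iota>' * ps \<pi> \<iota>')"
    unfolding g w'(1) by (rule sign_eq_ps_cs[OF w'(3,5,6)])
  have 3: "sign_rn r n h \<omega> = of_int (cs y w \<iota> * ps \<sigma> \<iota>)"
    unfolding h w(1) by (rule sign_eq_ps_cs[OF w(3,5,6)])
  have 4: "cs (\<lambda>i\<in>N. (x (\<sigma> i) + y i) mod int r) w \<iota> = cs x w' \<iota>' * cs y w \<iota>"
    unfolding w'eq by (rule cs_mult[OF \<sigma> w(5)])
  have 5: "ps (\<pi> \<circ> \<sigma>) \<iota> = ps \<pi> \<iota>' * ps \<sigma> \<iota>"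
    unfolding w'eq by (rule ps_mult[OF \<sigma> permutes_inj[OF \<pi>] w(5,6)])
  show ?thesis unfolding 1 2 3 4 5 by (simp only: of_int_mult mult_ac)
qed

lemma sign_one:
  assumes "is_sym \<omega>"
  shows "sign_rn r n \<one>\<^bsub>W\<^esub> \<omega> = 1"
proof -
  have "sign_rn r n \<one>\<^bsub>W\<^esub> \<omega> = sign_rn r n \<one>\<^bsub>W\<^esub> \<omega> * sign_rn r n \<one>\<^bsub>W\<^esub> \<omega>"
    using sign_cocycle[of "\<one>\<^bsub>W\<^esub>" "\<one>\<^bsub>W\<^esub>" \<omega>] assms by (simp add: twist_one is_sym_def)
  moreover have "sign_rn r n \<one>\<^bsub>W\<^esub> \<omega> \<noteq> 0" by (simp add: sign_rn_def)
  ultimately show ?thesis by simp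
qed

end

text \<open>Abstracted from \<open>rho\<close>, whose formula \<open>R\<close> copies. The cocycle
  rule for \<open>s\<close> gives multiplicativity, and only basis elements fixed by
  \<open>tw g\<close> reach the diagonal.\<close>

lemma
  fixes s :: "'g \<Rightarrow> 'i \<Rightarrow> 'k::field" and G :: "('g, 'm) monoid_scheme"
  assumes G: "group G" and I: "finite I"
    and tw: "\<And>g \<omega>. g \<in> carrier G \<Longrightarrow> \<omega> \<in> I \<Longrightarrow> tw g \<omega> \<in> I"
      "\<And>g h \<omega>. g \<in> carrier G \<Longrightarrow> h \<in> carrier G \<Longrightarrow> \<omega> \<in> I \<Longrightarrow> tw (g \<otimes>\<^bsub>G\<^esub> h) \<omega> = tw g (tw h \<omega>)"
      "\<And>\<omega>. \<omega> \<in> I \<Longrightarrow> tw \<one>\<^bsub>G\<^esub> \<omega> = \<omega>"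
    and s: "\<And>g h \<omega>. g \<in> carrier G \<Longrightarrow> h \<in> carrier G \<Longrightarrow> \<omega> \<in> I \<Longrightarrow> s (g \<otimes>\<^bsub>G\<^esub> h) \<omega> = s g (tw h \<omega>) * s h \<omega>"
      "\<And>\<omega>. \<omega> \<in> I \<Longrightarrow> s \<one>\<^bsub>G\<^esub> \<omega> = 1"
  defines "R \<equiv> \<lambda>g. \<lambda>v\<in>coord_space I. \<lambda>\<tau>. \<Sum>\<omega>\<in>I. v \<omega> * (s g \<omega> * unit_vec_at (tw g \<omega>) \<tau>)"
  shows signed_action_representation: "representation G I R"
    and signed_action_character: "rep_character I R g = (\<Sum>\<omega>\<in>{\<omega> \<in> I. tw g \<omega> = \<omega>}. s g \<omega>)"
proof -
  let ?V = "coord_space I :: ('i \<Rightarrow> 'k) set"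
  note [simp] = group.inv_closed[OF G] group.l_inv[OF G] group.r_inv[OF G]
     monoid.one_closed[OF group.is_monoid[OF G]] monoid.m_closed[OF group.is_monoid[OF G]]
  have Rv: "R g v = (\<lambda>\<tau>. \<Sum>\<omega>\<in>I. v \<omega> * (s g \<omega> * unit_vec_at (tw g \<omega>) \<tau>))" if "v \<in> ?V" for g v
    using that by (simp add: R_def)
  have cl: "R g v \<in> ?V" if "g \<in> carrier G" "v \<in> ?V" for g v
    using tw(1)[OF that(1)] unfolding Rv[OF that(2)] by (auto simp: coord_space_def unit_vec_at_def intro!: sum.neutral)
  have delta: "(\<Sum>\<omega>\<in>I. unit_vec_at a \<omega> * f \<omega>) = f a" if "a \<in> I" for a and f :: "'i \<Rightarrow> 'k"
  proof -
    have "(\<Sum>\<omega>\<in>I. unit_vec_at a \<omega> * f \<omega>) = (\<Sum>\<omega>\<in>I. if \<omega> = a then f \<omega> else 0)"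
      by (intro sum.cong) (auto simp: unit_vec_at_def)
    then show ?thesis using that I by simp
  qed
  have mu: "R g (R h v) = R (g \<otimes>\<^bsub>G\<^esub> h) v" if gh: "g \<in> carrier G" "h \<in> carrier G" and v: "v \<in> ?V" for g h v
  proof
    fix \<tau>
    have "R g (R h v) \<tau> = (\<Sum>\<omega>\<in>I. (\<Sum>\<omega>'\<in>I. v \<omega>' * (s h \<omega>' * unit_vec_at (tw h \<omega>') \<omega>)) * (s g \<omega> * unit_vec_at (tw g \<omega>) \<tau>))"
      unfolding Rv[OF cl[OF gh(2) v]] unfolding Rv[OF v] ..
    also have "\<dots> = (\<Sum>\<omega>'\<in>I. \<Sum>\<omega>\<in>I. v \<omega>' * s h \<omega>' * (unit_vec_at (tw h \<omega>') \<omega> * (s g \<omega> * unit_vec_at (tw g \<omega>) \<tau>)))"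
      unfolding sum_distrib_right by (subst sum.swap) (simp only: mult.assoc)
    also have "\<dots> = (\<Sum>\<omega>'\<in>I. v \<omega>' * s h \<omega>' * (s g (tw h \<omega>') * unit_vec_at (tw g (tw h \<omega>')) \<tau>))"
      unfolding sum_distrib_left[symmetric] by (intro sum.cong refl arg_cong2[where f = "(*)"] delta tw(1) gh)
    also have "\<dots> = R (g \<otimes>\<^bsub>G\<^esub> h) v \<tau>"
      unfolding Rv[OF v] using gh by (intro sum.cong refl) (simp add: tw(2) s(1))
    finally show "R g (R h v) \<tau> = R (g \<otimes>\<^bsub>G\<^esub> h) v \<tau>" .
  qed
  have on: "R \<one>\<^bsub>G\<^esub> v = v" if v: "v \<in> ?V" for v
  proof
    fix \<tau>
    have "R \<one>\<^bsub>G\<^esub> v \<tau> = (\<Sum>\<omega>\<in>I. if \<omega> = \<tau> then v \<omega> else 0)"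
      unfolding Rv[OF v] by (intro sum.cong) (auto simp: tw(3) s(2) unit_vec_at_def)
    then show "R \<one>\<^bsub>G\<^esub> v \<tau> = v \<tau>" using v I by (auto simp: coord_space_def)
  qed
  have bij: "R g \<in> Bij ?V" if "g \<in> carrier G" for g
  proof -
    have "bij_betw (R g) ?V ?V"
      by (rule bij_betw_byWitness[where f' = "R (inv\<^bsub>G\<^esub> g)"]) (use that in \<open>auto simp: cl mu on\<close>)
    then show ?thesis by (auto simp: Bij_def R_def)
  qed
  have "R \<in> hom G (BijGroup ?V)"
  proof (rule homI)
    fix g h assume gh: "g \<in> carrier G" "h \<in> carrier G"
    have "R (g \<otimes>\<^bsub>G\<^esub> h) = compose ?V (R g) (R h)"
    proof
      fix v
      show "R (g \<otimes>\<^bsub>G\<^esub> h) v = compose ?V (R g) (R h) v"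
        by (cases "v \<in> ?V") (simp_all add: compose_def mu[OF gh], simp add: R_def)
    qed
    then show "R (g \<otimes>\<^bsub>G\<^esub> h) = R g \<otimes>\<^bsub>BijGroup ?V\<^esub> R h"
      using bij gh by (auto simp: BijGroup_def)
  qed (auto simp: BijGroup_def bij)
  then have "group_action G ?V R"
    using G by (simp add: group_action_def group_hom_def group_hom_axioms_def group_BijGroup)
  moreover have "linear_on_space ?V (R g)" for g
  proof -
    have "(\<lambda>i. u i + v i) \<in> ?V" "(\<lambda>i. c * v i) \<in> ?V" if "u \<in> ?V" "v \<in> ?V" for u v :: "'i \<Rightarrow> 'k" and c
      using that by (auto simp: coord_space_def)
    then show ?thesis
      unfolding linear_on_space_def by (simp add: Rv distrib_right sum.distrib sum_distrib_left mult.assoc)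
  qed
  ultimately show "representation G I R" using I by (simp add: representation_def)
  have "rep_character I R g = (\<Sum>\<omega>\<in>I. s g \<omega> * unit_vec_at (tw g \<omega>) \<omega>)"
    unfolding rep_character_def
    by (intro sum.cong refl) (simp add: Rv unit_vec_at_in delta)
  also have "\<dots> = (\<Sum>\<omega>\<in>I. if tw g \<omega> = \<omega> then s g \<omega> else 0)"
    by (intro sum.cong) (auto simp: unit_vec_at_def)
  also have "\<dots> = (\<Sum>\<omega>\<in>{\<omega> \<in> I. tw g \<omega> = \<omega>}. s g \<omega>)" by (rule sum.inter_filter[OF I, symmetric])
  finally show "rep_character I R g = (\<Sum>\<omega>\<in>{\<omega> \<in> I. tw g \<omega> = \<omega>}. s g \<omega>)" .
qed

lemma matrep_of_rat_representation:
  fixes R :: "'g \<Rightarrow> ('i \<Rightarrow> rat) \<Rightarrow> ('i \<Rightarrow> rat)"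
  assumes R: "representation G I R"
  shows "\<exists>d M. matrep G d M \<and> (\<forall>g. mat_trace (M g) = of_rat (rep_character I R g))"
proof -
  define m where "m g a b = (of_rat (R g (unit_vec_at b) a) :: complex)" for g a b
  have I: "finite I" using R by (simp add: representation_def)
  have "\<exists>d M. matrep G d M \<and> (\<forall>g. mat_trace (M g) = (\<Sum>a\<in>I. m g a a))"
  proof (rule matrep_of_kernel[OF group_if_representation[OF R] I, where m = m])
    fix g h a c assume *: "g \<in> carrier G" "h \<in> carrier G" "a \<in> I" "c \<in> I"
    have u: "(unit_vec_at c :: 'i \<Rightarrow> rat) \<in> coord_space I" using *(4) by (rule unit_vec_at_in)
    have "R (g \<otimes>\<^bsub>G\<^esub> h) (unit_vec_at c) a = (\<Sum>b\<in>I. R h (unit_vec_at c) b * R g (unit_vec_at b) a)"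
      unfolding representation_mult[OF R *(1,2) u] representation_expand[OF R *(1) representation_closed[OF R *(2) u]] ..
    then show "m (g \<otimes>\<^bsub>G\<^esub> h) a c = (\<Sum>b\<in>I. m g a b * m h b c)"
      by (simp add: m_def of_rat_sum of_rat_mult mult.commute)
  next
    fix a c assume "a \<in> I" "c \<in> I"
    then show "m \<one>\<^bsub>G\<^esub> a c = (if a = c then 1 else 0)"
      using representation_one[OF R unit_vec_at_in, of c] by (simp add: m_def unit_vec_at_def)
  qed
  then show ?thesis by (simp add: m_def rep_character_def of_rat_sum)
qed

text \<open>Each translation permutes \<open>B\<close> and preserves \<open>s\<close>, so the sum
  over a divisibility class may be taken over any translate of it. Adding up \<open>q\<close>
  translates counts for each point how often it falls into the class. This is how identities for
  \<open>G(r,1,n)\<close> descend to \<open>G(r,p,n)\<close>.\<close>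

lemma sum_translates:
  fixes s :: "'a \<Rightarrow> rat"
  assumes B: "finite B" and t: "\<And>a. a < q \<Longrightarrow> bij_betw (t a) B B"
    and D: "\<And>a x. a < q \<Longrightarrow> x \<in> B \<Longrightarrow> [D (t a x) = D x + m * int a] (mod int p)"
    and s: "\<And>a x. a < q \<Longrightarrow> x \<in> B \<Longrightarrow> s (t a x) = s x"
  shows "of_nat q * (\<Sum>x\<in>{x \<in> B. int p dvd D x}. s x) =
    (\<Sum>x\<in>B. s x * of_nat (card {a \<in> {..<q}. int p dvd D x + m * int a}))"
proof -
  have "of_nat q * (\<Sum>x\<in>{x \<in> B. int p dvd D x}. s x) = (\<Sum>a<q. \<Sum>x\<in>B. if int p dvd D x then s x else 0)"
    by (simp add: sum.inter_filter[OF B])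
  also have "\<dots> = (\<Sum>a<q. \<Sum>x\<in>B. if int p dvd D (t a x) then s (t a x) else 0)"
    by (intro sum.cong refl sum.reindex_bij_betw[OF t, symmetric]) auto
  also have "\<dots> = (\<Sum>a<q. \<Sum>x\<in>B. if int p dvd D x + m * int a then s x else 0)"
    using s cong_dvd_iff[OF D] by (intro sum.cong) auto
  also have "\<dots> = (\<Sum>x\<in>B. \<Sum>a<q. if int p dvd D x + m * int a then s x else 0)" by (rule sum.swap)
  also have "\<dots> = (\<Sum>x\<in>B. s x * of_nat (card {a \<in> {..<q}. int p dvd D x + m * int a}))"
    by (intro sum.cong refl) (simp add: sum.inter_filter[symmetric])
  finally show ?thesis .
qed

lemma coprime_solution:
  fixes m D :: int
  assumes "coprime m (int p)" "p > 0"
  shows "\<exists>a<p. int p dvd D + m * int a"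
proof -
  obtain y where "[m * y = 1] (mod int p)" using cong_solve_coprime_int[OF assms(1)] by auto
  then have "[m * y * - D = 1 * - D] (mod int p)" by (rule cong_scalar_right)
  moreover have "[m * ((y * - D) mod int p) = m * (y * - D)] (mod int p)"
    unfolding cong_def by (rule mod_mult_right_eq)
  ultimately have "[m * ((y * - D) mod int p) = 1 * - D] (mod int p)"
    by (simp only: mult.assoc cong_trans)
  then have "[D + m * ((y * - D) mod int p) = D + 1 * - D] (mod int p)"
    by (rule cong_add[OF cong_refl])
  then have "[D + m * ((y * - D) mod int p) = 0] (mod int p)" by simp
  then have "int p dvd D + m * int (nat ((y * - D) mod int p))"
    using assms(2) by (simp only: cong_0_iff nat_0_le pos_mod_sign of_nat_0_less_iff)
  moreover have "nat ((y * - D) mod int p) < p" using assms(2) by (simp add: nat_less_iff)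
  ultimately show ?thesis by blast
qed

lemma coprime_unique_solution:
  fixes m D :: int
  assumes "coprime m (int p)" "p > 0"
  shows "card {a \<in> {..<p}. int p dvd D + m * int a} = 1"
proof -
  obtain a where a: "a < p" "int p dvd D + m * int a" using coprime_solution[OF assms] by blast
  have "b = a" if b: "b < p" "int p dvd D + m * int b" for b
  proof -
    have "int p dvd (D + m * int b) - (D + m * int a)" by (rule dvd_diff[OF b(2) a(2)])
    also have "(D + m * int b) - (D + m * int a) = m * (int b - int a)" by (simp add: right_diff_distrib)
    finally have "int p dvd int b - int a"
      using coprime_dvd_mult_right_iff[OF coprime_commute[THEN iffD1, OF assms(1)]] by (simp only:)
    then have "[int b = int a] (mod int p)" by (simp add: cong_iff_dvd_diff)
    then have "[b = a] (mod p)" by (simp only: cong_int_iff)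
    then show ?thesis using a(1) b(1) by (simp only: cong_def mod_less)
  qed
  then have "{a \<in> {..<p}. int p dvd D + m * int a} = {a}" using a by blast
  then show ?thesis by simp
qed

section \<open>The character identity for G(r,1,n)\<close>

context wreath_product
begin

definition conf :: "wr \<Rightarrow> nat \<Rightarrow> nat \<times> int" where
  "conf g = (\<lambda>i\<in>N. (wr_perm g i, wr_col g i))"

lemma bij_betw_conf:
  "bij_betw conf (carrier W) {f \<in> N \<rightarrow>\<^sub>E N \<times> {0..<int r}. inj_on (\<lambda>i. fst (f i)) N}"
proof (rule bij_betw_byWitness[where f' = "\<lambda>f. (\<lambda>i\<in>N. snd (f i), \<lambda>i. if i \<in> N then fst (f i) else i)"])
  let ?from = "\<lambda>f :: nat \<Rightarrow> nat \<times> int. (\<lambda>i\<in>N. snd (f i), \<lambda>i. if i \<in> N then fst (f i) else i)"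
  let ?F = "{f \<in> N \<rightarrow>\<^sub>E N \<times> {0..<int r}. inj_on (\<lambda>i. fst (f i)) N}"
  note [simp del] = atLeastAtMost_iff One_nat_def
  show "\<forall>g\<in>carrier W. ?from (conf g) = g"
  proof
    fix g assume "g \<in> carrier W"
    then obtain x \<pi> where g: "g = (x, \<pi>)" "x \<in> N \<rightarrow>\<^sub>E {0..<int r}" "\<pi> permutes N" by (rule W_cases)
    have "(\<lambda>i\<in>N. snd (conf g i)) = x" using g(2) by (auto simp: conf_def g(1) PiE_def extensional_def)
    moreover have "(\<lambda>i. if i \<in> N then fst (conf g i) else i) = \<pi>"
      using permutes_not_in[OF g(3)] by (auto simp: conf_def g(1))
    ultimately show "?from (conf g) = g" unfolding g(1) by (simp only:)
  qed
  show "\<forall>f\<in>?F. conf (?from f) = f"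
    by (auto simp: conf_def PiE_def extensional_def fun_eq_iff)
  show "conf ` carrier W \<subseteq> ?F"
  proof (rule image_subsetI)
    fix g assume "g \<in> carrier W"
    then obtain x \<pi> where g: "g = (x, \<pi>)" "x \<in> N \<rightarrow>\<^sub>E {0..<int r}" "\<pi> permutes N" by (rule W_cases)
    show "conf g \<in> ?F"
      using g(2) permutes_in_image[OF g(3)] permutes_inj[OF g(3)]
      by (auto simp: conf_def g(1) inj_on_def dest: injD)
  qed
  show "?from ` ?F \<subseteq> carrier W"
  proof (rule image_subsetI)
    fix f assume "f \<in> ?F"
    then have f: "f \<in> N \<rightarrow>\<^sub>E N \<times> {0..<int r}" "inj_on (\<lambda>i. fst (f i)) N" by auto
    have fi: "fst (f i) \<in> N" "snd (f i) \<in> {0..<int r}" if "i \<in> N" for i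
      using PiE_mem[OF f(1) that] by (auto simp: mem_Times_iff)
    have "(\<lambda>i. fst (f i)) ` N = N" using f(2) fi by (intro endo_inj_surj) auto
    then have "bij_betw (\<lambda>i. fst (f i)) N N" using f(2) by (simp add: bij_betw_def)
    then have "bij_betw (\<lambda>i. if i \<in> N then fst (f i) else i) N N" by (simp cong: bij_betw_cong)
    then have "(\<lambda>i. if i \<in> N then fst (f i) else i) permutes N" by (rule bij_imp_permutes) simp
    then show "?from f \<in> carrier W" using fi(2) r by (simp add: carrier_wreath)
  qed
qed

lemma bij_betw_conf_restrict:
  assumes "\<And>g. g \<in> carrier W \<Longrightarrow> Q g \<longleftrightarrow> conf g \<in> C"
    and "\<And>f. f \<in> C \<Longrightarrow> f \<in> N \<rightarrow>\<^sub>E N \<times> {0..<int r} \<and> inj_on (\<lambda>i. fst (f i)) N"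
  shows "bij_betw conf {g \<in> carrier W. Q g} C"
proof -
  have "conf ` {g \<in> carrier W. Q g} = C"
  proof (intro Set.equalityI subsetI)
    fix f assume f: "f \<in> C"
    then have "f \<in> conf ` carrier W"
      using assms(2)[OF f] bij_betw_imp_surj_on[OF bij_betw_conf] by simp
    then obtain g where "g \<in> carrier W" "f = conf g" by blast
    then show "f \<in> conf ` {g \<in> carrier W. Q g}" using f assms(1) by blast
  qed (use assms(1) in blast)
  moreover have "inj_on conf {g \<in> carrier W. Q g}"
    by (rule inj_on_subset[OF bij_betw_imp_inj_on[OF bij_betw_conf]]) blast
  ultimately show ?thesis by (simp only: bij_betw_def)
qed

definition roots :: "wr \<Rightarrow> wr set" where
  "roots g = {h \<in> carrier W. h \<otimes>\<^bsub>W\<^esub> wr_bar r n h = g}"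

definition fixed :: "wr \<Rightarrow> wr set" where
  "fixed g = {\<omega> \<in> carrier W. is_sym \<omega> \<and> wr_twist r n g \<omega> = \<omega>}"

text \<open>Written pointwise, fixed symmetric elements and twisted roots are the configurations on
  \<open>{1..n}\<close> for \<open>sym_pred\<close> and \<open>root_pred\<close>, and
  \<open>sign_rn\<close> is the product of the local factors \<open>sg\<close>.\<close>

theorem sum_sign_fixed:
  assumes g: "g \<in> carrier W"
  shows "(\<Sum>\<omega>\<in>fixed g. sign_rn r n g \<omega>) = of_nat (card (roots g))"
proof -
  obtain x \<pi> where gx: "g = (x, \<pi>)" "x \<in> N \<rightarrow>\<^sub>E {0..<int r}" and \<pi>: "\<pi> permutes N" using g by (rule W_cases)
  have gW: "(x, \<pi>) \<in> carrier W" using g gx by simp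
  interpret cp: colored_perm N \<pi> r x by unfold_locales (use \<pi> r in auto)
  note [simp del] = atLeastAtMost_iff One_nat_def
  have invN: "cp.inv_set N" using permutes_image[OF \<pi>] by (simp add: cp.inv_set_def)
  have \<pi>N: "\<pi> i \<in> N \<longleftrightarrow> i \<in> N" "inv' \<pi> (\<pi> i) = i" "\<pi> (inv' \<pi> i) = i" "inv' \<pi> i \<in> N \<longleftrightarrow> i \<in> N" for i
    using permutes_in_image[OF \<pi>] permutes_inverses[OF \<pi>] permutes_inv_mem[OF \<pi>] by auto
  have inj_sym: "inj_on (\<lambda>i. fst (f i)) N" if f: "f \<in> cp.config cp.sym_pred N" for f
    using cp.config_mem(3)[OF f] by (intro inj_on_inverseI[where g = "\<lambda>i. fst (f i)"]) (auto simp: cp.sym_pred_def)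
  have inj_root: "inj_on (\<lambda>i. fst (f i)) N" if f: "f \<in> cp.config cp.root_pred N" for f
  proof (rule inj_onI)
    fix i j assume "i \<in> N" "j \<in> N" "fst (f i) = fst (f j)"
    then have "\<pi> i = \<pi> j" using cp.config_mem(3)[OF f] unfolding cp.root_pred_def by metis
    then show "i = j" by simp
  qed
  have confW: "conf (w, \<iota>) \<in> N \<rightarrow>\<^sub>E N \<times> {0..<int r}" if "(w, \<iota>) \<in> carrier W" for w \<iota>
    using bij_betw_conf that unfolding bij_betw_def by blast
  have conf_i: "conf (w, \<iota>) i = (\<iota> i, w i)" if "i \<in> N" for w \<iota> i using that by (simp add: conf_def)
  have "bij_betw conf {\<omega> \<in> carrier W. is_sym \<omega> \<and> wr_twist r n g \<omega> = \<omega>} (cp.config cp.sym_pred N)"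
  proof (rule bij_betw_conf_restrict)
    fix \<omega> assume \<omega>: "\<omega> \<in> carrier W"
    obtain w \<iota> where w: "\<omega> = (w, \<iota>)" "w \<in> N \<rightarrow>\<^sub>E {0..<int r}" "\<iota> permutes N" using \<omega> by (rule W_cases)
    have wW: "(w, \<iota>) \<in> carrier W" using \<omega> w by simp
    have \<iota>N: "\<iota> i \<in> N \<longleftrightarrow> i \<in> N" for i using permutes_in_image[OF w(3)] .
    let ?w = "\<lambda>j\<in>N. (w (inv' \<pi> j) + x (inv' \<pi> j) + x (\<iota> (inv' \<pi> j))) mod int r"
    have "wr_twist r n g \<omega> = \<omega> \<longleftrightarrow> ?w = w \<and> \<pi> \<circ> \<iota> \<circ> inv' \<pi> = \<iota>"
      unfolding gx(1) w(1) twist_eq[OF gW wW] by simp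
    also have "?w = w \<longleftrightarrow> (\<forall>i\<in>N. w (\<pi> i) = (w i + x i + x (\<iota> i)) mod int r)"
    proof
      assume eq: "?w = w"
      show "\<forall>i\<in>N. w (\<pi> i) = (w i + x i + x (\<iota> i)) mod int r"
      proof
        fix i assume i: "i \<in> N"
        then have "?w (\<pi> i) = (w i + x i + x (\<iota> i)) mod int r" by (simp add: \<pi>N)
        then show "w (\<pi> i) = (w i + x i + x (\<iota> i)) mod int r" using eq by simp
      qed
    next
      assume a: "\<forall>i\<in>N. w (\<pi> i) = (w i + x i + x (\<iota> i)) mod int r"
      show "?w = w"
      proof
        fix j
        show "?w j = w j"
        proof (cases "j \<in> N")
          case True
          then show ?thesis using a[rule_format, of "inv' \<pi> j"] by (simp add: \<pi>N)
        next
          case False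
          then show ?thesis using w(2) by (auto simp: PiE_def extensional_def)
        qed
      qed
    qed
    also have "\<pi> \<circ> \<iota> \<circ> inv' \<pi> = \<iota> \<longleftrightarrow> (\<forall>i\<in>N. \<iota> (\<pi> i) = \<pi> (\<iota> i))"
    proof
      assume eq: "\<pi> \<circ> \<iota> \<circ> inv' \<pi> = \<iota>"
      show "\<forall>i\<in>N. \<iota> (\<pi> i) = \<pi> (\<iota> i)" using fun_cong[OF eq, of "\<pi> _"] by (simp add: \<pi>N)
    next
      assume a: "\<forall>i\<in>N. \<iota> (\<pi> i) = \<pi> (\<iota> i)"
      show "\<pi> \<circ> \<iota> \<circ> inv' \<pi> = \<iota>"
      proof
        fix j
        show "(\<pi> \<circ> \<iota> \<circ> inv' \<pi>) j = \<iota> j"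
        proof (cases "j \<in> N")
          case True
          then show ?thesis using a[rule_format, of "inv' \<pi> j"] by (simp add: \<pi>N)
        next
          case False
          then show ?thesis
            using permutes_not_in[OF w(3)] permutes_not_in[OF \<pi>] permutes_not_in[OF permutes_inv[OF \<pi>]] by simp
        qed
      qed
    qed
    finally have tw: "wr_twist r n g \<omega> = \<omega> \<longleftrightarrow>
       (\<forall>i\<in>N. w (\<pi> i) = (w i + x i + x (\<iota> i)) mod int r) \<and> (\<forall>i\<in>N. \<iota> (\<pi> i) = \<pi> (\<iota> i))" .
    show "(is_sym \<omega> \<and> wr_twist r n g \<omega> = \<omega>) \<longleftrightarrow> conf \<omega> \<in> cp.config cp.sym_pred N"
      unfolding tw unfolding w(1) is_sym_iff[OF wW] cp.config_def cp.sym_pred_def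
      using confW[OF wW] \<iota>N \<pi>N(1) by (auto simp: conf_i)
  qed (use inj_sym in \<open>auto simp: cp.config_def\<close>)
  then have bij: "bij_betw conf (fixed g) (cp.config cp.sym_pred N)" by (simp add: fixed_def)
  have bij': "bij_betw conf (roots g) (cp.config cp.root_pred N)"
    unfolding roots_def
  proof (rule bij_betw_conf_restrict)
    fix h assume h: "h \<in> carrier W"
    obtain y \<sigma> where y: "h = (y, \<sigma>)" "y \<in> N \<rightarrow>\<^sub>E {0..<int r}" "\<sigma> permutes N" using h by (rule W_cases)
    have yW: "(y, \<sigma>) \<in> carrier W" using h y by simp
    have \<sigma>N: "\<sigma> i \<in> N \<longleftrightarrow> i \<in> N" for i using permutes_in_image[OF y(3)] .
    have yr: "y i \<in> {0..<int r}" "x i \<in> {0..<int r}" if "i \<in> N" for i using y(2) gx(2) that by auto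
    let ?x = "\<lambda>i\<in>N. (y (\<sigma> i) + (\<lambda>i\<in>N. (- y i) mod int r) i) mod int r"
    have "h \<otimes>\<^bsub>W\<^esub> wr_bar r n h = g \<longleftrightarrow> ?x = x \<and> \<sigma> \<circ> \<sigma> = \<pi>"
      unfolding y(1) W_bar[OF yW] wreath_mult[OF y(3)] gx(1) by simp
    also have "?x = x \<longleftrightarrow> (\<forall>i\<in>N. y (\<sigma> i) = (y i + x i) mod int r)"
    proof -
      have "?x = x \<longleftrightarrow> (\<forall>i\<in>N. ?x i = x i)"
        using gx(2) by (auto simp: fun_eq_iff PiE_def extensional_def)
      also have "\<dots> \<longleftrightarrow> (\<forall>i\<in>N. y (\<sigma> i) = (y i + x i) mod int r)"
      proof (rule ball_cong[OF refl])
        fix i assume i: "i \<in> N"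
        have "?x i = (y (\<sigma> i) - y i) mod int r"
          unfolding restrict_apply'[OF i] by (simp add: mod_add_right_eq)
        moreover have "(y (\<sigma> i) - y i) mod int r = x i \<longleftrightarrow> [y (\<sigma> i) - y i = x i] (mod int r)"
          using yr[OF i] by (simp add: cong_def)
        moreover have "\<dots> \<longleftrightarrow> [y (\<sigma> i) = y i + x i] (mod int r)"
          by (simp add: cong_iff_dvd_diff algebra_simps)
        moreover have "\<dots> \<longleftrightarrow> y (\<sigma> i) = (y i + x i) mod int r"
          using yr(1)[of "\<sigma> i"] i \<sigma>N by (simp add: cong_def)
        ultimately show "?x i = x i \<longleftrightarrow> y (\<sigma> i) = (y i + x i) mod int r" by simp
      qed
      finally show ?thesis .
    qed
    also have "\<sigma> \<circ> \<sigma> = \<pi> \<longleftrightarrow> (\<forall>i\<in>N. \<sigma> (\<sigma> i) = \<pi> i)"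
    proof
      assume a: "\<forall>i\<in>N. \<sigma> (\<sigma> i) = \<pi> i"
      show "\<sigma> \<circ> \<sigma> = \<pi>"
      proof
        fix i
        show "(\<sigma> \<circ> \<sigma>) i = \<pi> i"
          using a permutes_not_in[OF y(3), of i] permutes_not_in[OF \<pi>, of i] by (cases "i \<in> N") auto
      qed
    qed auto
    finally show "h \<otimes>\<^bsub>W\<^esub> wr_bar r n h = g \<longleftrightarrow> conf h \<in> cp.config cp.root_pred N"
      unfolding cp.config_def cp.root_pred_def using confW[OF yW] \<sigma>N y(1) by (auto simp: conf_i)
  qed (use inj_root in \<open>auto simp: cp.config_def\<close>)
  have "(\<Sum>\<omega>\<in>fixed g. sign_rn r n g \<omega>) = (\<Sum>\<omega>\<in>fixed g. of_int (\<Prod>i\<in>N. cp.sg i (conf \<omega> i)))"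
  proof (rule sum.cong[OF refl])
    fix \<omega> assume "\<omega> \<in> fixed g"
    then have "is_sym \<omega>" by (simp add: fixed_def)
    then obtain w \<iota> where w: "\<omega> = (w, \<iota>)" "(w, \<iota>) \<in> carrier W" "\<And>i. i \<in> N \<Longrightarrow> w i \<in> {0..<int r}" "\<iota> permutes N" "\<And>i. i \<in> N \<Longrightarrow> \<iota> i \<in> N"
      "\<And>i. i \<in> N \<Longrightarrow> \<iota> (\<iota> i) = i" using is_sym_cases by metis
    have P: "(\<Prod>i\<in>N. cp.sg i (conf \<omega> i)) = ps \<pi> \<iota> * cs x w \<iota>"
      unfolding ps_def cs_def prod.distrib[symmetric] by (intro prod.cong refl) (simp only: w(1) conf_i cp.sg_def fst_conv snd_conv)
    show "sign_rn r n g \<omega> = of_int (\<Prod>i\<in>N. cp.sg i (conf \<omega> i))"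
      unfolding P unfolding gx(1) w(1) by (subst sign_eq_ps_cs[OF w(3,5,6)], assumption+, rule arg_cong[OF mult.commute])
  qed
  also have "\<dots> = of_int (\<Sum>\<omega>\<in>fixed g. \<Prod>i\<in>N. cp.sg i (conf \<omega> i))" by (simp only: of_int_sum)
  also have "(\<Sum>\<omega>\<in>fixed g. \<Prod>i\<in>N. cp.sg i (conf \<omega> i)) = cp.Z cp.sym_pred cp.sg N"
    unfolding cp.Z_def by (rule sum.reindex_bij_betw[OF bij])
  also have "\<dots> = cp.Z cp.root_pred (\<lambda>_ _. 1) N" by (rule cp.Z_sym_eq_Z_root[OF invN])
  also have "\<dots> = int (card (roots g))" using bij_betw_same_card[OF bij'] by (simp add: cp.Z_def)
  finally show ?thesis by simp
qed

end

lemma even_card_fixpoint_free: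
  fixes A :: "nat set"
  assumes "finite A" "\<And>i. i \<in> A \<Longrightarrow> \<iota> i \<in> A \<and> \<iota> (\<iota> i) = i \<and> \<iota> i \<noteq> i"
  shows "even (card A)"
proof -
  define L where "L = {i \<in> A. i < \<iota> i}"
  have "inj_on \<iota> L" using assms(2) by (intro inj_on_inverseI[where g = \<iota>]) (auto simp: L_def)
  then have "card (\<iota> ` L) = card L" by (rule card_image)
  moreover have "A = L \<union> \<iota> ` L"
  proof (intro Set.equalityI subsetI)
    fix i assume i: "i \<in> A"
    note ai = assms(2)[OF i]
    show "i \<in> L \<union> \<iota> ` L"
    proof (cases "i < \<iota> i")
      case True
      then show ?thesis using i by (simp add: L_def)
    next
      case False
      have "\<iota> i < \<iota> (\<iota> i)" using False ai by simp
      then have "\<iota> i \<in> L" using ai by (simp add: L_def)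
      then have "\<iota> (\<iota> i) \<in> \<iota> ` L" by (rule imageI)
      then show ?thesis using ai by simp
    qed
  next
    fix i assume "i \<in> L \<union> \<iota> ` L"
    then show "i \<in> A" using assms(2) by (auto simp: L_def)
  qed
  moreover have "L \<inter> \<iota> ` L = {}"
  proof -
    have "\<iota> i \<notin> L" if "i \<in> L" for i
      using that assms(2)[of i] by (simp add: L_def)
    then show ?thesis by blast
  qed
  moreover have "finite L" using assms(1) by (simp add: L_def)
  ultimately have "card A = card L + card L" by (simp add: card_Un_disjoint)
  then show ?thesis by simp
qed

lemma even_sum_iff_even_card_odd:
  fixes w :: "'a \<Rightarrow> int"
  assumes "finite A"
  shows "even (\<Sum>i\<in>A. w i) \<longleftrightarrow> even (card {i \<in> A. odd (w i)})"
  using assms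
proof (induction A)
  case (insert a A)
  have "{i \<in> insert a A. odd (w i)} = (if odd (w a) then insert a {i \<in> A. odd (w i)} else {i \<in> A. odd (w i)})" by auto
  then show ?case using insert by auto
qed simp

section \<open>Scalars, and the scalar r / 2\<close>

context wreath_product
begin

definition scal :: "int \<Rightarrow> wr" where "scal a = (\<lambda>i\<in>N. a mod int r, id)"

lemma scal_closed: "scal a \<in> carrier W"
  using r by (simp add: scal_def carrier_wreath permutes_id restrict_mod_PiE)

lemma colsum_scal: "[colsum (scal a) = int n * a] (mod int r)"
  by (simp add: colsum_def scal_def cong_def mod_mult_right_eq)

lemma scal_central:
  assumes "h \<in> carrier W"
  shows "scal a \<otimes>\<^bsub>W\<^esub> h = h \<otimes>\<^bsub>W\<^esub> scal a"
proof -
  obtain y \<sigma> where h: "h = (y, \<sigma>)" and \<sigma>: "\<sigma> permutes N" using assms by (rule W_cases)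
  have "\<sigma> i \<in> N" if "i \<in> N" for i using permutes_in_image[OF \<sigma>] that by simp
  then have "(\<lambda>i\<in>N. ((\<lambda>i\<in>N. a mod int r) (\<sigma> i) + y i) mod int r) = (\<lambda>i\<in>N. (y (id i) + (\<lambda>i\<in>N. a mod int r) i) mod int r)"
    by (intro restrict_ext) (simp only: restrict_apply' id_apply add.commute)
  then show ?thesis unfolding h scal_def wreath_mult[OF \<sigma>] wreath_mult[OF permutes_id] by (simp only: id_comp comp_id)
qed

lemma bar_scal: "wr_bar r n (scal a) = inv\<^bsub>W\<^esub> (scal a)"
  unfolding scal_def W_bar[OF scal_closed[unfolded scal_def]] W_inv[OF scal_closed[unfolded scal_def]] by (simp only: inv_id id_apply)

text \<open>A scalar is central and its bar is its inverse, so both cancel in the product of an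
  element with its bar.\<close>

lemma roots_scal:
  assumes "h \<in> roots g"
  shows "scal a \<otimes>\<^bsub>W\<^esub> h \<in> roots g"
proof -
  have h: "h \<in> carrier W" "h \<otimes>\<^bsub>W\<^esub> wr_bar r n h = g" using assms by (auto simp: roots_def)
  note z = scal_closed[of a]
  have b: "wr_bar r n (scal a \<otimes>\<^bsub>W\<^esub> h) = inv\<^bsub>W\<^esub> (scal a) \<otimes>\<^bsub>W\<^esub> wr_bar r n h"
    by (simp only: bar_mult[OF z h(1)] bar_scal)
  have "scal a \<otimes>\<^bsub>W\<^esub> h \<otimes>\<^bsub>W\<^esub> wr_bar r n (scal a \<otimes>\<^bsub>W\<^esub> h) =
      h \<otimes>\<^bsub>W\<^esub> scal a \<otimes>\<^bsub>W\<^esub> (inv\<^bsub>W\<^esub> (scal a) \<otimes>\<^bsub>W\<^esub> wr_bar r n h)"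
    unfolding b unfolding scal_central[OF h(1)] ..
  also have "\<dots> = h \<otimes>\<^bsub>W\<^esub> (scal a \<otimes>\<^bsub>W\<^esub> inv\<^bsub>W\<^esub> (scal a) \<otimes>\<^bsub>W\<^esub> wr_bar r n h)"
    using z h(1) bar_closed[OF h(1)] by (simp only: W.m_assoc W.inv_closed W.m_closed)
  also have "\<dots> = g" using z h bar_closed[OF h(1)] by (simp only: W.r_inv W.l_one)
  finally show ?thesis using z h(1) by (simp add: roots_def)
qed

lemma bij_betw_roots_scal: "bij_betw (\<lambda>h. scal a \<otimes>\<^bsub>W\<^esub> h) (roots g) (roots g)"
proof (rule bij_betw_byWitness[where f' = "\<lambda>h. scal (- a) \<otimes>\<^bsub>W\<^esub> h"])
  have "scal a \<otimes>\<^bsub>W\<^esub> (scal b \<otimes>\<^bsub>W\<^esub> h) = h" if "h \<in> roots g" "a + b = 0" for a b h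
  proof -
    have h: "h \<in> carrier W" using that(1) by (simp add: roots_def)
    have "scal a \<otimes>\<^bsub>W\<^esub> scal b = \<one>\<^bsub>W\<^esub>"
      unfolding scal_def wreath_mult[OF permutes_id] wreath_one
      by (intro prod_eqI) (auto simp: mod_add_eq that(2) intro!: restrict_ext)
    then show ?thesis using W.m_assoc[OF scal_closed scal_closed h, of a b] h by simp
  qed
  then show "\<forall>h\<in>roots g. scal (- a) \<otimes>\<^bsub>W\<^esub> (scal a \<otimes>\<^bsub>W\<^esub> h) = h" "\<forall>h\<in>roots g. scal a \<otimes>\<^bsub>W\<^esub> (scal (- a) \<otimes>\<^bsub>W\<^esub> h) = h"
    by simp_all
qed (blast intro: roots_scal)+

text \<open>Expanding the sign of \<open>g z = z g\<close> at \<omega> in both orders leaves the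
  sign of \<open>z\<close> as a common nonzero factor, because \<open>g\<close> fixes
  \<omega>.\<close>

lemma twist_central:
  assumes "z \<in> carrier W" "\<And>h. h \<in> carrier W \<Longrightarrow> z \<otimes>\<^bsub>W\<^esub> h = h \<otimes>\<^bsub>W\<^esub> z" "\<omega> \<in> fixed g" "g \<in> carrier W"
  shows "wr_twist r n z \<omega> \<in> fixed g" "sign_rn r n g (wr_twist r n z \<omega>) = sign_rn r n g \<omega>"
proof -
  have \<omega>: "\<omega> \<in> carrier W" "is_sym \<omega>" "wr_twist r n g \<omega> = \<omega>" using assms(3) by (auto simp: fixed_def)
  have "wr_twist r n g (wr_twist r n z \<omega>) = wr_twist r n z (wr_twist r n g \<omega>)"
    using twist_mult[OF assms(4,1) \<omega>(1)] twist_mult[OF assms(1,4) \<omega>(1)] assms(2)[OF assms(4)] by simp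
  then show "wr_twist r n z \<omega> \<in> fixed g"
    using \<omega> is_sym_twist[OF assms(1) \<omega>(2)] twist_closed[OF assms(1) \<omega>(1)] by (simp add: fixed_def)
  have "sign_rn r n g (wr_twist r n z \<omega>) * sign_rn r n z \<omega> = sign_rn r n z \<omega> * sign_rn r n g \<omega>"
    using sign_cocycle[OF assms(4,1) \<omega>(2)] sign_cocycle[OF assms(1,4) \<omega>(2)] assms(2)[OF assms(4)] \<omega>(3) by simp
  moreover have "sign_rn r n z \<omega> \<noteq> 0" by (simp add: sign_rn_def)
  ultimately show "sign_rn r n g (wr_twist r n z \<omega>) = sign_rn r n g \<omega>" by simp
qed

lemma finite_fixed: "finite (fixed g)" and finite_roots: "finite (roots g)"
  using finite_W by (simp_all add: fixed_def roots_def)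

lemma bij_betw_fixed_scal:
  assumes "g \<in> carrier W"
  shows "bij_betw (wr_twist r n (scal a)) (fixed g) (fixed g)"
proof -
  have inj: "inj_on (wr_twist r n (scal a)) (fixed g)"
  proof (rule inj_on_inverseI)
    fix \<omega> assume "\<omega> \<in> fixed g"
    then have "\<omega> \<in> carrier W" by (simp add: fixed_def)
    then show "wr_twist r n (inv\<^bsub>W\<^esub> (scal a)) (wr_twist r n (scal a) \<omega>) = \<omega>"
      using twist_mult[of "inv\<^bsub>W\<^esub> (scal a)" "scal a" \<omega>] scal_closed by (simp add: twist_one)
  qed
  moreover have "wr_twist r n (scal a) ` fixed g \<subseteq> fixed g"
    using twist_central(1)[OF scal_closed scal_central] assms by blast
  ultimately show ?thesis using endo_inj_surj[OF finite_fixed] by (simp add: bij_betw_def)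
qed

definition half :: wr where "half = scal (int r div 2)"

lemma half_closed: "half \<in> carrier W" by (simp add: half_def scal_closed)

lemma half_half: "even r \<Longrightarrow> half \<otimes>\<^bsub>W\<^esub> half = \<one>\<^bsub>W\<^esub>"
  unfolding half_def scal_def wreath_mult[OF permutes_id] wreath_one
  by (intro prod_eqI) (auto simp: mod_add_eq intro!: restrict_ext)

lemma half_neq_one: "even r \<Longrightarrow> n > 0 \<Longrightarrow> half \<noteq> \<one>\<^bsub>W\<^esub>"
proof
  assume "even r" "n > 0" "half = \<one>\<^bsub>W\<^esub>"
  then have "(\<lambda>i\<in>N. (int r div 2) mod int r) 1 = (\<lambda>i\<in>N. 0) 1" by (simp add: half_def scal_def wreath_one)
  then have "(int r div 2) mod int r = 0" using \<open>n > 0\<close> by simp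
  moreover have "(int r div 2) mod int r = int r div 2" using r by (intro mod_pos_pos_trivial) auto
  ultimately show False using \<open>even r\<close> r by auto
qed

text \<open>Twisting adds the scalar colour twice, and twice \<open>r / 2\<close> is 0 modulo
  \<open>r\<close>.\<close>

lemma twist_half:
  assumes "even r" "\<omega> \<in> carrier W"
  shows "wr_twist r n half \<omega> = \<omega>"
proof -
  obtain w \<iota> where w: "\<omega> = (w, \<iota>)" "w \<in> N \<rightarrow>\<^sub>E {0..<int r}" "\<iota> permutes N" using assms(2) by (rule W_cases)
  have wW: "(w, \<iota>) \<in> carrier W" using w assms by simp
  let ?h = "\<lambda>i\<in>N. (int r div 2) mod int r"
  have "(\<lambda>j\<in>N. (w (inv' id j) + ?h (inv' id j) + ?h (\<iota> (inv' id j))) mod int r) = w"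
  proof (rule PiE_int_eqI[OF restrict_mod_PiE[OF r] w(2)])
    fix i assume i: "i \<in> N"
    then have \<iota>i: "\<iota> i \<in> N" using permutes_in_image[OF w(3)] by simp
    have "(w i + (int r div 2) mod int r + (int r div 2) mod int r) mod int r = (w i + (int r div 2 + int r div 2)) mod int r"
      by (metis add.assoc mod_add_left_eq mod_add_right_eq)
    also have "int r div 2 + int r div 2 = int r" using assms(1) by simp
    finally show "(\<lambda>j\<in>N. (w (inv' id j) + ?h (inv' id j) + ?h (\<iota> (inv' id j))) mod int r) i mod int r = w i mod int r"
      using i \<iota>i by (simp add: inv_id del: One_nat_def atLeastAtMost_iff)
  qed
  then show ?thesis
    unfolding half_def scal_def w(1) twist_eq[OF scal_closed[unfolded scal_def] wW] by (simp add: inv_id)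
qed

text \<open>Adding \<open>r / 2\<close> to the half of a colour always ends in the upper half, so
  every odd colour at a fixed point counts. Odd colours at moved points come in equal pairs and do
  not change the parity of the colour sum.\<close>

lemma sign_half:
  assumes "even r" "is_sym \<omega>"
  shows "sign_rn r n half \<omega> = (if even (colsum \<omega>) then 1 else -1)"
proof -
  obtain w \<iota> where w: "\<omega> = (w, \<iota>)" "\<And>i. i \<in> N \<Longrightarrow> w i \<in> {0..<int r}" "\<And>i. i \<in> N \<Longrightarrow> \<iota> i \<in> N"
    "\<And>i. i \<in> N \<Longrightarrow> \<iota> (\<iota> i) = i" "\<And>i. i \<in> N \<Longrightarrow> w (\<iota> i) = w i" using is_sym_cases[OF assms(2)] by blast
  note [simp del] = atLeastAtMost_iff One_nat_def
  let ?h = "\<lambda>i\<in>N. (int r div 2) mod int r"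
  define F where "F = {i \<in> N. \<iota> i = i \<and> odd (w i)}"
  define M where "M = {i \<in> N. \<iota> i \<noteq> i \<and> odd (w i)}"
  have "even (card M)"
    by (rule even_card_fixpoint_free[where \<iota> = \<iota>]) (use w in \<open>auto simp: M_def\<close>)
  moreover have "{i \<in> N. odd (w i)} = F \<union> M" "F \<inter> M = {}" by (auto simp: F_def M_def)
  moreover have "finite F" "finite M" by (simp_all add: F_def M_def)
  moreover have "even (colsum \<omega>) \<longleftrightarrow> even (card {i \<in> N. odd (w i)})"
    using even_sum_iff_even_card_odd[of N w] by (simp add: colsum_def w(1))
  ultimately have par: "even (colsum \<omega>) \<longleftrightarrow> even (card F)" by (simp add: card_Un_disjoint)
  have "ps id \<iota> = 1" unfolding ps_def by (rule prod.neutral) auto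
  moreover have "cs ?h w \<iota> = (\<Prod>i\<in>N. if \<iota> i = i \<and> odd (w i) then -1 else 1)"
    unfolding cs_def
  proof (rule prod.cong[OF refl])
    fix i assume i: "i \<in> N"
    have "int r div 2 \<le> (?h i + w i div 2) mod int r"
    proof -
      have wi: "0 \<le> w i" "w i < int r" using w(2)[OF i] by auto
      have r2: "int r = 2 * (int r div 2)" using assms(1) by simp
      have "(?h i + w i div 2) mod int r = (int r div 2 + w i div 2) mod int r"
        unfolding restrict_apply'[OF i] by (rule mod_add_left_eq)
      also have "\<dots> = int r div 2 + w i div 2" using wi r2 by (intro mod_pos_pos_trivial) linarith+
      finally show ?thesis using wi by simp
    qed
    then show "(if even r \<and> \<iota> i = i \<and> odd (w i) \<and> int r div 2 \<le> (?h i + w i div 2) mod int r then -1 else 1 :: int) =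
       (if \<iota> i = i \<and> odd (w i) then -1 else 1)" using assms(1) by (simp only: simp_thms)
  qed
  moreover have "(\<Prod>i\<in>N. if \<iota> i = i \<and> odd (w i) then -1 else 1 :: int) = (-1) ^ card F"
    unfolding F_def by (rule prod_sign_card) simp
  ultimately have "cs ?h w \<iota> * ps id \<iota> = (-1) ^ card F" by simp
  moreover have "sign_rn r n (?h, id) (w, \<iota>) = of_int (cs ?h w \<iota> * ps id \<iota>)"
    by (rule sign_eq_ps_cs) (use w in auto)
  ultimately have "sign_rn r n half \<omega> = of_int ((-1) ^ card F)"
    unfolding half_def scal_def w(1) by (simp only:)
  then show ?thesis using par by simp
qed

end

section \<open>The groups G(r,p,n)\<close>

locale complex_reflection = wreath_product +
  fixes p :: nat
  assumes p: "p > 0" "p dvd r"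
begin

abbreviation Gp where "Gp \<equiv> Grpn r p n"

lemma dvd_cong: "[a = b] (mod int r) \<Longrightarrow> int p dvd a \<longleftrightarrow> int p dvd b"
  using p(2) by (meson cong_dvd_iff cong_dvd_modulus int_dvd_int_iff)

text \<open>As \<open>p\<close> divides \<open>r\<close>, divisibility by \<open>p\<close> is well
  defined on residues modulo \<open>r\<close> and can stand in for
  \<open>multiples_mod\<close>.\<close>

lemma carrier_Gp: "carrier Gp = {g \<in> carrier W. int p dvd colsum g}"
proof -
  have "D mod int r \<in> multiples_mod p r \<longleftrightarrow> int p dvd D" for D
  proof
    assume "D mod int r \<in> multiples_mod p r"
    then obtain z where "D mod int r = (int p * z) mod int r" by (auto simp: multiples_mod_def)
    then have "[D = int p * z] (mod int r)" by (simp add: cong_def)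
    then show "int p dvd D" using dvd_cong by simp
  next
    assume "int p dvd D"
    then have "int p dvd D mod int r" using p(2) by (simp add: dvd_mod_iff)
    then obtain z where z: "D mod int r = int p * z" by blast
    \<comment> \<open>\<open>multiples_mod\<close> wants the cofactor \<open>z\<close> itself to be
      a residue modulo \<open>r\<close>, which \<open>z \<le> p * z < r\<close> provides.\<close>
    have "0 \<le> int p * z" "int p * z < int r" using r unfolding z[symmetric] by auto
    then have "0 \<le> z" using p(1) by (simp add: zero_le_mult_iff)
    moreover have "z \<le> int p * z" using p(1) \<open>0 \<le> z\<close> by (simp add: mult_le_cancel_right1)
    ultimately have "z \<in> carrier (integer_mod_group r)" using \<open>int p * z < int r\<close> r by (simp add: carrier_integer_mod_group)
    moreover have "D mod int r = (int p * z) mod int r" using z by (metis mod_mod_trivial)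
    ultimately show "D mod int r \<in> multiples_mod p r" unfolding multiples_mod_def by blast
  qed
  then show ?thesis by (simp add: Grpn_def Delta_def colsum_def)
qed

lemma mult_Gp [simp]: "g \<otimes>\<^bsub>Gp\<^esub> h = g \<otimes>\<^bsub>W\<^esub> h" and one_Gp [simp]: "\<one>\<^bsub>Gp\<^esub> = \<one>\<^bsub>W\<^esub>"
  by (simp_all add: Grpn_def)

lemma subgroup_Gp: "subgroup (carrier Gp) W"
proof (rule W.subgroupI)
  show "carrier Gp \<subseteq> carrier W" by (auto simp: carrier_Gp)
  have "\<one>\<^bsub>W\<^esub> \<in> carrier Gp" by (simp add: carrier_Gp colsum_one)
  then show "carrier Gp \<noteq> {}" by blast
  show "inv\<^bsub>W\<^esub> g \<in> carrier Gp" if "g \<in> carrier Gp" for g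
    using that dvd_cong[OF colsum_inv[of g]] by (simp add: carrier_Gp)
  show "g \<otimes>\<^bsub>W\<^esub> h \<in> carrier Gp" if "g \<in> carrier Gp" "h \<in> carrier Gp" for g h
    using that dvd_cong[OF colsum_mult[of g h]] by (simp add: carrier_Gp)
qed

lemma Gp_eq: "W\<lparr>carrier := carrier Gp\<rparr> = Gp"
  by (simp add: Grpn_def)

lemma group_Gp: "group Gp"
  using subgroup.subgroup_is_group[OF subgroup_Gp W.is_group] unfolding Gp_eq .

lemma inv_Gp: "g \<in> carrier Gp \<Longrightarrow> inv\<^bsub>Gp\<^esub> g = inv\<^bsub>W\<^esub> g"
  using W.m_inv_consistent[OF subgroup_Gp] unfolding Gp_eq .

sublocale Gp: finite_group_involution Gp "wr_bar r n"
proof (intro finite_group_involution.intro finite_group.intro group_Gp finite_group_axioms.intro finite_group_involution_axioms.intro)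
  show "finite (carrier Gp)" using finite_W by (simp add: carrier_Gp)
  show "wr_bar r n g \<in> carrier Gp" if "g \<in> carrier Gp" for g
    using that bar_closed[of g] dvd_cong[OF colsum_bar[of g]] by (simp add: carrier_Gp)
  show "wr_bar r n (g \<otimes>\<^bsub>Gp\<^esub> h) = wr_bar r n g \<otimes>\<^bsub>Gp\<^esub> wr_bar r n h" if "g \<in> carrier Gp" "h \<in> carrier Gp" for g h
    using that by (simp add: carrier_Gp bar_mult)
  show "wr_bar r n (wr_bar r n g) = g" if "g \<in> carrier Gp" for g
    using that by (simp add: carrier_Gp bar_bar)
qed

lemma sym_elts_eq: "sym_elts r p n = {\<omega>. is_sym \<omega> \<and> int p dvd colsum \<omega>}"
  by (auto simp: sym_elts_def is_sym_def carrier_Gp)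

lemma
  shows rho_representation: "representation Gp (sym_elts r p n) (rho r p n)"
    and rho_character: "rep_character (sym_elts r p n) (rho r p n) g = (\<Sum>\<omega>\<in>{\<omega> \<in> fixed g. int p dvd colsum \<omega>}. sign_rn r n g \<omega>)"
proof -
  have tw: "wr_twist r n g \<omega> \<in> sym_elts r p n" if "g \<in> carrier Gp" "\<omega> \<in> sym_elts r p n" for g \<omega>
  proof -
    have g: "g \<in> carrier W" "int p dvd colsum g" and \<omega>: "is_sym \<omega>" "\<omega> \<in> carrier W" "int p dvd colsum \<omega>"
      using that by (auto simp: carrier_Gp sym_elts_eq is_sym_def)
    then show ?thesis
      using dvd_cong[OF colsum_twist[OF g(1) \<omega>(2)]] is_sym_twist[OF g(1) \<omega>(1)] by (simp add: sym_elts_eq)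
  qed
  have rho_eq: "rho r p n = (\<lambda>g. \<lambda>v\<in>coord_space (sym_elts r p n). \<lambda>\<tau>. \<Sum>\<omega>\<in>sym_elts r p n. v \<omega> * (sign_rn r n g \<omega> * unit_vec_at (wr_twist r n g \<omega>) \<tau>))"
    by (intro ext) (simp only: rho_def)
  have W: "\<omega> \<in> carrier W" "is_sym \<omega>" if "\<omega> \<in> sym_elts r p n" for \<omega> using that by (auto simp: sym_elts_eq is_sym_def)
  have GW: "g \<in> carrier W" if "g \<in> carrier Gp" for g using that by (simp add: carrier_Gp)
  show "representation Gp (sym_elts r p n) (rho r p n)"
    unfolding rho_eq
    by (rule signed_action_representation[OF group_Gp finite_sym_elts[OF r] tw])
      (simp_all add: W GW twist_mult twist_one sign_cocycle sign_one)
  have "rep_character (sym_elts r p n) (rho r p n) g = (\<Sum>\<omega>\<in>{\<omega> \<in> sym_elts r p n. wr_twist r n g \<omega> = \<omega>}. sign_rn r n g \<omega>)"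
    unfolding rho_eq
    by (rule signed_action_character[OF group_Gp finite_sym_elts[OF r] tw])
      (simp_all add: W GW twist_mult twist_one sign_cocycle sign_one)
  also have "{\<omega> \<in> sym_elts r p n. wr_twist r n g \<omega> = \<omega>} = {\<omega> \<in> fixed g. int p dvd colsum \<omega>}"
    by (auto simp: sym_elts_eq fixed_def is_sym_def)
  finally show "rep_character (sym_elts r p n) (rho r p n) g = (\<Sum>\<omega>\<in>{\<omega> \<in> fixed g. int p dvd colsum \<omega>}. sign_rn r n g \<omega>)" .
qed

end

section \<open>Conjugacy of bar and inverse; roots of the identity\<close>

context wreath_product
begin

text \<open>A configuration for \<open>conj_pred\<close> is a solution \<open>h\<close> of the
  equation, multiplied out and read at \<open>\<pi> i\<close>.\<close>

lemma conj_transpose: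
  assumes g: "g \<in> carrier W"
  shows "\<exists>h\<in>carrier W. g \<otimes>\<^bsub>W\<^esub> h = h \<otimes>\<^bsub>W\<^esub> wr_transpose r n g"
proof -
  obtain x \<pi> where gx: "g = (x, \<pi>)" and \<pi>: "\<pi> permutes N" using g by (rule W_cases)
  have gW: "(x, \<pi>) \<in> carrier W" using g gx by simp
  interpret cp: colored_perm N \<pi> r x by unfold_locales (use \<pi> r in auto)
  note [simp del] = atLeastAtMost_iff One_nat_def
  have \<pi>N: "inv' \<pi> (\<pi> i) = i" "\<pi> (inv' \<pi> i) = i" "inv' \<pi> i \<in> N \<longleftrightarrow> i \<in> N" for i
    using permutes_inverses[OF \<pi>] permutes_inv_mem[OF \<pi>] by auto
  have "cp.inv_set N" using permutes_image[OF \<pi>] by (simp add: cp.inv_set_def)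
  then obtain f where f: "f \<in> cp.config cp.conj_pred N" using cp.conj_config_nonempty by blast
  note cf = cp.config_mem(3)[OF f, unfolded cp.conj_pred_def]
  have "inj_on (\<lambda>i. fst (f i)) N"
    by (rule inj_on_inverseI[where g = "\<lambda>i. fst (f i)"]) (use cf in blast)
  moreover have "f \<in> N \<rightarrow>\<^sub>E N \<times> {0..<int r}" using f by (simp add: cp.config_def)
  ultimately have "f \<in> conf ` carrier W" using bij_betw_imp_surj_on[OF bij_betw_conf] by simp
  then obtain h where h: "h \<in> carrier W" "f = conf h" by blast
  obtain t \<theta> where th: "h = (t, \<theta>)" and \<theta>: "\<theta> permutes N" using h(1) by (rule W_cases)
  have fi: "f i = (\<theta> i, t i)" if "i \<in> N" for i using that by (simp add: h(2) conf_def th)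
  have \<theta>N: "\<theta> i \<in> N \<longleftrightarrow> i \<in> N" "\<pi> i \<in> N \<longleftrightarrow> i \<in> N" for i
    using permutes_in_image[OF \<theta>] permutes_in_image[OF \<pi>] by auto
  have c: "\<pi> (\<theta> (\<pi> i)) = \<theta> i" "t (\<pi> i) = (t i + x i - x (\<theta> (\<pi> i))) mod int r" if "i \<in> N" for i
    using cf[OF that] that by (simp_all add: fi \<theta>N)
  have 1: "(\<lambda>i\<in>N. (x (\<theta> i) + t i) mod int r) = (\<lambda>i\<in>N. (t (inv' \<pi> i) + (\<lambda>i\<in>N. x (inv' \<pi> i)) i) mod int r)"
  proof (rule restrict_ext)
    fix i assume i: "i \<in> N"
    define j where "j = inv' \<pi> i"
    have j: "j \<in> N" "i = \<pi> j" using i by (simp_all add: j_def \<pi>N)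
    have "(x (\<theta> i) + t i) mod int r = (x (\<theta> (\<pi> j)) + (t j + x j - x (\<theta> (\<pi> j)))) mod int r"
      unfolding j(2) c(2)[OF j(1)] by (rule mod_add_right_eq)
    then show "(x (\<theta> i) + t i) mod int r = (t (inv' \<pi> i) + (\<lambda>i\<in>N. x (inv' \<pi> i)) i) mod int r"
      unfolding restrict_apply'[OF i] j_def[symmetric] by simp
  qed
  have 2: "\<pi> \<circ> \<theta> = \<theta> \<circ> inv' \<pi>"
  proof
    fix i
    show "(\<pi> \<circ> \<theta>) i = (\<theta> \<circ> inv' \<pi>) i"
    proof (cases "i \<in> N")
      case True
      then show ?thesis using c(1)[of "inv' \<pi> i"] by (simp add: \<pi>N)
    next
      case False
      then show ?thesis
        using permutes_not_in[OF \<theta>] permutes_not_in[OF \<pi>] permutes_not_in[OF permutes_inv[OF \<pi>]] by simp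
    qed
  qed
  have "g \<otimes>\<^bsub>W\<^esub> h = h \<otimes>\<^bsub>W\<^esub> wr_transpose r n g"
    unfolding gx th W_transpose[OF gW] wreath_mult[OF \<theta>] wreath_mult[OF permutes_inv[OF \<pi>]] 1 2 ..
  then show ?thesis using h(1) by blast
qed

text \<open>Apply the bar to the equation of \<open>conj_transpose\<close>: the bar of the transpose
  is the inverse.\<close>

lemma conj_bar:
  assumes g: "g \<in> carrier W"
  shows "\<exists>h\<in>carrier W. wr_bar r n g \<otimes>\<^bsub>W\<^esub> h = h \<otimes>\<^bsub>W\<^esub> inv\<^bsub>W\<^esub> g"
proof -
  obtain h where h: "h \<in> carrier W" "g \<otimes>\<^bsub>W\<^esub> h = h \<otimes>\<^bsub>W\<^esub> wr_transpose r n g"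
    using conj_transpose[OF g] by blast
  have "wr_bar r n (g \<otimes>\<^bsub>W\<^esub> h) = wr_bar r n (h \<otimes>\<^bsub>W\<^esub> wr_transpose r n g)" using h(2) by simp
  then have "wr_bar r n g \<otimes>\<^bsub>W\<^esub> wr_bar r n h = wr_bar r n h \<otimes>\<^bsub>W\<^esub> inv\<^bsub>W\<^esub> g"
    using g h(1) by (simp add: bar_mult transpose_closed) (simp add: wr_transpose_def bar_bar)
  then show ?thesis using bar_closed[OF h(1)] by blast
qed

lemma fixed_one: "fixed \<one>\<^bsub>W\<^esub> = {\<omega> \<in> carrier W. is_sym \<omega>}"
  by (auto simp: fixed_def twist_one)

text \<open>An element times its bar is trivial iff the element is the inverse of its bar, that is
  its transpose. So the dimension of the model is the number of twisted roots of the identity for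
  all \<open>p\<close> and \<open>n\<close>.\<close>

lemma roots_one: "roots \<one>\<^bsub>W\<^esub> = {\<omega> \<in> carrier W. is_sym \<omega>}"
proof -
  have "h \<otimes>\<^bsub>W\<^esub> wr_bar r n h = \<one>\<^bsub>W\<^esub> \<longleftrightarrow> wr_transpose r n h = h" if h: "h \<in> carrier W" for h
  proof
    assume "h \<otimes>\<^bsub>W\<^esub> wr_bar r n h = \<one>\<^bsub>W\<^esub>"
    then have "inv\<^bsub>W\<^esub> (wr_bar r n h) = h" using h bar_closed[OF h] by (intro W.inv_equality) auto
    then show "wr_transpose r n h = h" using h by (simp add: wr_transpose_def bar_inv)
  next
    assume "wr_transpose r n h = h"
    then have "h = inv\<^bsub>W\<^esub> (wr_bar r n h)" using h by (simp add: wr_transpose_def bar_inv)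
    then have "h \<otimes>\<^bsub>W\<^esub> wr_bar r n h = inv\<^bsub>W\<^esub> (wr_bar r n h) \<otimes>\<^bsub>W\<^esub> wr_bar r n h" by (rule arg_cong)
    then show "h \<otimes>\<^bsub>W\<^esub> wr_bar r n h = \<one>\<^bsub>W\<^esub>" using bar_closed[OF h] by (simp only: W.l_inv)
  qed
  then show ?thesis unfolding roots_def is_sym_def by blast
qed

text \<open>Colour sums add up and bar negates them. This obstruction will show that certain
  elements have no roots at all.\<close>

lemma colsum_root: "h \<in> roots g \<Longrightarrow> int r dvd colsum g"
proof -
  assume "h \<in> roots g"
  then have h: "h \<in> carrier W" "h \<otimes>\<^bsub>W\<^esub> wr_bar r n h = g" by (auto simp: roots_def)
  have "[colsum g = colsum h + colsum (wr_bar r n h)] (mod int r)"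
    using colsum_mult[OF h(1) bar_closed[OF h(1)]] h(2) by simp
  moreover have "[colsum h + colsum (wr_bar r n h) = colsum h + - colsum h] (mod int r)"
    by (rule cong_add[OF cong_refl colsum_bar[OF h(1)]])
  ultimately have "[colsum g = colsum h + - colsum h] (mod int r)" by (rule cong_trans)
  then show ?thesis by (simp add: cong_0_iff)
qed

end

section \<open>Descent to G(r,p,n) and the two directions of the theorem\<close>

context complex_reflection
begin

lemma twisted_roots_eq: "Gp.twisted_roots g = {h \<in> roots g. int p dvd colsum h}"
  by (auto simp: Gp.twisted_roots_def roots_def carrier_Gp)

text \<open>Multiplying a root by the scalar \<open>a\<close> shifts its colour sum by
  \<open>n * a\<close>; twisting a symmetric element by it shifts the sum by
  \<open>2 * n * a\<close>. As \<open>n\<close> is invertible modulo \<open>p\<close>, the first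
  reaches every class modulo \<open>p\<close> equally often. The second does so only for odd
  \<open>p\<close>; for even \<open>p\<close> it stays within a parity class.\<close>

lemma sum_sign_Gp:
  assumes cop: "coprime p n" and par: "odd p \<or> odd (r div p)" and g: "g \<in> carrier Gp"
  shows "(\<Sum>\<omega>\<in>{\<omega> \<in> fixed g. int p dvd colsum \<omega>}. sign_rn r n g \<omega>) = of_nat (card {h \<in> roots g. int p dvd colsum h})"
    (is "?F = of_nat (card ?H)")
proof -
  have gW: "g \<in> carrier W" and pg: "int p dvd colsum g" using g by (auto simp: carrier_Gp)
  have cop': "coprime (int n) (int p)" using cop by (simp add: coprime_commute)
  have mod_p: "[a = b] (mod int p)" if "[a = b] (mod int r)" for a b
    using that p(2) by (meson cong_dvd_modulus int_dvd_int_iff)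
  have "of_nat p * (\<Sum>h\<in>?H. 1) = (\<Sum>h\<in>roots g. 1 * of_nat (card {a \<in> {..<p}. int p dvd colsum h + int n * int a}) :: rat)"
  proof (rule sum_translates[where t = "\<lambda>a h. scal (int a) \<otimes>\<^bsub>W\<^esub> h"])
    show "finite (roots g)" by (rule finite_roots)
    show "bij_betw (\<lambda>h. scal (int a) \<otimes>\<^bsub>W\<^esub> h) (roots g) (roots g)" for a by (rule bij_betw_roots_scal)
    show "[colsum (scal (int a) \<otimes>\<^bsub>W\<^esub> h) = colsum h + int n * int a] (mod int p)" if "h \<in> roots g" for a h
    proof (rule mod_p)
      have "h \<in> carrier W" using that by (simp add: roots_def)
      then have "[colsum (scal (int a) \<otimes>\<^bsub>W\<^esub> h) = colsum (scal (int a)) + colsum h] (mod int r)"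
        by (rule colsum_mult[OF scal_closed])
      also have "[colsum (scal (int a)) + colsum h = int n * int a + colsum h] (mod int r)"
        by (rule cong_add[OF colsum_scal cong_refl])
      finally show "[colsum (scal (int a) \<otimes>\<^bsub>W\<^esub> h) = colsum h + int n * int a] (mod int r)" by (simp only: add.commute)
    qed
  qed simp
  then have rootsum: "of_nat p * of_nat (card ?H) = (of_nat (card (roots g)) :: rat)"
    by (simp only: coprime_unique_solution[OF cop' p(1)] of_nat_1 mult_1 sum_constant mult_1_right)
  have fixsum: "of_nat q * ?F = (\<Sum>\<omega>\<in>fixed g. sign_rn r n g \<omega> * of_nat (card {a \<in> {..<q}. int p dvd colsum \<omega> + 2 * int n * int a}))" for q
  proof (rule sum_translates[where t = "\<lambda>a. wr_twist r n (scal (int a))"])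
    show "finite (fixed g)" by (rule finite_fixed)
    show "bij_betw (wr_twist r n (scal (int a))) (fixed g) (fixed g)" for a by (rule bij_betw_fixed_scal[OF gW])
    show "sign_rn r n g (wr_twist r n (scal (int a)) \<omega>) = sign_rn r n g \<omega>" if "\<omega> \<in> fixed g" for a \<omega>
      by (rule twist_central(2)[OF scal_closed scal_central that gW])
    show "[colsum (wr_twist r n (scal (int a)) \<omega>) = colsum \<omega> + 2 * int n * int a] (mod int p)" if "\<omega> \<in> fixed g" for a \<omega>
    proof (rule mod_p)
      have "\<omega> \<in> carrier W" using that by (simp add: fixed_def)
      then have "[colsum (wr_twist r n (scal (int a)) \<omega>) = colsum \<omega> + 2 * colsum (scal (int a))] (mod int r)"
        by (rule colsum_twist[OF scal_closed])
      also have "[colsum \<omega> + 2 * colsum (scal (int a)) = colsum \<omega> + 2 * (int n * int a)] (mod int r)"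
        by (intro cong_add cong_mult cong_refl colsum_scal)
      finally show "[colsum (wr_twist r n (scal (int a)) \<omega>) = colsum \<omega> + 2 * int n * int a] (mod int r)"
        by (simp only: mult.assoc)
    qed
  qed
  have "of_nat p * ?F = (of_nat (card (roots g)) :: rat)"
  proof (cases "even p")
    case False
    have "coprime (2 * int n) (int p)" using False cop' by simp
    then have "of_nat p * ?F = (\<Sum>\<omega>\<in>fixed g. sign_rn r n g \<omega>)"
      unfolding fixsum by (simp only: coprime_unique_solution p(1) of_nat_1 mult_1_right)
    then show ?thesis using sum_sign_fixed[OF gW] by simp
  next
    case True
    then obtain q where q: "p = 2 * q" by (rule evenE)
    have "odd (r div p)" using True par by blast
    have "odd n" using cop True by auto
    have q0: "q > 0" using p(1) q by simp
    have copq: "coprime (int n) (int q)" using cop' unfolding q by simp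
    have er: "even r" using True p(2) by (rule dvd_trans)
    define S where "S \<omega> = (if even (colsum \<omega>) then 1 else -1 :: rat)" for \<omega>
    \<comment> \<open>With \<open>p = 2 * q\<close>, the shifts \<open>2 * n * a\<close> have period
      \<open>q\<close> in \<open>a\<close>: an even sum meets a multiple of \<open>p\<close> exactly
      once among \<open>q\<close> translates, an odd sum never.\<close>
    have cnt: "of_nat (card {a \<in> {..<q}. int p dvd D + 2 * int n * int a}) = (if even D then 1 else 0 :: rat)" for D
    proof (cases "even D")
      case True
      then obtain E where E: "D = 2 * E" by (rule evenE)
      have "int p dvd D + 2 * int n * int a \<longleftrightarrow> int q dvd E + int n * int a" for a
      proof -
        have "D + 2 * int n * int a = 2 * (E + int n * int a)" "int p = 2 * int q" using E q by simp_all
        then show ?thesis by (simp only: dvd_times_left_cancel_iff[of 2] zero_neq_numeral not_False_eq_True)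
      qed
      then show ?thesis using True coprime_unique_solution[OF copq q0, of E] by simp
    next
      case False
      have "\<not> int p dvd D + 2 * int n * int a" for a
      proof
        assume "int p dvd D + 2 * int n * int a"
        then have "2 dvd D + 2 * int n * int a" using q by (metis dvd_trans dvd_triv_left int_dvd_int_iff of_nat_numeral)
        then show False using False by simp
      qed
      then show ?thesis using False by simp
    qed
    \<comment> \<open>The sign of \<open>half\<close> is the parity of the colour sum, so the signed
      sum at \<open>half\<close> times \<open>g\<close> is the even part minus the odd part of the
      sum at \<open>g\<close>. It will vanish because that element has no roots, so the two parts
      are equal.\<close>
    have hg: "half \<otimes>\<^bsub>W\<^esub> g \<in> carrier W" using half_closed gW by (rule W.m_closed)
    have "wr_twist r n (half \<otimes>\<^bsub>W\<^esub> g) \<omega> = wr_twist r n g \<omega>" if "\<omega> \<in> carrier W" for \<omega>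
      using twist_mult[OF half_closed gW that] twist_half[OF er twist_closed[OF gW that]] by simp
    then have "fixed (half \<otimes>\<^bsub>W\<^esub> g) = fixed g"
      unfolding fixed_def by (intro Collect_cong) (simp cong: conj_cong)
    then have "(\<Sum>\<omega>\<in>fixed g. sign_rn r n (half \<otimes>\<^bsub>W\<^esub> g) \<omega>) = of_nat (card (roots (half \<otimes>\<^bsub>W\<^esub> g)))"
      using sum_sign_fixed[OF hg] by simp
    also have "roots (half \<otimes>\<^bsub>W\<^esub> g) = {}"
    proof (rule ccontr)
      assume "roots (half \<otimes>\<^bsub>W\<^esub> g) \<noteq> {}"
      then obtain h where "h \<in> roots (half \<otimes>\<^bsub>W\<^esub> g)" by blast
      then have "int r dvd colsum (half \<otimes>\<^bsub>W\<^esub> g)" by (rule colsum_root)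
      then have "int p dvd colsum (half \<otimes>\<^bsub>W\<^esub> g)" using p(2) by (meson dvd_trans int_dvd_int_iff)
      then have "int p dvd colsum half + colsum g" using dvd_cong[OF colsum_mult[OF half_closed gW]] by blast
      then have "int p dvd colsum half" using pg by (simp add: dvd_add_left_iff)
      \<comment> \<open>\<open>n\<close> and \<open>r / p\<close> are odd, so
        \<open>n * (r / 2)\<close> is an odd multiple of \<open>q\<close> and cannot be divisible by
        \<open>2 * q\<close>.\<close>
      then have "int p dvd int n * (int r div 2)" using dvd_cong[OF colsum_scal[of "int r div 2"]] by (simp add: half_def)
      moreover have "r = p * (r div p)" using p(2) by simp
      then have "int r div 2 = int q * int (r div p)" unfolding q by (metis mult.assoc nonzero_mult_div_cancel_left of_nat_mult of_nat_numeral zero_neq_numeral)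
      ultimately have "2 * int q dvd int q * (int n * int (r div p))" unfolding q by (simp add: mult_ac)
      then have "int q * 2 dvd int q * (int n * int (r div p))" by (simp only: mult.commute)
      then have "2 dvd int n * int (r div p)" using q0 by (simp only: dvd_times_left_cancel_iff[of "int q"] of_nat_0_eq_iff)
      then show False using \<open>odd n\<close> \<open>odd (r div p)\<close> by simp
    qed
    finally have 0: "(\<Sum>\<omega>\<in>fixed g. sign_rn r n (half \<otimes>\<^bsub>W\<^esub> g) \<omega>) = 0" by simp
    have "sign_rn r n (half \<otimes>\<^bsub>W\<^esub> g) \<omega> = S \<omega> * sign_rn r n g \<omega>" if "\<omega> \<in> fixed g" for \<omega>
    proof -
      have "is_sym \<omega>" "wr_twist r n g \<omega> = \<omega>" using that by (auto simp: fixed_def)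
      then show ?thesis using sign_cocycle[OF half_closed gW] sign_half[OF er] by (simp add: S_def)
    qed
    then have 1: "(\<Sum>\<omega>\<in>fixed g. S \<omega> * sign_rn r n g \<omega>) = 0" using 0 by simp
    \<comment> \<open>Half of \<open>S \<omega> + 1\<close> is the indicator of an even colour
      sum.\<close>
    have "of_nat q * ?F = (\<Sum>\<omega>\<in>fixed g. (1 / 2) * (S \<omega> * sign_rn r n g \<omega> + sign_rn r n g \<omega>))"
      unfolding fixsum cnt by (intro sum.cong) (auto simp: S_def)
    also have "\<dots> = (1 / 2) * (\<Sum>\<omega>\<in>fixed g. sign_rn r n g \<omega>)"
      unfolding sum_distrib_left[symmetric] sum.distrib 1 by simp
    finally show ?thesis using sum_sign_fixed[OF gW] unfolding q by simp
  qed
  then have "of_nat p * ?F = of_nat p * of_nat (card ?H)" using rootsum by simp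
  then show ?thesis using p(1) by simp
qed

text \<open>A conjugator in the full group is corrected by a scalar. Being central, it leaves the
  conjugation unchanged, and as \<open>n\<close> is invertible modulo \<open>p\<close> it can make
  the colour sum divisible by \<open>p\<close>.\<close>

lemma conj_Gp:
  assumes cop: "coprime p n" and g: "g \<in> carrier Gp"
  shows "\<exists>k\<in>carrier Gp. wr_bar r n g = k \<otimes>\<^bsub>Gp\<^esub> inv\<^bsub>Gp\<^esub> g \<otimes>\<^bsub>Gp\<^esub> inv\<^bsub>Gp\<^esub> k"
proof -
  have gW: "g \<in> carrier W" using g by (simp add: carrier_Gp)
  obtain h where h: "h \<in> carrier W" "wr_bar r n g \<otimes>\<^bsub>W\<^esub> h = h \<otimes>\<^bsub>W\<^esub> inv\<^bsub>W\<^esub> g" using conj_bar[OF gW] by blast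
  have "coprime (int n) (int p)" using cop by (simp add: coprime_commute)
  then obtain a where a: "int p dvd colsum h + int n * int a" using coprime_solution[OF _ p(1)] by blast
  define k where "k = scal (int a) \<otimes>\<^bsub>W\<^esub> h"
  have kW: "k \<in> carrier W" using h(1) scal_closed by (simp add: k_def)
  have "[colsum k = colsum (scal (int a)) + colsum h] (mod int r)"
    unfolding k_def by (rule colsum_mult[OF scal_closed h(1)])
  also have "[colsum (scal (int a)) + colsum h = int n * int a + colsum h] (mod int r)"
    by (rule cong_add[OF colsum_scal cong_refl])
  finally have "int p dvd colsum k" using a dvd_cong by (simp add: add.commute)
  then have kG: "k \<in> carrier Gp" using kW by (simp add: carrier_Gp)
  have bW: "wr_bar r n g \<in> carrier W" by (rule bar_closed[OF gW])
  have "wr_bar r n g \<otimes>\<^bsub>W\<^esub> k = wr_bar r n g \<otimes>\<^bsub>W\<^esub> scal (int a) \<otimes>\<^bsub>W\<^esub> h"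
    unfolding k_def by (rule W.m_assoc[OF bW scal_closed h(1), symmetric])
  also have "\<dots> = scal (int a) \<otimes>\<^bsub>W\<^esub> wr_bar r n g \<otimes>\<^bsub>W\<^esub> h" by (simp only: scal_central[OF bW])
  also have "\<dots> = scal (int a) \<otimes>\<^bsub>W\<^esub> (h \<otimes>\<^bsub>W\<^esub> inv\<^bsub>W\<^esub> g)"
    unfolding h(2)[symmetric] by (rule W.m_assoc[OF scal_closed bW h(1)])
  also have "\<dots> = k \<otimes>\<^bsub>W\<^esub> inv\<^bsub>W\<^esub> g"
    unfolding k_def by (rule W.m_assoc[OF scal_closed h(1) W.inv_closed[OF gW], symmetric])
  finally have "wr_bar r n g = k \<otimes>\<^bsub>W\<^esub> inv\<^bsub>W\<^esub> g \<otimes>\<^bsub>W\<^esub> inv\<^bsub>W\<^esub> k"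
    using W.m_assoc[OF bW kW W.inv_closed[OF kW]] kW bW by simp
  then show ?thesis using kG g by (auto simp: inv_Gp)
qed

lemma gelfand_model_if:
  assumes "coprime p n" "odd p \<or> odd (r div p)"
  shows "gelfand_model Gp (sym_elts r p n) (rho r p n)"
  unfolding gelfand_model_def
proof (intro conjI ballI)
  show rep: "representation Gp (sym_elts r p n) (rho r p n)" by (rule rho_representation)
  fix g assume g: "g \<in> carrier Gp"
  obtain d M where M: "matrep Gp d M" "\<And>g. mat_trace (M g) = of_rat (rep_character (sym_elts r p n) (rho r p n) g)"
    using matrep_of_rat_representation[OF rep] by blast
  have "mat_trace (M g) = (\<Sum>\<psi>\<in>Irr Gp. \<psi> g)"
  proof (rule Gp.sum_Irr_eq_if_twisted_roots[OF M(1) _ conj_Gp[OF assms(1)] g])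
    fix g assume "g \<in> carrier Gp"
    then show "mat_trace (M g) = of_nat (card (Gp.twisted_roots g))"
      unfolding M(2) rho_character twisted_roots_eq by (simp only: sum_sign_Gp[OF assms] of_rat_of_nat_eq)
  qed
  then show "of_rat (rep_character (sym_elts r p n) (rho r p n) g) = (\<Sum>\<psi>\<in>Irr Gp. \<psi> g)" unfolding M(2) .
qed

text \<open>Either alternative makes \<open>n * (r / 2)\<close> a multiple of \<open>p\<close>, so
  \<open>half\<close> belongs to the group. All basis elements have even colour sum because
  \<open>p\<close> is even, hence \<open>half\<close> has the same character value as the
  identity.\<close>

lemma not_gelfand_model_even:
  assumes n: "n > 0" and even: "even p" "even n \<or> even (r div p)"
  shows "\<not> gelfand_model Gp (sym_elts r p n) (rho r p n)"
proof
  assume "gelfand_model Gp (sym_elts r p n) (rho r p n)"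
  then have gm: "of_rat (rep_character (sym_elts r p n) (rho r p n) g) = (\<Sum>\<psi>\<in>Irr Gp. \<psi> g)" if "g \<in> carrier Gp" for g
    using that by (simp add: gelfand_model_def)
  have er: "even r" using even(1) p(2) by (rule dvd_trans)
  have "int p dvd int n * (int r div 2)"
  proof -
    from p(2) obtain k where k: "r = p * k" by blast
    have kk: "r div p = k" using k p(1) by simp
    have "p dvd n * (r div 2)" using even(2)
    proof
      assume "even n"
      then obtain m where "n = 2 * m" by (rule evenE)
      then have "n * (r div 2) = m * r" using er by (simp add: mult.assoc[symmetric] mult.commute)
      then show ?thesis using p(2) by simp
    next
      assume "even (r div p)"
      then obtain m where "k = 2 * m" unfolding kk by (rule evenE)
      then have "r div 2 = p * m" using k by simp
      then show ?thesis by simp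
    qed
    then have "int p dvd int (n * (r div 2))" by (simp only: int_dvd_int_iff)
    then show ?thesis by (simp add: zdiv_int)
  qed
  then have "int p dvd colsum half" using dvd_cong[OF colsum_scal[of "int r div 2"]] by (simp add: half_def)
  then have hG: "half \<in> carrier Gp" using half_closed by (simp add: carrier_Gp)
  have fh: "fixed half = fixed \<one>\<^bsub>W\<^esub>" unfolding fixed_one by (auto simp: fixed_def twist_half[OF er])
  have "rep_character (sym_elts r p n) (rho r p n) half = rep_character (sym_elts r p n) (rho r p n) \<one>\<^bsub>W\<^esub>"
    unfolding rho_character fh
  proof (rule sum.cong[OF refl])
    fix \<omega> assume \<omega>: "\<omega> \<in> {\<omega> \<in> fixed \<one>\<^bsub>W\<^esub>. int p dvd colsum \<omega>}"
    then have sym: "is_sym \<omega>" by (simp add: fixed_def)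
    have "2 dvd int p" using even(1) by simp
    then have "even (colsum \<omega>)" using \<omega> by (auto intro: dvd_trans)
    then show "sign_rn r n half \<omega> = sign_rn r n \<one>\<^bsub>W\<^esub> \<omega>" using sign_half[OF er sym] sign_one[OF sym] by simp
  qed
  then have "(\<Sum>\<psi>\<in>Irr Gp. \<psi> half) = (\<Sum>\<psi>\<in>Irr Gp. \<psi> \<one>\<^bsub>Gp\<^esub>)"
    using gm[OF hG] gm[OF Gp.one_closed] by simp
  then have "half = \<one>\<^bsub>Gp\<^esub>"
    by (rule Gp.central_involution_trivial[OF hG, rotated 2])
      (use half_half[OF er] scal_central in \<open>auto simp: half_def carrier_Gp\<close>)
  then show False using half_neq_one[OF er n] by simp
qed

text \<open>The dimension of the model is the number of twisted roots of the identity. A Gelfand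
  model of this dimension would make bar and inverse conjugate within the group for every element,
  which an \<open>n\<close>-cycle refutes.\<close>

lemma not_gelfand_model_odd:
  assumes n: "n > 0" and d: "odd (gcd p n)" "gcd p n > 1"
  shows "\<not> gelfand_model Gp (sym_elts r p n) (rho r p n)"
proof
  assume "gelfand_model Gp (sym_elts r p n) (rho r p n)"
  then have gm: "of_rat (rep_character (sym_elts r p n) (rho r p n) g) = (\<Sum>\<psi>\<in>Irr Gp. \<psi> g)" if "g \<in> carrier Gp" for g
    using that by (simp add: gelfand_model_def)
  define d where "d = gcd p n"
  have d3: "d \<ge> 3" using d by (metis One_nat_def Suc_1 Suc_leI d_def dvd_refl le_neq_implies_less numeral_3_eq_3)
  have dn: "d dvd n" "d dvd p" "d dvd r" using p(2) by (auto simp: d_def intro: dvd_trans)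
  have n3: "n \<ge> 3" using d3 dvd_imp_le[OF dn(1) n] by simp
  have r3: "r \<ge> 3" using d3 dvd_imp_le[OF dn(3) r] by simp
  have "rep_character (sym_elts r p n) (rho r p n) \<one>\<^bsub>W\<^esub> = of_nat (card (Gp.twisted_roots \<one>\<^bsub>W\<^esub>))"
  proof -
    have "rep_character (sym_elts r p n) (rho r p n) \<one>\<^bsub>W\<^esub> = (\<Sum>\<omega>\<in>{\<omega> \<in> fixed \<one>\<^bsub>W\<^esub>. int p dvd colsum \<omega>}. 1)"
      unfolding rho_character by (intro sum.cong refl sign_one) (simp add: fixed_def)
    then show ?thesis unfolding twisted_roots_eq fixed_one roots_one by simp
  qed
  then have "of_nat (card (Gp.twisted_roots \<one>\<^bsub>Gp\<^esub>)) = (\<Sum>\<psi>\<in>Irr Gp. \<psi> \<one>\<^bsub>Gp\<^esub>)"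
    using gm[OF Gp.one_closed] by simp
  note conj = Gp.conj_if_sum_Irr_one[OF this]
  \<comment> \<open>This \<open>n\<close>-cycle adds 1 to a point, also modulo \<open>d\<close> at
    the wrap-around, because \<open>d\<close> divides \<open>n\<close>.\<close>
  define c where "c i = (if i \<in> {1..<n} then Suc i else if i = n then 1 else i)" for i
  have cN: "c i \<in> N" if "i \<in> N" for i using that n3 by (auto simp: c_def)
  have "inj_on c N" by (auto simp: inj_on_def c_def)
  moreover from this have "c ` N = N" using cN by (intro endo_inj_surj image_subsetI) simp_all
  ultimately have "bij_betw c N N" by (simp only: bij_betw_def)
  then have c: "c permutes N" by (rule bij_imp_permutes) (use n in \<open>auto simp: c_def\<close>)
  \<comment> \<open>Opposite colours at two neighbours: the colour sum is 0 modulo \<open>r\<close>,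
    but the moment, the sum of all \<open>i * x i\<close>, is -1 modulo \<open>d\<close>. The moment
    is what obstructs the conjugation.\<close>
  define x where "x = (\<lambda>i\<in>N. if i = 1 then 1 else if i = 2 then int r - 1 else 0)"
  have xN: "x i = (if i = 1 then 1 else if i = 2 then int r - 1 else 0)" if "i \<in> N" for i using that by (simp add: x_def)
  have gW: "(x, c) \<in> carrier W" using c r r3 by (auto simp: carrier_wreath x_def)
  have sumx: "(\<Sum>i\<in>N. f i * x i) = f 1 + f 2 * (int r - 1)" for f :: "nat \<Rightarrow> int"
  proof -
    have "(\<Sum>i\<in>N. f i * x i) = (\<Sum>i\<in>N. (if i = 1 then f 1 else 0) + (if i = 2 then f 2 * (int r - 1) else 0))"
      by (intro sum.cong refl) (auto simp: xN)
    then show ?thesis using n3 by (simp add: sum.distrib)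
  qed
  have "colsum (x, c) = int r" using sumx[of "\<lambda>_. 1"] by (simp add: colsum_def)
  then have gG: "(x, c) \<in> carrier Gp" using gW p(2) by (simp add: carrier_Gp)
  obtain k where kG: "k \<in> carrier Gp" and k: "wr_bar r n (x, c) = k \<otimes>\<^bsub>W\<^esub> inv\<^bsub>W\<^esub> (x, c) \<otimes>\<^bsub>W\<^esub> inv\<^bsub>W\<^esub> k"
    using conj[OF gG] by (auto simp: inv_Gp gG)
  have kW: "k \<in> carrier W" and pk: "int p dvd colsum k" using kG by (auto simp: carrier_Gp)
  obtain t \<theta> where t: "k = (t, \<theta>)" and \<theta>: "\<theta> permutes N" using kW by (rule W_cases)
  have bk: "wr_bar r n (x, c) \<otimes>\<^bsub>W\<^esub> k = k \<otimes>\<^bsub>W\<^esub> inv\<^bsub>W\<^esub> (x, c)"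
    unfolding k using kW gW by (simp add: W.m_assoc)
  note eq = bk[unfolded t W_bar[OF gW] W_inv[OF gW] wreath_mult[OF \<theta>] wreath_mult[OF permutes_inv[OF c]] prod.inject]
  have \<theta>N: "\<theta> i \<in> N" if "i \<in> N" for i using permutes_in_image[OF \<theta>] that by simp
  have invc: "inv' c (c i) = i" for i using permutes_inverses(2)[OF c] .
  \<comment> \<open>The permutation part of the conjugation equation and, reduced modulo
    \<open>d\<close>, its colour part, both read at \<open>c j\<close>.\<close>
  have E1: "c (\<theta> (c j)) = \<theta> j" for j using fun_cong[OF conjunct2[OF eq], of "c j"] by (simp add: invc)
  have E2: "[t (c j) - t j = x (\<theta> (c j)) - x j] (mod int d)" if j: "j \<in> N" for j
  proof -
    note cj = cN[OF j]
    have "((- x (\<theta> (c j))) mod int r + t (c j)) mod int r = (t j + (- x j) mod int r) mod int r"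
      using fun_cong[OF conjunct1[OF eq], of "c j"]
      unfolding restrict_apply'[OF cj] restrict_apply'[OF \<theta>N[OF cj]] invc .
    then have "[- x (\<theta> (c j)) + t (c j) = t j + - x j] (mod int r)"
      unfolding cong_def mod_add_left_eq mod_add_right_eq .
    then have "int r dvd (- x (\<theta> (c j)) + t (c j)) - (t j + - x j)" by (simp only: cong_iff_dvd_diff)
    then have "int d dvd (- x (\<theta> (c j)) + t (c j)) - (t j + - x j)" using dn(3) by (meson dvd_trans int_dvd_int_iff)
    then show ?thesis by (simp add: cong_iff_dvd_diff algebra_simps)
  qed
  have L1: "[int (c j) = int j + 1] (mod int d)" if "j \<in> N" for j
  proof (cases "j = n")
    case True
    then have "int (c j) - (int j + 1) = - int n" using n by (simp add: c_def)
    moreover have "int d dvd - int n" using dn(1) by simp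
    ultimately show ?thesis by (simp only: cong_iff_dvd_diff)
  next
    case False
    then have "c j = Suc j" using that by (auto simp: c_def)
    then show ?thesis by (simp add: add.commute)
  qed
  define a where "a = int (\<theta> 1) + 1"
  \<comment> \<open>A permutation that inverts the cycle is a reflection modulo
    \<open>d\<close>.\<close>
  have S: "[int (\<theta> j) + int j = a] (mod int d)" if "j \<in> N" for j
  proof -
    have "Suc i \<le> n \<Longrightarrow> [int (\<theta> (Suc i)) + int (Suc i) = a] (mod int d)" for i
    proof (induction i)
      case 0
      then show ?case by (simp add: a_def)
    next
      case (Suc i)
      have i: "Suc i \<in> N" "c (Suc i) = Suc (Suc i)" using Suc.prems by (auto simp: c_def)
      have "[int (\<theta> (Suc i)) = int (\<theta> (Suc (Suc i))) + 1] (mod int d)"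
        using L1[OF \<theta>N[OF cN[OF i(1)]]] E1[of "Suc i"] unfolding i(2) by (simp only:)
      then have "[int (\<theta> (Suc (Suc i))) + 1 + int (Suc i) = int (\<theta> (Suc i)) + int (Suc i)] (mod int d)"
        by (intro cong_add cong_refl) (rule cong_sym)
      also have "[int (\<theta> (Suc i)) + int (Suc i) = a] (mod int d)" using Suc by simp
      finally show ?case by (simp add: algebra_simps)
    qed
    from this[of "j - 1"] show ?thesis using that by simp
  qed
  have "bij_betw (\<theta> \<circ> c) N N" by (rule permutes_imp_bij[OF permutes_compose[OF c \<theta>]])
  then have re\<theta>c: "(\<Sum>j\<in>N. f (\<theta> (c j))) = (\<Sum>i\<in>N. f i)" for f :: "nat \<Rightarrow> int"
    using sum.reindex_bij_betw[of "\<theta> \<circ> c" N N f] by simp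
  have rec: "(\<Sum>j\<in>N. f (c j)) = (\<Sum>i\<in>N. f i)" for f :: "nat \<Rightarrow> int"
    by (rule sum.reindex_bij_betw[OF permutes_imp_bij[OF c]])
  \<comment> \<open>The colour equations are weighted by \<open>j\<close> and added. Summation by
    parts turns the left side into minus the colour sum of \<open>k\<close>; by the reflection the
    right side is \<open>a - 1\<close> times the sum of \<open>x\<close> minus twice its
    moment.\<close>
  have "[(\<Sum>j\<in>N. int j * (t (c j) - t j)) = (\<Sum>j\<in>N. int j * (x (\<theta> (c j)) - x j))] (mod int d)"
    by (intro cong_sum cong_mult cong_refl E2)
  moreover have "[(\<Sum>j\<in>N. int j * (t (c j) - t j)) = - (\<Sum>i\<in>N. t i)] (mod int d)"
  proof -
    have "[(\<Sum>j\<in>N. int j * (t (c j) - t j)) = (\<Sum>j\<in>N. (int (c j) - 1) * t (c j) - int j * t j)] (mod int d)"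
    proof (rule cong_sum)
      fix j assume "j \<in> N"
      then have "[int (c j) - 1 = int j + 1 - 1] (mod int d)" by (intro cong_diff cong_refl L1)
      then have "[int j * t (c j) - int j * t j = (int (c j) - 1) * t (c j) - int j * t j] (mod int d)"
        by (intro cong_diff cong_mult cong_refl) (simp add: cong_sym)
      then show "[int j * (t (c j) - t j) = (int (c j) - 1) * t (c j) - int j * t j] (mod int d)"
        by (simp only: right_diff_distrib)
    qed
    also have "(\<Sum>j\<in>N. (int (c j) - 1) * t (c j) - int j * t j) = (\<Sum>i\<in>N. (int i - 1) * t i) - (\<Sum>i\<in>N. int i * t i)"
      unfolding sum_subtractf rec[of "\<lambda>i. (int i - 1) * t i"] ..
    also have "\<dots> = - (\<Sum>i\<in>N. t i)" by (simp add: left_diff_distrib sum_subtractf)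
    finally show ?thesis .
  qed
  moreover have "[(\<Sum>j\<in>N. int j * (x (\<theta> (c j)) - x j)) = (a - 1) * int r - 2 * (2 * int r - 1)] (mod int d)"
  proof -
    have "[(\<Sum>j\<in>N. int j * (x (\<theta> (c j)) - x j)) = (\<Sum>j\<in>N. (a - 1 - int (\<theta> (c j))) * x (\<theta> (c j)) - int j * x j)] (mod int d)"
    proof (rule cong_sum)
      fix j assume j: "j \<in> N"
      have "[int (\<theta> j) = int (\<theta> (c j)) + 1] (mod int d)" using L1[OF \<theta>N[OF cN[OF j]]] unfolding E1 .
      then have "[(int (\<theta> j) + int j) - int (\<theta> j) = a - (int (\<theta> (c j)) + 1)] (mod int d)"
        by (rule cong_diff[OF S[OF j]])
      then have "[int j = a - 1 - int (\<theta> (c j))] (mod int d)" by (simp add: algebra_simps)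
      then have "[int j * x (\<theta> (c j)) - int j * x j = (a - 1 - int (\<theta> (c j))) * x (\<theta> (c j)) - int j * x j] (mod int d)"
        by (intro cong_diff cong_mult cong_refl)
      then show "[int j * (x (\<theta> (c j)) - x j) = (a - 1 - int (\<theta> (c j))) * x (\<theta> (c j)) - int j * x j] (mod int d)"
        by (simp only: right_diff_distrib)
    qed
    also have "(\<Sum>j\<in>N. (a - 1 - int (\<theta> (c j))) * x (\<theta> (c j)) - int j * x j) =
        (\<Sum>i\<in>N. (a - 1 - int i) * x i) - (\<Sum>i\<in>N. int i * x i)"
      unfolding sum_subtractf re\<theta>c[of "\<lambda>i. (a - 1 - int i) * x i"] ..
    also have "\<dots> = (a - 1) * int r - 2 * (2 * int r - 1)"
      unfolding sumx by (simp add: algebra_simps)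
    finally show ?thesis .
  qed
  ultimately have "[- (\<Sum>i\<in>N. t i) = (a - 1) * int r - 2 * (2 * int r - 1)] (mod int d)"
    by (meson cong_sym cong_trans)
  then have 1: "int d dvd - (\<Sum>i\<in>N. t i) - ((a - 1) * int r - 2 * (2 * int r - 1))" by (simp only: cong_iff_dvd_diff)
  have "int d dvd (\<Sum>i\<in>N. t i)" using pk dn(2) unfolding t colsum_def by (simp only: fst_conv) (meson dvd_trans int_dvd_int_iff)
  moreover have "int d dvd int r" using dn(3) by simp
  \<comment> \<open>Adding \<open>(a - 5) * r\<close> cancels all multiples of \<open>r\<close> and
    leaves -2, which \<open>d \<ge> 3\<close> does not divide.\<close>
  ultimately have "int d dvd (- (\<Sum>i\<in>N. t i) - ((a - 1) * int r - 2 * (2 * int r - 1))) + (\<Sum>i\<in>N. t i) + (a - 5) * int r"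
    by (intro dvd_add 1 dvd_mult)
  also have "(- (\<Sum>i\<in>N. t i) - ((a - 1) * int r - 2 * (2 * int r - 1))) + (\<Sum>i\<in>N. t i) + (a - 5) * int r = - 2"
    by (simp add: algebra_simps)
  finally have "int d dvd 2" by simp
  then have "int d \<le> 2" by (rule zdvd_imp_le) simp
  then show False using d3 by simp
qed

end

theorem theorem3p1:
  fixes r p n :: nat
  assumes "r > 0" and "p > 0" and "n > 0" and "p dvd r"
  shows "gelfand_model (Grpn r p n) (sym_elts r p n) (rho r p n) \<longleftrightarrow>
           gcd p n = 1 \<and> (odd p \<or> odd (r div p))"
proof -
  interpret complex_reflection r n p by unfold_locales (use assms in auto)
  show ?thesis
  proof
    assume gm: "gelfand_model (Grpn r p n) (sym_elts r p n) (rho r p n)"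
    then have *: "\<not> (even p \<and> (even n \<or> even (r div p)))" using not_gelfand_model_even[OF assms(3)] by blast
    have "gcd p n = 1"
    proof (rule ccontr)
      assume "gcd p n \<noteq> 1"
      moreover have "gcd p n > 0" using assms(2) by simp
      ultimately have "gcd p n > 1" by linarith
      \<comment> \<open>An even gcd would make both \<open>p\<close> and \<open>n\<close> even,
        which is already excluded.\<close>
      moreover have "odd (gcd p n)" using * not_gelfand_model_odd[OF assms(3)] gm by auto
      ultimately show False using not_gelfand_model_odd[OF assms(3)] gm by blast
    qed
    then show "gcd p n = 1 \<and> (odd p \<or> odd (r div p))" using * by blast
  next
    assume "gcd p n = 1 \<and> (odd p \<or> odd (r div p))"
    then show "gelfand_model (Grpn r p n) (sym_elts r p n) (rho r p n)"
      using gelfand_model_if by (simp add: coprime_iff_gcd_eq_1)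
  qed
qed

end
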